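(* Let $PSL(2,\mathbb{R})$ act in the natural way on the projective line $\mathbb{P}^1$ of lines through the origin in $\mathbb{R}^2$. Then the dynamical system $(\mathbb{P}^1, PSL(2,\mathbb{R}))$ is affinely prime. Equivalently, the group $G$ of M\"obius transformations preserving the unit disk, acting on the circle $S^1=\{\zeta\in\mathbb{C}:|\zeta|=1\}$, has the linear Stone-Weierstrass property (LSW): for every non-constant $f\in C(S^1)$ (real valued), the uniformly closed linear span of $\{f^g : g\in G\}\cup\{\mathbf{1}\}$ is all of $C(S^1)$, where $f^g(x)=f(gx)$.
   Context: A dynamical system $(X,G)$ consists of a nonempty compact metric space $X$ and a topological group $G$ acting on $X$ via a continuous homomorphism $G\to\mathrm{Homeo}(X)$ (compact-open topology). $C(X)$ is the Banach algebra of real valued continuous functions on $X$ with the uniform norm, and $\mathbf{1}$ is the constant function $1$. $M(X)$ is the space of Borel probability measures on $X$ with the weak$^*$ topology inherited from $C(X)^*$; $G$ acts on it by push-forward. An affine dynamical system $(Q,G)$ is a nonempty compact convex metrizable subset $Q$ of a locally convex topological vector space on which $G$ acts continuously by continuous affine maps. A system is nontrivial if it has more than one point. An affine homomorphism is a continuous affine $G$-equivariant map. $(Q,G)$ is affinely prime if every surjective affine homomorphism $\pi:Q\to Q'$ onto a nontrivial affine dynamical system $(Q',G)$ is one-to-one. A dynamical system $(X,G)$ is affinely prime if the affine system $(M(X),G)$ is affinely prime. The group of M\"obius transformations preserving the unit disk $D=\{z\in\mathbb{C}:|z|<1\}$ is $G=\{z\mapsto \frac{az+\bar c}{cz+\bar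 a} : a,c\in\mathbb{C},\ a\bar a-c\bar c=1\}$; it is topologically isomorphic to $PSL(2,\mathbb{R})$, and the action of $G$ on $S^1$ is (under this isomorphism) isomorphic to the action of $PSL(2,\mathbb{R})$ on $\mathbb{P}^1$. *)

theory Defs
  imports
    "HOL-Analysis.Analysis"
    "HOL-Probability.Probability_Measure"
    "HOL-Algebra.Coset"
    "HOL-Algebra.Group_Action"
begin

section \<open>Dynamical systems\<close>

definition topological_group :: "'g monoid \<Rightarrow> 'g topology \<Rightarrow> bool" where
  "topological_group G TG \<longleftrightarrow>
     group G \<and> topspace TG = carrier G \<and>
     continuous_map (prod_topology TG TG) TG (\<lambda>(x, y). x \<otimes>\<^bsub>G\<^esub> y) \<and>
     continuous_map TG TG (\<lambda>x. inv\<^bsub>G\<^esub> x)"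

text \<open>As in \<^const>\<open>Bij\<close>, self-maps of a space are taken to be extensional on its carrier, so that
  equal maps are equal as HOL functions.\<close>

definition Homeo :: "'x topology \<Rightarrow> ('x \<Rightarrow> 'x) set" where
  "Homeo X = {h \<in> extensional (topspace X). homeomorphic_map X X h}"

definition Homeo_topology :: "'x topology \<Rightarrow> ('x \<Rightarrow> 'x) topology" where
  "Homeo_topology X =
     topology_generated_by {{h \<in> Homeo X. h ` K \<subseteq> U} | K U. compactin X K \<and> openin X U}"

definition dynamical_system ::
    "'x topology \<Rightarrow> 'g monoid \<Rightarrow> 'g topology \<Rightarrow> ('g \<Rightarrow> 'x \<Rightarrow> 'x) \<Rightarrow> bool" where
  "dynamical_system X G TG \<phi> \<longleftrightarrow>
     topspace X \<noteq> {} \<and> compact_space X \<and> metrizable_space X \<and>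
     topological_group G TG \<and>
     group_action G (topspace X) \<phi> \<and>
     continuous_map TG (Homeo_topology X) \<phi>"

section \<open>Affine dynamical systems\<close>

text \<open>Topologies on the vector space are explicit, so that the weak* topology can be used on a dual
  space whose type already carries the norm topology. No separation axiom is imposed.\<close>

definition locally_convex_tvs :: "'v::real_vector topology \<Rightarrow> bool" where
  "locally_convex_tvs T \<longleftrightarrow>
     topspace T = UNIV \<and>
     continuous_map (prod_topology T T) T (\<lambda>(x, y). x + y) \<and>
     continuous_map (prod_topology euclideanreal T) T (\<lambda>(r, x). r *\<^sub>R x) \<and>
     (\<forall>U. openin T U \<and> 0 \<in> U \<longrightarrow> (\<exists>V. openin T V \<and> convex V \<and> 0 \<in> V \<and> V \<subseteq> U))"

definition affine_map_on :: "'v::real_vector set \<Rightarrow> ('v \<Rightarrow> 'w::real_vector) \<Rightarrow> bool" where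
  "affine_map_on Q p \<longleftrightarrow>
     (\<forall>x\<in>Q. \<forall>y\<in>Q. \<forall>t\<in>{0..1}. p ((1 - t) *\<^sub>R x + t *\<^sub>R y) = (1 - t) *\<^sub>R p x + t *\<^sub>R p y)"

definition affine_dynamical_system ::
    "'v::real_vector topology \<Rightarrow> 'v set \<Rightarrow> 'g monoid \<Rightarrow> 'g topology \<Rightarrow> ('g \<Rightarrow> 'v \<Rightarrow> 'v) \<Rightarrow> bool" where
  "affine_dynamical_system T Q G TG \<phi> \<longleftrightarrow>
     locally_convex_tvs T \<and> convex Q \<and>
     dynamical_system (subtopology T Q) G TG \<phi> \<and>
     (\<forall>g\<in>carrier G. affine_map_on Q (\<phi> g))"

definition affine_homomorphism ::
    "'v::real_vector topology \<Rightarrow> 'v set \<Rightarrow> ('g \<Rightarrow> 'v \<Rightarrow> 'v) \<Rightarrow>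
     'w::real_vector topology \<Rightarrow> 'w set \<Rightarrow> ('g \<Rightarrow> 'w \<Rightarrow> 'w) \<Rightarrow>
     'g monoid \<Rightarrow> ('v \<Rightarrow> 'w) \<Rightarrow> bool" where
  "affine_homomorphism T Q \<phi> T' Q' \<phi>' G p \<longleftrightarrow>
     continuous_map (subtopology T Q) (subtopology T' Q') p \<and>
     affine_map_on Q p \<and>
     (\<forall>g\<in>carrier G. \<forall>x\<in>Q. p (\<phi> g x) = \<phi>' g (p x))"

text \<open>The vector space containing the target system ranges over all topologies on the type
  \<open>'w\<close>; a theorem with \<open>'w\<close> left free covers targets in arbitrary locally convex spaces.\<close>

definition affinely_prime ::
    "'w::real_vector itself \<Rightarrow> 'v::real_vector topology \<Rightarrow> 'v set \<Rightarrow>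
     'g monoid \<Rightarrow> 'g topology \<Rightarrow> ('g \<Rightarrow> 'v \<Rightarrow> 'v) \<Rightarrow> bool" where
  "affinely_prime (_ :: 'w itself) T Q G TG \<phi> \<longleftrightarrow>
     affine_dynamical_system T Q G TG \<phi> \<and>
     (\<forall>(T' :: 'w topology) Q' \<phi>' p.
        affine_dynamical_system T' Q' G TG \<phi>' \<and> (\<exists>x\<in>Q'. \<exists>y\<in>Q'. x \<noteq> y) \<and>
        affine_homomorphism T Q \<phi> T' Q' \<phi>' G p \<and> p ` Q = Q'
        \<longrightarrow> inj_on p Q)"

section \<open>The system of probability measures\<close>

definition borel_prob_measures :: "'x::topological_space measure set" where
  "borel_prob_measures = {\<mu>. prob_space \<mu> \<and> sets \<mu> = sets borel}"

definition integral_functional ::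
    "'x::topological_space measure \<Rightarrow> ('x \<Rightarrow>\<^sub>C real) \<Rightarrow>\<^sub>L real" where
  "integral_functional \<mu> = Blinfun (\<lambda>f. \<integral>x. apply_bcontfun f x \<partial>\<mu>)"

text \<open>\<open>M(X)\<close>, as a subset of the dual of \<open>C(X)\<close>.\<close>

definition prob_functionals :: "(('x::topological_space \<Rightarrow>\<^sub>C real) \<Rightarrow>\<^sub>L real) set" where
  "prob_functionals = integral_functional ` borel_prob_measures"

text \<open>For real-valued operators the strong operator topology is pointwise convergence on
  \<open>C(X)\<close>, that is, the weak* topology of \<open>C(X)\<close>'s dual.\<close>

abbreviation weak_star_topology ::
    "(('x::topological_space \<Rightarrow>\<^sub>C real) \<Rightarrow>\<^sub>L real) topology" where
  "weak_star_topology \<equiv> strong_operator_topology"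

text \<open>The choice of the representing measure does not matter, because the integrals of continuous
  functions against the push-forward are determined by the functional.\<close>

definition push_forward_action ::
    "('g \<Rightarrow> 'x \<Rightarrow> 'x) \<Rightarrow> 'g \<Rightarrow>
     (('x::topological_space \<Rightarrow>\<^sub>C real) \<Rightarrow>\<^sub>L real) \<Rightarrow> (('x \<Rightarrow>\<^sub>C real) \<Rightarrow>\<^sub>L real)" where
  "push_forward_action \<phi> g =
     restrict
       (\<lambda>\<Lambda>. integral_functional
              (distr (inv_into borel_prob_measures integral_functional \<Lambda>) borel (\<phi> g)))
       prob_functionals"

definition affinely_prime_system ::
    "'w::real_vector itself \<Rightarrow> 'g monoid \<Rightarrow> 'g topology \<Rightarrow>
     ('g \<Rightarrow> 'x::topological_space \<Rightarrow> 'x) \<Rightarrow> bool" where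
  "affinely_prime_system W G TG \<phi> \<longleftrightarrow>
     dynamical_system (euclidean :: 'x topology) G TG \<phi> \<and>
     affinely_prime W weak_star_topology prob_functionals G TG (push_forward_action \<phi>)"

section \<open>The linear Stone--Weierstrass property\<close>

definition linear_stone_weierstrass ::
    "'g set \<Rightarrow> ('g \<Rightarrow> 'x::topological_space \<Rightarrow> 'x) \<Rightarrow> bool" where
  "linear_stone_weierstrass S \<phi> \<longleftrightarrow>
     (\<forall>f :: 'x \<Rightarrow>\<^sub>C real. (\<nexists>c. \<forall>x. apply_bcontfun f x = c) \<longrightarrow>
        closure (span ({h. \<exists>g\<in>S. \<forall>x. apply_bcontfun h x = apply_bcontfun f (\<phi> g x)}
                       \<union> {const_bcontfun 1})) = UNIV)"

section \<open>The projective line and the projective special linear group\<close>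

typedef proj_line = "{L :: (real^2) set. subspace L \<and> dim L = 1}"
proof
  show "span {axis 1 1 :: real^2} \<in> {L. subspace L \<and> dim L = 1}"
    by (simp add: dim_span dim_singleton axis_eq_0_iff)
qed

text \<open>The quotient topology from the nonzero vectors of the plane.\<close>

instantiation proj_line :: topological_space
begin

definition open_proj_line :: "proj_line set \<Rightarrow> bool" where
  "open_proj_line U \<longleftrightarrow> open {v :: real^2. v \<noteq> 0 \<and> Abs_proj_line (span {v}) \<in> U}"

instance
proof
  show "open (UNIV :: proj_line set)"
    by (simp add: open_proj_line_def) (use open_Compl[of "{0::real^2}"] in \<open>simp add: Compl_eq\<close>)
  show "open (U \<inter> V)" if "open U" "open V" for U V :: "proj_line set"
  proof -
    have "{v :: real^2. v \<noteq> 0 \<and> Abs_proj_line (span {v}) \<in> U \<inter> V} =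
      {v. v \<noteq> 0 \<and> Abs_proj_line (span {v}) \<in> U} \<inter> {v. v \<noteq> 0 \<and> Abs_proj_line (span {v}) \<in> V}"
      by auto
    then show ?thesis using that by (simp add: open_proj_line_def open_Int)
  qed
  show "open (\<Union>K)" if "\<forall>U\<in>K. open U" for K :: "proj_line set set"
  proof -
    have "{v :: real^2. v \<noteq> 0 \<and> Abs_proj_line (span {v}) \<in> \<Union>K} =
      (\<Union>U\<in>K. {v. v \<noteq> 0 \<and> Abs_proj_line (span {v}) \<in> U})"
      by auto
    then show ?thesis using that unfolding open_proj_line_def by (metis (no_types, lifting) open_UN)
  qed
qed

end

definition SL2R :: "(real^2^2) monoid" where
  "SL2R = \<lparr>carrier = {A. det A = 1}, mult = (**), one = mat 1\<rparr>"

definition PSL2R :: "(real^2^2) set monoid" where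
  "PSL2R = SL2R Mod {mat 1, - mat 1}"

text \<open>The quotient topology from \<open>SL2R\<close>.\<close>

definition PSL2R_topology :: "(real^2^2) set topology" where
  "PSL2R_topology =
     topology (\<lambda>U. U \<subseteq> carrier PSL2R \<and>
       openin (top_of_set (carrier SL2R))
              {A \<in> carrier SL2R. {mat 1, - mat 1} #>\<^bsub>SL2R\<^esub> A \<in> U})"

lemma openin_PSL2R_topology:
  "openin PSL2R_topology U \<longleftrightarrow> U \<subseteq> carrier PSL2R \<and>
     openin (top_of_set (carrier SL2R)) {A \<in> carrier SL2R. {mat 1, - mat 1} #>\<^bsub>SL2R\<^esub> A \<in> U}"
proof -
  let ?pre = "\<lambda>U. {A \<in> carrier SL2R. {mat 1, - mat 1} #>\<^bsub>SL2R\<^esub> A \<in> U}"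
  let ?P = "\<lambda>U. U \<subseteq> carrier PSL2R \<and> openin (top_of_set (carrier SL2R)) (?pre U)"
  have "istopology ?P"
    unfolding istopology_def
  proof (intro conjI allI impI)
    fix U V assume U: "?P U" and V: "?P V"
    have "?pre (U \<inter> V) = ?pre U \<inter> ?pre V" by auto
    then show "openin (top_of_set (carrier SL2R)) (?pre (U \<inter> V))"
      using U V by (metis (no_types, lifting) openin_Int)
    show "U \<inter> V \<subseteq> carrier PSL2R" using U by auto
  next
    fix K assume K: "\<forall>U\<in>K. ?P U"
    have "?pre (\<Union>K) = (\<Union>U\<in>K. ?pre U)" by auto
    moreover have "openin (top_of_set (carrier SL2R)) (\<Union>U\<in>K. ?pre U)"
      using K by (intro openin_Union) auto
    ultimately show "openin (top_of_set (carrier SL2R)) (?pre (\<Union>K))" by (metis (no_types, lifting))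
    show "\<Union>K \<subseteq> carrier PSL2R" using K by auto
  qed
  then show ?thesis unfolding PSL2R_topology_def by (simp add: topology_inverse')
qed

text \<open>Both matrices in a coset map a line to the same line, so the union below is that line.\<close>

definition PSL2R_action :: "(real^2^2) set \<Rightarrow> proj_line \<Rightarrow> proj_line" where
  "PSL2R_action a L = Abs_proj_line (\<Union>A\<in>a. (\<lambda>v. A *v v) ` Rep_proj_line L)"

section \<open>The circle and the Moebius group of the disk\<close>

typedef circle = "sphere (0 :: complex) 1"
  by (rule exI[of _ 1]) simp

instantiation circle :: topological_space
begin

definition open_circle :: "circle set \<Rightarrow> bool" where
  "open_circle U \<longleftrightarrow> (\<exists>V. open V \<and> U = Rep_circle -` V)"

instance
proof
  show "open (UNIV :: circle set)"
    unfolding open_circle_def by (rule exI[of _ UNIV]) simp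
  show "open (U \<inter> V)" if "open U" "open V" for U V :: "circle set"
    using that unfolding open_circle_def by (metis open_Int vimage_Int)
  show "open (\<Union>K)" if "\<forall>U\<in>K. open U" for K :: "circle set set"
  proof -
    obtain V where "\<forall>U\<in>K. open (V U) \<and> U = Rep_circle -` V U"
      using \<open>\<forall>U\<in>K. open U\<close> unfolding open_circle_def by metis
    then have "open (\<Union>U\<in>K. V U)" and "\<Union>K = Rep_circle -` (\<Union>U\<in>K. V U)"
      by auto
    then show ?thesis unfolding open_circle_def by blast
  qed
qed

end

text \<open>For \<open>a * cnj a - c * cnj c = 1\<close> the pole lies outside the closed unit disk, so the value
  that HOL assigns to the map there is irrelevant.\<close>

definition disk_moebius_group :: "(complex \<Rightarrow> complex) set" where
  "disk_moebius_group =
     {(\<lambda>z. (a * z + cnj c) / (c * z + cnj a)) | a c. a * cnj a - c * cnj c = 1}"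

definition circle_action :: "(complex \<Rightarrow> complex) \<Rightarrow> circle \<Rightarrow> circle" where
  "circle_action g \<zeta> = Abs_circle (g (Rep_circle \<zeta>))"

end

theory Submission
  imports Defs "HOL-Probability.Helly_Selection" "HOL-Probability.Probability_Mass_Function"
begin

text \<open>A closed invariant subspace \<open>V\<close> of \<open>C(S\<^sup>1)\<close> is invariant under rotations, hence contains the
  Fourier components of its elements, and some component of order \<open>n \<ge> 1\<close> of a non-constant function
  is nonzero. Differentiating \<open>Re (a z\<^sup>n)\<close> along the hyperbolic one-parameter group gives a multiple
  of \<open>Re (a (z\<^bsup>n-1\<^esup> - z\<^bsup>n+1\<^esup>))\<close>, so from order \<open>n\<close> one reaches all orders, and \<open>V = C(S\<^sup>1)\<close> by
  Stone--Weierstrass. For affine primeness, let \<open>p\<close> map \<open>M(X)\<close> onto a nontrivial \<open>Q'\<close>. By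
  Hahn--Banach some continuous affine \<open>l\<close> is non-constant on \<open>Q'\<close>; then \<open>l (p \<mu>) = \<integral> f d\<mu>\<close> for the
  non-constant function \<open>f x = l (p \<delta>\<^sub>x)\<close>, and \<open>p \<mu> = p \<nu>\<close> forces \<open>\<mu>\<close> and \<open>\<nu>\<close> to agree on all
  translates of \<open>f\<close>, hence everywhere.\<close>

section \<open>Separation in locally convex spaces\<close>

text \<open>Of the stated equivalence, one direction is used: (LSW) for the matrix action yields
  affine primeness. (LSW) for the Moebius action comes from the same lemma of the locale
  \<open>circle_homeomorphism\<close>, not through an isomorphism of groups. That locale works on
  any space with a coordinate \<open>e\<close> onto the unit circle, so each group has only to
  exhibit its rotations and the maps \<open>boost s\<close> with small positive \<open>s\<close>. On
  the projective line the coordinate is the doubled angle v / cnj v, which is why half angles appear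
  in the matrices. Two obstacles shape the rest. The target of \<open>p\<close> lies in an arbitrary
  vector space with an explicit topology, possibly not Hausdorff, so separation is built from
  sublinear functionals and starts from two points that the metrizable space \<open>Q'\<close>
  already separates. And affine primeness includes the claim that \<open>M(X)\<close> is itself a
  compact metrizable system; sequences of trigonometric moments embed it in a countable product of
  planes, where convergent sequences decide everything.\<close>

definition sublinear :: "('v::real_vector \<Rightarrow> real) \<Rightarrow> bool" where
  "sublinear q \<longleftrightarrow> (\<forall>x y. q (x + y) \<le> q x + q y) \<and> (\<forall>t\<ge>0. \<forall>x. q (t *\<^sub>R x) \<le> t * q x)"

lemma sublinearD:
  assumes "sublinear q"
  shows "q (x + y) \<le> q x + q y" "0 \<le> t \<Longrightarrow> q (t *\<^sub>R x) \<le> t * q x" "- q (- x) \<le> q x" "q 0 = 0"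
proof -
  show *: "q (x + y) \<le> q x + q y" "0 \<le> t \<Longrightarrow> q (t *\<^sub>R x) \<le> t * q x" for x y t
    using assms by (auto simp: sublinear_def)
  show "q 0 = 0" using *(1)[of 0 0] *(2)[of 0 0] by simp
  then show "- q (- x) \<le> q x" using *(1)[of x "-x"] by simp
qed

text \<open>\<open>m x\<close> is the infimum of \<open>q (x + t *\<^sub>R a) - t * q a\<close> over
  \<open>t \<ge> 0\<close>. Taking \<open>x = - a\<close> and \<open>t = 1\<close> gives
  \<open>m (- a) \<le> - q a\<close>, so a linear functional below \<open>m\<close> must take the
  value \<open>q a\<close> at \<open>a\<close>.\<close>

lemma sublinear_shift:
  assumes q: "sublinear q"
  obtains m where "sublinear m" "\<And>x. m x \<le> q x" "\<And>x t. 0 \<le> t \<Longrightarrow> m x \<le> q (x + t *\<^sub>R a) - t * q a"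
proof
  define m where "m x = (INF t\<in>{0..}. q (x + t *\<^sub>R a) - t * q a)" for x
  \<comment> \<open>A lower bound independent of \<open>t\<close>: subadditivity gives
    \<open>q (t *\<^sub>R a) \<le> q (x + t *\<^sub>R a) + q (- x)\<close>, and scaling back by the
    inverse of \<open>t\<close> gives \<open>t * q a \<le> q (t *\<^sub>R a)\<close>.\<close>
  have bdd: "bdd_below ((\<lambda>t. q (x + t *\<^sub>R a) - t * q a) ` {0..})" for x
  proof (rule bdd_belowI2)
    fix t :: real assume "t \<in> {0..}"
    have "q ((x + t *\<^sub>R a) + (- x)) \<le> q (x + t *\<^sub>R a) + q (- x)"
      by (rule sublinearD[OF q])
    moreover have "t * q a \<le> q (t *\<^sub>R a)"
    proof (cases "t = 0")
      case True then show ?thesis by (simp add: sublinearD[OF q])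
    next
      case False
      then have "q (inverse t *\<^sub>R (t *\<^sub>R a)) \<le> inverse t * q (t *\<^sub>R a)"
        using \<open>t \<in> {0..}\<close> by (intro sublinearD[OF q]) auto
      then show ?thesis using False \<open>t \<in> {0..}\<close> by (simp add: field_simps)
    qed
    ultimately show "- q (- x) \<le> q (x + t *\<^sub>R a) - t * q a" by simp
  qed
  show le: "m x \<le> q (x + t *\<^sub>R a) - t * q a" if "0 \<le> t" for x t
    unfolding m_def using that by (intro cINF_lower[OF bdd]) auto
  show "m x \<le> q x" for x using le[of 0 x] by simp
  have add: "m (x + y) \<le> m x + m y" for x y
  proof -
    \<comment> \<open>Shifts \<open>s\<close> for \<open>x\<close> and \<open>t\<close> for
      \<open>y\<close> combine to the shift \<open>s + t\<close> for \<open>x + y\<close>; the two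
      infima are then taken one at a time.\<close>
    have 1: "m (x + y) - (q (x + s *\<^sub>R a) - s * q a) \<le> q (y + t *\<^sub>R a) - t * q a"
      if "0 \<le> s" "0 \<le> t" for s t
    proof -
      have "m (x + y) \<le> q ((x + y) + (s + t) *\<^sub>R a) - (s + t) * q a"
        using that by (intro le) auto
      also have "(x + y) + (s + t) *\<^sub>R a = (x + s *\<^sub>R a) + (y + t *\<^sub>R a)"
        by (simp add: algebra_simps)
      also have "q \<dots> \<le> q (x + s *\<^sub>R a) + q (y + t *\<^sub>R a)"
        by (rule sublinearD[OF q])
      finally show ?thesis by (simp add: algebra_simps)
    qed
    have "m (x + y) - (q (x + s *\<^sub>R a) - s * q a) \<le> m y" if "0 \<le> s" for s
      unfolding m_def[of y] by (rule cINF_greatest) (use 1 that in auto)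
    then have "m (x + y) - m y \<le> m x"
      unfolding m_def[of x] by (intro cINF_greatest) (force simp: algebra_simps)+
    then show ?thesis by simp
  qed
  have scale: "m (c *\<^sub>R x) \<le> c * m x" if "0 \<le> c" for c x
  proof (cases "c = 0")
    case True
    then show ?thesis using le[of 0 0] by (simp add: sublinearD[OF q])
  next
    case False
    have "inverse c * m (c *\<^sub>R x) \<le> m x"
      unfolding m_def[of x]
    proof (rule cINF_greatest)
      fix t :: real assume t: "t \<in> {0..}"
      have "m (c *\<^sub>R x) \<le> q (c *\<^sub>R x + (c * t) *\<^sub>R a) - (c * t) * q a"
        using that t by (intro le) auto
      also have "c *\<^sub>R x + (c * t) *\<^sub>R a = c *\<^sub>R (x + t *\<^sub>R a)" by (simp add: algebra_simps)
      also have "q \<dots> \<le> c * q (x + t *\<^sub>R a)" by (rule sublinearD(2)[OF q that])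
      finally show "inverse c * m (c *\<^sub>R x) \<le> q (x + t *\<^sub>R a) - t * q a"
        using that False by (simp add: field_simps)
    qed auto
    then show ?thesis using that False by (simp add: field_simps)
  qed
  show "sublinear m" unfolding sublinear_def using add scale by blast
qed

text \<open>A minimal sublinear functional is not changed by the shift above, which makes it additive.\<close>

lemma Hahn_Banach_sublinear:
  fixes a :: "'v::real_vector"
  assumes q0: "sublinear q0"
  obtains f :: "'v \<Rightarrow> real" where "linear f" "\<And>x. f x \<le> q0 x" "f a = q0 a"
proof -
  \<comment> \<open>Shifting along \<open>a\<close> before minimising fixes the value at
    \<open>a\<close>: every linear functional below \<open>q\<close> agrees with \<open>q0\<close>
    there.\<close>
  obtain q where q: "sublinear q" "\<And>x. q x \<le> q0 x"
    and qa: "\<And>x t. 0 \<le> t \<Longrightarrow> q x \<le> q0 (x + t *\<^sub>R a) - t * q0 a"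
    using sublinear_shift[OF q0, of a] by metis
  define A where "A = {p. sublinear p \<and> p \<le> q}"
  have "\<exists>m\<in>A. \<forall>p\<in>A. p \<le> m \<longrightarrow> p = m"
  \<comment> \<open>The order is reversed, so that the maximal element given by Zorn's lemma is a
    minimal sublinear functional.\<close>
  proof (rule predicate_Zorn)
    show "partial_order_on A (relation_of (\<lambda>x y. y \<le> x) A)"
      by (auto simp: partial_order_on_def preorder_on_def refl_on_def trans_def antisym_def relation_of_def)
    fix C assume C: "C \<in> Chains (relation_of (\<lambda>x y. y \<le> x) A)"
    then have CA: "C \<subseteq> A" and tot: "\<And>p p'. p \<in> C \<Longrightarrow> p' \<in> C \<Longrightarrow> p \<le> p' \<or> p' \<le> p"
      by (auto simp: Chains_def relation_of_def)
    show "\<exists>u\<in>A. \<forall>p\<in>C. u \<le> p"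
    proof (cases "C = {}")
      case True
      then show ?thesis using q by (auto simp: A_def)
    next
      case False
      define u where "u x = (INF p\<in>C. p x)" for x
      have bdd: "bdd_below ((\<lambda>p. p x) ` C)" for x
      proof (rule bdd_belowI2)
        fix p assume "p \<in> C"
        then have "sublinear p" "p (- x) \<le> q (- x)" using CA by (auto simp: A_def le_fun_def)
        then show "- q (- x) \<le> p x" using sublinearD(3)[of p x] by linarith
      qed
      have le: "u x \<le> p x" if "p \<in> C" for p x
        unfolding u_def using that by (intro cINF_lower[OF bdd])
      have "u (x + y) \<le> u x + u y" for x y
      proof -
        have 1: "u (x + y) - p x \<le> p' y" if "p \<in> C" "p' \<in> C" for p p'
        proof -
          note pp = that
          \<comment> \<open>In a chain one of \<open>p\<close> and \<open>p'\<close> lies below the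
            other; this smaller one serves both points.\<close>
          obtain r where r: "r \<in> C" "r x \<le> p x" "r y \<le> p' y"
            using tot[OF pp] pp by (meson le_funD order_refl)
          then have "sublinear r" using CA by (auto simp: A_def)
          then show ?thesis using le[OF r(1), of "x + y"] sublinearD(1)[of r x y] r by linarith
        qed
        have "u (x + y) - p x \<le> u y" if "p \<in> C" for p
          unfolding u_def[of y] by (rule cINF_greatest[OF False]) (use 1 that in auto)
        then have "u (x + y) - u y \<le> u x"
          unfolding u_def[of x] by (intro cINF_greatest[OF False]) (force simp: algebra_simps)
        then show ?thesis by simp
      qed
      moreover have "u (t *\<^sub>R x) \<le> t * u x" if "0 \<le> t" for t x
      proof (cases "t = 0")
        case True
        obtain p where "p \<in> C" using False by blast
        then have "u 0 \<le> p 0" "p 0 = 0" using le CA by (auto simp: A_def sublinearD)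
        then show ?thesis using True by simp
      next
        case F: False
        have "inverse t * u (t *\<^sub>R x) \<le> u x"
          unfolding u_def[of x]
        proof (rule cINF_greatest[OF False])
          fix p assume "p \<in> C"
          then have "u (t *\<^sub>R x) \<le> t * p x"
            using le[of p "t *\<^sub>R x"] sublinearD(2)[of p t x] that CA by (force simp: A_def)
          then show "inverse t * u (t *\<^sub>R x) \<le> p x" using that F by (simp add: field_simps)
        qed
        then show ?thesis using that F by (simp add: field_simps)
      qed
      ultimately have "sublinear u" by (simp add: sublinear_def)
      moreover obtain p where "p \<in> C" using False by blast
      then have "u \<le> q" using le CA unfolding A_def le_fun_def by (blast intro: order_trans)
      ultimately show ?thesis using le by (auto simp: A_def le_fun_def)
    qed
  qed
  then obtain m where m: "sublinear m" "m \<le> q" and min: "\<And>p. sublinear p \<Longrightarrow> p \<le> m \<Longrightarrow> p = m"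
    unfolding A_def by (auto intro: order_trans)
  have add: "m (x + y) = m x + m y" for x y
  proof -
    obtain p where p: "sublinear p" "\<And>x. p x \<le> m x" "\<And>x t. 0 \<le> t \<Longrightarrow> p x \<le> m (x + t *\<^sub>R y) - t * m y"
      using sublinear_shift[OF m(1), of y] by metis
    then have "p = m" using min by (simp add: le_fun_def)
    then have "m x \<le> m (x + y) - m y" using p(3)[of 1 x] by simp
    then show ?thesis using sublinearD(1)[OF m(1), of x y] by linarith
  qed
  have neg: "m (- x) = - m x" for x using add[of x "- x"] sublinearD(4)[OF m(1)] by simp
  have nonneg: "m (t *\<^sub>R x) = t * m x" if "0 \<le> t" for t x
    using sublinearD(2)[OF m(1) that, of x] sublinearD(2)[OF m(1) that, of "- x"] neg
    by (metis neg_le_iff_le mult_minus_right order_antisym scaleR_minus_right)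
  have lin: "linear m"
  proof (rule linearI)
    show "m (x + y) = m x + m y" for x y by (rule add)
    show "m (t *\<^sub>R x) = t *\<^sub>R m x" for t x
    proof (cases "0 \<le> t")
      case True then show ?thesis by (simp add: nonneg)
    next
      case False
      then have "m (- ((- t) *\<^sub>R x)) = t * m x" by (simp only: neg nonneg)
      then show ?thesis by simp
    qed
  qed
  have "m x \<le> q0 x" for x using m(2) q(2) by (meson le_funD order_trans)
  moreover have "m (- a) \<le> - q0 a"
    using qa[of 1 "- a"] le_funD[OF m(2), of "- a"] sublinearD(4)[OF q0] by simp
  ultimately have "m a = q0 a" using neg by (simp add: order_antisym)
  then show thesis using that lin \<open>\<And>x. m x \<le> q0 x\<close> by blast
qed

text \<open>The gauge of \<open>V\<close> is finite because \<open>V\<close> is absorbing and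
  subadditive because \<open>V\<close> is convex; it is at most 1 on \<open>V\<close> and at least 1
  at \<open>y\<close>. Hahn-Banach provides a linear functional below it with equality at
  \<open>y\<close>.\<close>

lemma convex_separation:
  fixes V :: "'v::real_vector set"
  assumes "convex V" "0 \<in> V" "\<And>x. \<exists>t>0. t *\<^sub>R x \<in> V" "y \<notin> V"
  obtains f :: "'v \<Rightarrow> real" where "linear f" "\<And>x. x \<in> V \<Longrightarrow> f x \<le> 1" "f y \<ge> 1"
proof -
  define S where "S x = {t::real. 0 < t \<and> inverse t *\<^sub>R x \<in> V}" for x
  define q where "q x = Inf (S x)" for x
  have ne: "S x \<noteq> {}" for x
  proof -
    obtain t where "t > 0" "t *\<^sub>R x \<in> V" using assms(3) by blast
    then have "inverse t \<in> S x" by (simp add: S_def)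
    then show ?thesis by blast
  qed
  have bdd: "bdd_below (S x)" for x by (rule bdd_belowI[of _ 0]) (auto simp: S_def)
  have le: "q x \<le> t" if "t \<in> S x" for x t unfolding q_def by (rule cInf_lower[OF that bdd])
  have "q (x + y) \<le> q x + q y" for x y
  proof -
    have 1: "q (x + y) - s \<le> t" if s: "s \<in> S x" and t: "t \<in> S y" for s t
    proof -
      have pos: "0 < s" "0 < t" using s t by (auto simp: S_def)
      \<comment> \<open>A convex combination with weights proportional to \<open>s\<close> and
        \<open>t\<close> shows that \<open>s + t\<close> is admissible for
        \<open>x + y\<close>.\<close>
      have "(s / (s + t)) *\<^sub>R (inverse s *\<^sub>R x) + (t / (s + t)) *\<^sub>R (inverse t *\<^sub>R y) \<in> V"
        using s t pos by (intro convexD[OF assms(1)]) (auto simp: S_def add_divide_distrib[symmetric])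
      also have "(s / (s + t)) *\<^sub>R (inverse s *\<^sub>R x) + (t / (s + t)) *\<^sub>R (inverse t *\<^sub>R y) =
          inverse (s + t) *\<^sub>R (x + y)"
        using pos by (simp add: scaleR_add_right field_simps)
      finally have "s + t \<in> S (x + y)" using pos by (simp add: S_def)
      then show ?thesis using le by fastforce
    qed
    have "q (x + y) - s \<le> q y" if "s \<in> S x" for s
      unfolding q_def[of y] by (rule cInf_greatest[OF ne 1[OF that]])
    then have "q (x + y) - q y \<le> q x"
      unfolding q_def[of x] by (intro cInf_greatest[OF ne]) (force simp: algebra_simps)
    then show ?thesis by simp
  qed
  moreover have "q (c *\<^sub>R x) \<le> c * q x" if "0 \<le> c" for c x
  proof (cases "c = 0")
    case True
    have "q 0 \<le> t" if "0 < t" for t using that assms(2) by (intro le) (simp add: S_def)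
    then have "q 0 \<le> 0" by (rule field_le_epsilon[of "q 0" 0, simplified])
    then show ?thesis using True by simp
  next
    case False
    have "inverse c * q (c *\<^sub>R x) \<le> q x"
      unfolding q_def[of x]
    proof (rule cInf_greatest[OF ne])
      fix t assume "t \<in> S x"
      then have "0 < t" "inverse t *\<^sub>R x \<in> V" by (auto simp: S_def)
      moreover have "inverse (c * t) *\<^sub>R c *\<^sub>R x = inverse t *\<^sub>R x" using False by simp
      ultimately have "c * t \<in> S (c *\<^sub>R x)" using that False by (simp add: S_def del: scaleR_scaleR)
      from le[OF this] show "inverse c * q (c *\<^sub>R x) \<le> t" using that False by (simp add: field_simps)
    qed
    then show ?thesis using that False by (simp add: field_simps)
  qed
  ultimately have "sublinear q" by (simp add: sublinear_def)
  then obtain f where f: "linear f" "\<And>x. f x \<le> q x" "f y = q y" using Hahn_Banach_sublinear by metis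
  have "f x \<le> 1" if "x \<in> V" for x
    using f(2)[of x] le[of 1 x] that by (simp add: S_def)
  moreover have "1 \<le> q y"
    unfolding q_def
  proof (rule cInf_greatest[OF ne])
    fix t assume t: "t \<in> S y"
    show "1 \<le> t"
    proof (rule ccontr)
      assume "\<not> 1 \<le> t"
      \<comment> \<open>For \<open>t < 1\<close> the point \<open>y\<close> lies between 0 and
        \<open>inverse t *\<^sub>R y\<close>, both in \<open>V\<close>.\<close>
      then have "t *\<^sub>R (inverse t *\<^sub>R y) + (1 - t) *\<^sub>R 0 \<in> V"
        using t assms(2) by (intro convexD[OF assms(1)]) (auto simp: S_def)
      then show False using assms(4) t by (simp add: S_def)
    qed
  qed
  ultimately show thesis using f by (intro that[of f]) auto
qed

lemma locally_convex_continuous_map_affine: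
  assumes "locally_convex_tvs T"
  shows "continuous_map T T (\<lambda>x. c *\<^sub>R x + a)"
proof -
  have T: "topspace T = UNIV" and add: "continuous_map (prod_topology T T) T (\<lambda>(x, y). x + y)"
    and sc: "continuous_map (prod_topology euclideanreal T) T (\<lambda>(r, x). r *\<^sub>R x)"
    using assms by (auto simp: locally_convex_tvs_def)
  have "continuous_map T T ((\<lambda>(r, x). r *\<^sub>R x) \<circ> (\<lambda>x. (c, x)))"
    by (rule continuous_map_compose[OF _ sc]) (auto intro: continuous_map_pairedI)
  then have "continuous_map T (prod_topology T T) (\<lambda>x. (c *\<^sub>R x, a))"
    by (auto intro!: continuous_map_pairedI simp: T o_def)
  then have "continuous_map T T ((\<lambda>(x, y). x + y) \<circ> (\<lambda>x. (c *\<^sub>R x, a)))"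
    by (rule continuous_map_compose[OF _ add])
  then show ?thesis by (simp add: o_def)
qed

text \<open>A convex neighbourhood \<open>V\<close> of 0 with \<open>x + V\<close> inside
  \<open>U\<close> is absorbing because scalar multiplication is continuous, and it misses
  \<open>y - x\<close>. A linear functional bounded above by 1 on \<open>V\<close> is continuous,
  being small on small multiples of the intersection of \<open>V\<close> and
  \<open>-V\<close>.\<close>

lemma locally_convex_separation:
  fixes T :: "'v::real_vector topology"
  assumes T: "locally_convex_tvs T" and U: "openin T U" "x \<in> U" "y \<notin> U"
  obtains f :: "'v \<Rightarrow> real" where "linear f" "continuous_map T euclideanreal f" "f x \<noteq> f y"
proof -
  have top: "topspace T = UNIV"
    and sc: "continuous_map (prod_topology euclideanreal T) T (\<lambda>(r, x). r *\<^sub>R x)"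
    using T by (auto simp: locally_convex_tvs_def)
  have aff: "openin T {z. c *\<^sub>R z + a \<in> W}" if "openin T W" for c a W
    using openin_continuous_map_preimage[OF locally_convex_continuous_map_affine[OF T] that, of c a]
    by (simp add: top)
  have "openin T {z. z + x \<in> U}" using aff[OF U(1), of 1 x] by simp
  then obtain V where V: "openin T V" "convex V" "0 \<in> V" "V \<subseteq> {z. z + x \<in> U}"
    using T U(2) unfolding locally_convex_tvs_def by (metis (mono_tags, lifting) add_0 mem_Collect_eq)
  have "\<exists>t>0. t *\<^sub>R z \<in> V" for z
  proof -
    have "continuous_map euclideanreal T ((\<lambda>(r, x). r *\<^sub>R x) \<circ> (\<lambda>r. (r, z)))"
      by (rule continuous_map_compose[OF _ sc]) (auto intro: continuous_map_pairedI simp: top)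
    then have "continuous_map euclideanreal T (\<lambda>r. r *\<^sub>R z)" by (simp add: o_def)
    from openin_continuous_map_preimage[OF this V(1)]
    have "open {r. r *\<^sub>R z \<in> V}" by simp
    moreover have "0 \<in> {r. r *\<^sub>R z \<in> V}" using V by simp
    ultimately obtain e where "e > 0" "ball 0 e \<subseteq> {r. r *\<^sub>R z \<in> V}"
      by (meson open_contains_ball)
    then show ?thesis by (intro exI[of _ "e/2"]) (auto simp: subset_iff dist_real_def)
  qed
  moreover have "y - x \<notin> V" using V(4) U(3) by auto
  ultimately obtain f :: "'v \<Rightarrow> real"
    where f: "linear f" "\<And>z. z \<in> V \<Longrightarrow> f z \<le> 1" "f (y - x) \<ge> 1"
    using convex_separation[OF V(2,3), of "y - x"] by blast
  have "continuous_map T euclideanreal f"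
  proof (clarsimp simp: continuous_map top)
    fix W :: "real set" assume "open W"
    show "openin T {z. f z \<in> W}"
    proof (subst openin_subopen, safe)
      fix z assume "f z \<in> W"
      then obtain e where e: "e > 0" "ball (f z) e \<subseteq> W" using \<open>open W\<close> by (meson open_contains_ball)
      \<comment> \<open>This is the translate to \<open>z\<close> of \<open>e/2\<close> times the
        intersection of \<open>V\<close> and \<open>-V\<close>; both signs occur because
        \<open>f\<close> is bounded on \<open>V\<close> only from above.\<close>
      let ?N = "{w. (2/e) *\<^sub>R w + - ((2/e) *\<^sub>R z) \<in> V} \<inter> {w. (-2/e) *\<^sub>R w + (2/e) *\<^sub>R z \<in> V}"
      have "openin T ?N" by (intro openin_Int aff V(1))
      moreover have "z \<in> ?N" using V(3) by simp
      moreover have "?N \<subseteq> {z. f z \<in> W}"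
      proof safe
        fix w assume "(2/e) *\<^sub>R w + - ((2/e) *\<^sub>R z) \<in> V" "(-2/e) *\<^sub>R w + (2/e) *\<^sub>R z \<in> V"
        from this[THEN f(2)] have "(2/e) * (f w - f z) \<le> 1" "(2/e) * (f z - f w) \<le> 1"
          by (simp_all add: linear_add[OF f(1)] linear_diff[OF f(1)] linear_cmul[OF f(1)]
              linear_neg[OF f(1)] right_diff_distrib diff_divide_distrib)
        then have "f w - f z \<le> e/2" "f z - f w \<le> e/2"
          using e(1) by (simp_all add: pos_divide_le_eq mult.commute)
        then have "\<bar>f w - f z\<bar> < e" using e(1) by linarith
        then show "f w \<in> W" using e(2) by (auto simp: subset_iff dist_real_def abs_minus_commute)
      qed
      ultimately show "\<exists>N. openin T N \<and> z \<in> N \<and> N \<subseteq> {z. f z \<in> W}" by blast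
    qed
  qed
  moreover have "f x \<noteq> f y" using f(3) linear_diff[OF f(1), of y x] by auto
  ultimately show thesis using that f(1) by blast
qed

section \<open>Continuous group actions\<close>

lemma subspace_closure:
  fixes S :: "'v::real_normed_vector set"
  assumes "subspace S"
  shows "subspace (closure S)"
proof (rule subspaceI)
  show "0 \<in> closure S" using subspace_0[OF assms] closure_subset by blast
  show "x + y \<in> closure S" if xy: "x \<in> closure S" "y \<in> closure S" for x y
  proof -
    obtain a b where a: "\<forall>n. a n \<in> S" "a \<longlonglongrightarrow> x" and b: "\<forall>n. b n \<in> S" "b \<longlonglongrightarrow> y"
      using xy by (metis closure_sequential)
    have "\<forall>n. a n + b n \<in> S" using a b subspace_add[OF assms] by blast
    then show ?thesis using tendsto_add[OF a(2) b(2)] by (metis closure_sequential)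
  qed
  show "c *\<^sub>R x \<in> closure S" if x: "x \<in> closure S" for c x
  proof -
    obtain a where a: "\<forall>n. a n \<in> S" "a \<longlonglongrightarrow> x" using x by (metis closure_sequential)
    have "\<forall>n. c *\<^sub>R a n \<in> S" using a subspace_scale[OF assms] by blast
    then show ?thesis using tendsto_scaleR[OF tendsto_const a(2)] by (metis closure_sequential)
  qed
qed

lemma compact_bcontfun:
  fixes f :: "'x::topological_space \<Rightarrow> real"
  assumes "compact (UNIV :: 'x set)" "continuous_on UNIV f"
  shows "f \<in> bcontfun"
  using compact_imp_bounded[OF compact_continuous_image[OF assms(2,1)]] assms(2)
  by (simp add: bcontfun_def)

lemma apply_Bcontfun_compact [simp]:
  fixes f :: "'x::topological_space \<Rightarrow> real"
  assumes "compact (UNIV :: 'x set)" "continuous_on UNIV f"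
  shows "apply_bcontfun (Bcontfun f) = f"
  using compact_bcontfun[OF assms] by (simp add: Bcontfun_inverse)

lemma continuous_map_prod_slice:
  assumes "continuous_map (prod_topology X Y) Z (\<lambda>(x, y). F x y)" "x \<in> topspace X"
  shows "continuous_map Y Z (F x)"
proof -
  have "continuous_map Y Z ((\<lambda>(x, y). F x y) \<circ> (\<lambda>y. (x, y)))"
    by (rule continuous_map_compose[OF _ assms(1)]) (use assms(2) in \<open>auto intro: continuous_map_pairedI\<close>)
  then show ?thesis by (simp add: o_def)
qed

text \<open>Compactness makes the continuity uniform: the tube lemma turns the open set where
  \<open>F\<close> is within \<open>e/2\<close> of its slice at \<open>p\<close> into a
  neighbourhood of \<open>p\<close>. It is applied to rotations, to difference quotients and to
  composition with group elements.\<close>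

lemma continuous_map_into_bcontfun:
  fixes F :: "'p \<Rightarrow> 'x::topological_space \<Rightarrow> real"
  assumes cpt: "compact (UNIV :: 'x set)"
    and F: "continuous_map (prod_topology T euclidean) euclideanreal (\<lambda>(p, x). F p x)"
  shows "continuous_map T euclidean (\<lambda>p. Bcontfun (F p))"
proof (clarsimp simp: continuous_map)
  have Fp: "continuous_on UNIV (F p)" if "p \<in> topspace T" for p
    using continuous_map_prod_slice[OF F that] by simp
  fix W :: "('x \<Rightarrow>\<^sub>C real) set" assume "open W"
  show "openin T {p \<in> topspace T. Bcontfun (F p) \<in> W}"
  proof (subst openin_subopen, safe)
    fix p assume p: "p \<in> topspace T" "Bcontfun (F p) \<in> W"
    obtain e where e: "e > 0" "ball (Bcontfun (F p)) e \<subseteq> W"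
      using \<open>open W\<close> p(2) by (meson open_contains_ball)
    let ?D = "\<lambda>z. (\<lambda>(p, x). F p x) z - (F p \<circ> snd) z"
    have "continuous_map (prod_topology T euclidean) euclideanreal ?D"
      by (intro continuous_map_diff F continuous_map_compose[OF continuous_map_snd])
        (use Fp[OF p(1)] in simp)
    from openin_continuous_map_preimage[OF this, of "ball 0 (e/2)"]
    have op: "openin (prod_topology T euclidean) {z \<in> topspace (prod_topology T euclidean). ?D z \<in> ball 0 (e/2)}"
      by simp
    have sub: "{p} \<times> UNIV \<subseteq> {z \<in> topspace (prod_topology T euclidean). ?D z \<in> ball 0 (e/2)}"
      using p(1) e(1) by auto
    obtain U V where U: "openin T U" "p \<in> U" and
      V: "UNIV \<subseteq> V" and
      UV: "U \<times> V \<subseteq> {z \<in> topspace (prod_topology T euclidean). ?D z \<in> ball 0 (e/2)}"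
      using tube_lemma_right[OF op _ p(1) sub] cpt by auto
    have "U \<subseteq> {p \<in> topspace T. Bcontfun (F p) \<in> W}"
    proof safe
      fix q assume q: "q \<in> U"
      then show qT: "q \<in> topspace T" using U(1) openin_subset by blast
      have "\<bar>F q x - F p x\<bar> < e/2" for x
      proof -
        have "(q, x) \<in> U \<times> V" using q V by auto
        then have "?D (q, x) \<in> ball 0 (e/2)" using UV by blast
        then show ?thesis by simp
      qed
      then have "dist (Bcontfun (F p)) (Bcontfun (F q)) \<le> e/2"
        by (intro dist_bound) (simp add: Fp p(1) qT cpt dist_real_def abs_minus_commute less_imp_le)
      then show "Bcontfun (F q) \<in> W" using e by auto
    qed
    then show "\<exists>U. openin T U \<and> p \<in> U \<and> U \<subseteq> {p \<in> topspace T. Bcontfun (F p) \<in> W}"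
      using U by blast
  qed
qed

text \<open>The tube lemma around \<open>{g} \<times> K\<close> gives a neighbourhood of
  \<open>g\<close> whose elements still map \<open>K\<close> into \<open>U\<close>, and inverse
  group elements make each \<open>\<phi> g\<close> a homeomorphism. This reduces the compact-open
  condition to joint continuity.\<close>

lemma continuous_map_Homeo_topology:
  assumes act: "group_action G (topspace X) \<phi>" and top: "topspace TG = carrier G"
    and cont: "continuous_map (prod_topology TG X) X (\<lambda>(g, x). \<phi> g x)"
  shows "continuous_map TG (Homeo_topology X) \<phi>"
proof -
  interpret group_action G "topspace X" \<phi> by fact
  interpret G: group G using group_hom by (simp add: group_hom_def)
  have H: "\<phi> g \<in> Homeo X" if g: "g \<in> carrier G" for g
  proof -
    have c: "continuous_map X X (\<phi> h)" if "h \<in> carrier G" for h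
      using continuous_map_prod_slice[OF cont] that top by auto
    have "homeomorphic_maps X X (\<phi> g) (\<phi> (inv\<^bsub>G\<^esub> g))"
      unfolding homeomorphic_maps_def
    proof (intro conjI ballI c g G.inv_closed)
      show "\<phi> (inv\<^bsub>G\<^esub> g) (\<phi> g x) = x" if "x \<in> topspace X" for x
        using orbit_sym_aux[OF g that refl] .
      show "\<phi> g (\<phi> (inv\<^bsub>G\<^esub> g) x) = x" if "x \<in> topspace X" for x
        using orbit_sym_aux[OF G.inv_closed[OF g] that refl] g by simp
    qed
    then show ?thesis
      using bij_prop0[OF g] by (auto simp: Homeo_def Bij_def homeomorphic_maps_map)
  qed
  show ?thesis
    unfolding Homeo_topology_def
  proof (rule continuous_on_generated_topo)
    fix S assume "S \<in> {{h \<in> Homeo X. h ` K \<subseteq> U} | K U. compactin X K \<and> openin X U}"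
    then obtain K U where S: "S = {h \<in> Homeo X. h ` K \<subseteq> U}" and K: "compactin X K" and U: "openin X U"
      by blast
    show "openin TG (\<phi> -` S \<inter> topspace TG)"
    proof (subst openin_subopen, safe)
      fix g assume g: "g \<in> topspace TG" "\<phi> g \<in> S"
      let ?W = "{z \<in> topspace (prod_topology TG X). (\<lambda>(g, x). \<phi> g x) z \<in> U}"
      have op: "openin (prod_topology TG X) ?W" by (rule openin_continuous_map_preimage[OF cont U])
      have sub: "{g} \<times> K \<subseteq> ?W" using g S compactin_subset_topspace[OF K] by auto
      obtain N V where N: "openin TG N" "g \<in> N" and V: "K \<subseteq> V" and NV: "N \<times> V \<subseteq> ?W"
        using tube_lemma_right[OF op K g(1) sub] by auto
      have "N \<subseteq> \<phi> -` S \<inter> topspace TG"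
      proof
        fix h assume h: "h \<in> N"
        then have hT: "h \<in> topspace TG" using openin_subset[OF N(1)] by blast
        have "\<phi> h x \<in> U" if "x \<in> K" for x
        proof -
          have "(h, x) \<in> ?W" using NV V h that by blast
          then show ?thesis by simp
        qed
        then show "h \<in> \<phi> -` S \<inter> topspace TG" using H hT top by (auto simp: S)
      qed
      then show "\<exists>N. openin TG N \<and> g \<in> N \<and> N \<subseteq> \<phi> -` S \<inter> topspace TG" using N by blast
    qed
  next
    \<comment> \<open>With \<open>K\<close> empty this subbasic set is all of
      \<open>Homeo X\<close>, so the generated topology covers the range of
      \<open>\<phi>\<close>.\<close>
    have "Homeo X \<in> {{h \<in> Homeo X. h ` K \<subseteq> U} | K U. compactin X K \<and> openin X U}"
      by (intro CollectI exI[of _ "{}"] exI[of _ "topspace X"]) auto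
    then show "\<phi> ` topspace TG \<subseteq> \<Union> {{h \<in> Homeo X. h ` K \<subseteq> U} | K U. compactin X K \<and> openin X U}"
      using H top by blast
  qed
qed

lemma open_map_prod:
  assumes "open_map X X' f" "open_map Y Y' g"
  shows "open_map (prod_topology X Y) (prod_topology X' Y') (\<lambda>(x, y). (f x, g y))"
  unfolding open_map_def
proof (intro allI impI)
  fix W assume W: "openin (prod_topology X Y) W"
  show "openin (prod_topology X' Y') ((\<lambda>(x, y). (f x, g y)) ` W)"
  proof (subst openin_prod_topology_alt, intro allI impI)
    fix a b assume "(a, b) \<in> (\<lambda>(x, y). (f x, g y)) ` W"
    then obtain x y where xy: "(x, y) \<in> W" "a = f x" "b = g y" by auto
    obtain U V where UV: "openin X U" "openin Y V" "x \<in> U" "y \<in> V" "U \<times> V \<subseteq> W"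
      using openin_prod_topology_alt[THEN iffD1, OF W, rule_format, OF xy(1)] by auto
    have "openin X' (f ` U)" "openin Y' (g ` V)" using assms UV by (auto simp: open_map_def)
    moreover have "f ` U \<times> g ` V \<subseteq> (\<lambda>(x, y). (f x, g y)) ` W"
      using UV(5) by (force simp: image_def)
    moreover have "a \<in> f ` U" "b \<in> g ` V" using xy UV by auto
    ultimately show "\<exists>U V. openin X' U \<and> openin Y' V \<and> a \<in> U \<and> b \<in> V \<and> U \<times> V \<subseteq> (\<lambda>(x, y). (f x, g y)) ` W"
      by blast
  qed
qed

text \<open>Products of quotient maps need not be quotient maps, but products of open maps are open.
  This lets multiplication in \<open>PSL2R\<close> and its action on lines inherit continuity from
  matrices and vectors.\<close>

lemma continuous_map_prod_open_quotient:
  assumes f: "continuous_map X X' f" "open_map X X' f" "f ` topspace X = topspace X'"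
    and g: "continuous_map Y Y' g" "open_map Y Y' g" "g ` topspace Y = topspace Y'"
    and h: "continuous_map (prod_topology X Y) Z (\<lambda>(x, y). h (f x) (g y))"
  shows "continuous_map (prod_topology X' Y') Z (\<lambda>(x, y). h x y)"
proof (rule continuous_compose_quotient_map)
  show "quotient_map (prod_topology X Y) (prod_topology X' Y') (\<lambda>(x, y). (f x, g y))"
  proof (rule continuous_open_imp_quotient_map)
    show "continuous_map (prod_topology X Y) (prod_topology X' Y') (\<lambda>(x, y). (f x, g y))"
      using continuous_map_compose[OF continuous_map_fst f(1), of Y]
        continuous_map_compose[OF continuous_map_snd g(1), of X]
      by (simp add: continuous_map_pairwise o_def case_prod_unfold)
    show "(\<lambda>(x, y). (f x, g y)) ` topspace (prod_topology X Y) = topspace (prod_topology X' Y')"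
      using f(3) g(3) by (force simp: image_def)
  qed (rule open_map_prod[OF f(2) g(2)])
  show "continuous_map (prod_topology X Y) Z ((\<lambda>(x, y). h x y) \<circ> (\<lambda>(x, y). (f x, g y)))"
    using h by (simp add: o_def case_prod_unfold)
qed

section \<open>The linear Stone--Weierstrass property on a topological circle\<close>

text \<open>Completeness of \<open>real \<Rightarrow>\<^sub>C real\<close> is what makes a
  continuous curve in it integrable; the Fourier averages are integrated there.\<close>

instance bcontfun :: (metric_space, banach) banach ..

lemma continuous_on_bcontfun_compose [continuous_intros]:
  "continuous_on A g \<Longrightarrow> continuous_on A (\<lambda>t. apply_bcontfun f (g t))"
  by (rule continuous_on_compose2[OF continuous_on_apply_bcontfun[of UNIV]]) auto

text \<open>Riemann sums are linear combinations of values of \<open>F\<close>, so they lie in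
  \<open>V\<close>, and closedness keeps the limit there.\<close>

lemma has_integral_in_closed_subspace:
  fixes F :: "real \<Rightarrow> 'v::real_normed_vector"
  assumes V: "closed V" "subspace V" and F: "(F has_integral y) {a..b}"
    and FV: "\<And>t. t \<in> {a..b} \<Longrightarrow> F t \<in> V"
  shows "y \<in> V"
proof (rule Lim_in_closed_set[OF V(1)])
  show "(sum (\<lambda>(x, k). Henstock_Kurzweil_Integration.content k *\<^sub>R F x) \<longlongrightarrow> y) (division_filter (cbox a b))"
    using F unfolding interval_cbox has_integral_cbox .
  show "\<forall>\<^sub>F p in division_filter (cbox a b).
      (\<Sum>(x, k)\<in>p. Henstock_Kurzweil_Integration.content k *\<^sub>R F x) \<in> V"
  proof (rule eventually_mono[OF eventually_division_filter_tagged_division])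
    fix p assume p: "p tagged_division_of cbox a b"
    show "(\<Sum>(x, k)\<in>p. Henstock_Kurzweil_Integration.content k *\<^sub>R F x) \<in> V"
    proof (rule subspace_sum[OF V(2)], clarify)
      fix x k assume "(x, k) \<in> p"
      then have "x \<in> {a..b}" using tagged_division_ofD(2,3)[OF p] by fastforce
      then show "Henstock_Kurzweil_Integration.content k *\<^sub>R F x \<in> V"
        by (intro subspace_scale[OF V(2)] FV)
    qed
  qed
qed (rule division_filter_not_empty)

text \<open>\<open>J\<close> carries Riemann sums to Riemann sums without changing their distance to
  the limit. An integral computed in the target space thus descends to the domain, complete or not,
  once its value is known to have the form \<open>J u\<close>.\<close>

lemma has_integral_linear_isometry:
  fixes F :: "real \<Rightarrow> 'v::real_normed_vector" and J :: "'v \<Rightarrow> 'w::real_normed_vector"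
  assumes J: "linear J" "\<And>v. norm (J v) = norm v" and F: "((\<lambda>t. J (F t)) has_integral J u) {a..b}"
  shows "(F has_integral u) {a..b}"
proof -
  have eq: "norm ((\<Sum>(x, k)\<in>p. Henstock_Kurzweil_Integration.content k *\<^sub>R J (F x)) - J u) =
      norm ((\<Sum>(x, k)\<in>p. Henstock_Kurzweil_Integration.content k *\<^sub>R F x) - u)" for p
  proof -
    have "(\<Sum>(x, k)\<in>p. Henstock_Kurzweil_Integration.content k *\<^sub>R J (F x)) - J u =
        J ((\<Sum>(x, k)\<in>p. Henstock_Kurzweil_Integration.content k *\<^sub>R F x) - u)"
      by (simp add: linear_diff[OF J(1)] linear_sum[OF J(1)] linear_cmul[OF J(1)] case_prod_unfold)
    then show ?thesis by (simp add: J(2))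
  qed
  show ?thesis
    using F unfolding interval_cbox has_integral eq .
qed

text \<open>Cut the shifted interval \<open>{t..t + p}\<close> at \<open>p\<close>; by periodicity
  the overhang past \<open>p\<close> has the same integral as \<open>{0..t}\<close>.\<close>

lemma integral_periodic_shift:
  fixes G :: "real \<Rightarrow> real"
  assumes G: "continuous_on UNIV G" "\<And>t. G (t + p) = G t" and t: "0 \<le> t" "t \<le> p"
  shows "((\<lambda>s. G (s + t)) has_integral integral {0..p} G) {0..p}"
proof -
  have int: "(G has_integral integral {a..b} G) {a..b}" for a b
    by (intro integrable_integral integrable_continuous_real continuous_on_subset[OF G(1)]) auto
  have "((\<lambda>s. G (p + s)) has_integral integral {p..t + p} G) {0..t}"
    using int[of p "t + p"] has_integral_shift_cbox_iff[of G p "integral {p..t + p} G" 0 t]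
    by (simp add: o_def add.commute)
  then have "(G has_integral integral {p..t + p} G) {0..t}" using G(2) by (simp add: add.commute)
  then have "integral {p..t + p} G = integral {0..t} G" by (simp add: integral_unique)
  moreover have "(G has_integral integral {t..p} G + integral {p..t + p} G) {t..t + p}"
    by (rule has_integral_combine[OF _ _ int int]) (use t in auto)
  moreover have "integral {0..t} G + integral {t..p} G = integral {0..p} G"
    by (rule has_integral_unique[OF has_integral_combine[OF t int int] int])
  ultimately have "(G has_integral integral {0..p} G) {t..t + p}" by (simp add: add.commute)
  then show ?thesis
    using has_integral_shift_cbox_iff[of G t "integral {0..p} G" 0 p]
    by (simp add: o_def add.commute)
qed

lemma Re_of_real_mult: "Re (of_real r * z) = r * Re z"
  by simp

section \<open>Coordinates and trigonometric polynomials on a topological circle\<close>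

locale circle_homeomorphism =
  fixes e :: "'x::topological_space \<Rightarrow> complex" and e' :: "complex \<Rightarrow> 'x"
  assumes homeo: "homeomorphism UNIV (sphere 0 1) e e'"
begin

lemma norm_e [simp]: "norm (e x) = 1"
  using homeomorphism_image1[OF homeo] by (metis UNIV_I dist_0_norm imageI mem_sphere)

lemma e'_e [simp]: "e' (e x) = x"
  using homeomorphism_apply1[OF homeo] by simp

lemma e_e' [simp]: "norm z = 1 \<Longrightarrow> e (e' z) = z"
  using homeomorphism_apply2[OF homeo] by simp

lemma continuous_on_e [continuous_intros]:
  "continuous_on A g \<Longrightarrow> continuous_on A (\<lambda>t. e (g t))"
  by (rule continuous_on_compose2[OF homeomorphism_cont1[OF homeo]]) auto

lemma continuous_on_e' [continuous_intros]:
  "continuous_on A g \<Longrightarrow> (\<And>t. t \<in> A \<Longrightarrow> norm (g t) = 1) \<Longrightarrow> continuous_on A (\<lambda>t. e' (g t))"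
  by (rule continuous_on_compose2[OF homeomorphism_cont2[OF homeo]]) auto

lemma compact_UNIV: "compact (UNIV :: 'x set)"
  using compact_continuous_image[OF homeomorphism_cont2[OF homeo] compact_sphere] homeomorphism_image2[OF homeo] by simp

lemmas apply_Bcontfun = apply_Bcontfun_compact[OF compact_UNIV]

lemma obtain_angle:
  obtains t where "0 \<le> t" "t \<le> 2 * pi" "x = e' (cis t)"
proof -
  obtain t where "0 \<le> t" "t < 2 * pi" "e x = Complex (cos t) (sin t)"
    using complex_unimodular_polar[OF norm_e] by metis
  then show thesis using that[of t] e'_e[of x] by (simp add: cis.ctr)
qed

text \<open>The complex coefficient covers cosine and sine of order \<open>n\<close> at once, and a
  rotation becomes multiplication of \<open>a\<close> by a unimodular number.\<close>

definition wave :: "complex \<Rightarrow> nat \<Rightarrow> 'x \<Rightarrow>\<^sub>C real" where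
  "wave a n = Bcontfun (\<lambda>x. Re (a * e x ^ n))"

lemma wave [simp]: "apply_bcontfun (wave a n) x = Re (a * e x ^ n)"
  unfolding wave_def by (subst apply_Bcontfun) (auto intro!: continuous_intros)

definition trig_polys :: "('x \<Rightarrow>\<^sub>C real) set" where
  "trig_polys = span {wave a n | a n. True}"

lemma wave_in_trig_polys: "wave a n \<in> trig_polys"
  unfolding trig_polys_def by (rule span_base) auto

lemma subspace_trig_polys: "subspace trig_polys"
  unfolding trig_polys_def by (rule subspace_span)

text \<open>From \<open>Re u * Re v = (Re (u * v) + Re (u * cnj v)) / 2\<close>, where conjugation
  inverts powers of a unimodular number; \<open>n \<le> m\<close> keeps the exponent
  \<open>m - n\<close> a natural number.\<close>

lemma wave_mult_le:
  assumes "n \<le> m"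
  shows "\<exists>w\<in>trig_polys. \<forall>x. w x = wave a m x * wave b n x"
proof (intro bexI allI)
  let ?w = "(1/2) *\<^sub>R (wave (a * b) (m + n) + wave (a * cnj b) (m - n))"
  show "?w \<in> trig_polys"
    by (intro subspace_scale[OF subspace_trig_polys] subspace_add[OF subspace_trig_polys] wave_in_trig_polys)
  show "?w x = wave a m x * wave b n x" for x
  proof -
    have c: "e x * cnj (e x) = 1" by (simp add: complex_norm_square[symmetric])
    have "e x ^ m * cnj (e x) ^ n = e x ^ (m - n) * (e x * cnj (e x)) ^ n"
      using assms by (simp add: power_mult_distrib power_add[symmetric] mult.assoc[symmetric])
    then have "a * cnj b * e x ^ (m - n) = (a * e x ^ m) * cnj (b * e x ^ n)"
      by (simp add: c)
    moreover have "a * b * e x ^ (m + n) = (a * e x ^ m) * (b * e x ^ n)" by (simp add: power_add)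
    moreover have "Re (u * v) + Re (u * cnj v) = 2 * (Re u * Re v)" for u v by simp
    ultimately show ?thesis by (simp only: plus_bcontfun.rep_eq scaleR_bcontfun.rep_eq wave) simp
  qed
qed

lemma trig_polys_mult:
  assumes "u \<in> trig_polys" "v \<in> trig_polys"
  shows "\<exists>w\<in>trig_polys. \<forall>x. w x = u x * v x"
proof -
  have sub: "subspace {v :: 'x \<Rightarrow>\<^sub>C real. \<exists>w\<in>trig_polys. \<forall>x. w x = u x * v x}" for u :: "'x \<Rightarrow>\<^sub>C real"
  proof (rule subspaceI; clarsimp)
    show "\<exists>w\<in>trig_polys. \<forall>x. w x = 0"
      using subspace_0[OF subspace_trig_polys] by (intro bexI[of _ 0]) auto
  next
    fix v1 v2 w1 w2 assume "w1 \<in> trig_polys" "w2 \<in> trig_polys"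
      "\<forall>x. w1 x = u x * v1 x" "\<forall>x. w2 x = u x * v2 x"
    then show "\<exists>w\<in>trig_polys. \<forall>x. w x = u x * (v1 x + v2 x)"
      using subspace_add[OF subspace_trig_polys] by (intro bexI[of _ "w1 + w2"]) (auto simp: algebra_simps)
  next
    fix c :: real and v w assume "w \<in> trig_polys" "\<forall>x. w x = u x * v x"
    then show "\<exists>w\<in>trig_polys. \<forall>x. w x = u x * (c * v x)"
      using subspace_scale[OF subspace_trig_polys] by (intro bexI[of _ "c *\<^sub>R w"]) (auto simp: algebra_simps)
  qed
  have ww: "\<exists>w\<in>trig_polys. \<forall>x. w x = wave a m x * wave b n x" for a b m n
    using wave_mult_le[of n m a b] wave_mult_le[of m n b a] by (metis linear mult.commute)
  have wv: "\<exists>w\<in>trig_polys. \<forall>x. w x = wave a m x * v x" for a m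
  proof -
    have "v \<in> {v :: 'x \<Rightarrow>\<^sub>C real. \<exists>w\<in>trig_polys. \<forall>x. w x = wave a m x * v x}"
      by (rule subsetD[OF span_minimal[OF _ sub] assms(2)[unfolded trig_polys_def]]) (use ww in blast)
    then show ?thesis by blast
  qed
  show ?thesis
  proof -
    have vw: "\<exists>w\<in>trig_polys. \<forall>x. w x = v x * wave a m x" for a m
      using wv[of a m] by (simp only: mult.commute)
    have "u \<in> {u :: 'x \<Rightarrow>\<^sub>C real. \<exists>w\<in>trig_polys. \<forall>x. w x = v x * u x}"
      by (rule subsetD[OF span_minimal[OF _ sub] assms(1)[unfolded trig_polys_def]]) (use vw in blast)
    then show ?thesis by (simp only: mult.commute) blast
  qed
qed

lemma real_polynomial_in_trig_polys:
  assumes "real_polynomial_function g"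
  shows "\<exists>w\<in>trig_polys. \<forall>x. w x = g (e x)"
  using assms
proof induction
  case (linear f)
  \<comment> \<open>A real-linear functional on the plane is \<open>Re (b * z)\<close> for one
    complex \<open>b\<close>, so it restricts to a wave of order 1.\<close>
  have rep: "f z = Re (Complex (f 1) (- f \<i>) * z)" for z
  proof -
    have "f z = f (Re z *\<^sub>R 1 + Im z *\<^sub>R \<i>)" by (rule arg_cong[of _ _ f]) (simp add: complex_eq_iff)
    also have "\<dots> = Re z * f 1 + Im z * f \<i>"
      by (simp add: linear_add linear_cmul bounded_linear.linear[OF linear])
    finally show ?thesis by (simp add: algebra_simps)
  qed
  show ?case
  proof (intro bexI allI)
    show "wave (Complex (f 1) (- f \<i>)) 1 x = f (e x)" for x
      by (simp only: wave power_one_right rep[of "e x", symmetric])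
  qed (rule wave_in_trig_polys)
next
  case (const c)
  show ?case using wave_in_trig_polys[of "of_real c" 0] by (intro bexI) auto
next
  case (add f g)
  then obtain u v where "u \<in> trig_polys" "v \<in> trig_polys" "\<forall>x. u x = f (e x)" "\<forall>x. v x = g (e x)" by blast
  then show ?case using subspace_add[OF subspace_trig_polys] by (intro bexI[of _ "u + v"]) auto
next
  case (mult f g)
  then obtain u v where "u \<in> trig_polys" "v \<in> trig_polys" "\<forall>x. u x = f (e x)" "\<forall>x. v x = g (e x)" by blast
  then show ?case using trig_polys_mult[of u v] by auto
qed

lemma trig_polys_dense:
  fixes f :: "'x \<Rightarrow>\<^sub>C real"
  assumes "0 < \<epsilon>"
  obtains w where "w \<in> trig_polys" "norm (f - w) \<le> \<epsilon>"
proof -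
  have "continuous_on (sphere 0 1) (\<lambda>z. apply_bcontfun f (e' z))"
    by (intro continuous_intros) auto
  then obtain g where g: "real_polynomial_function g" "\<And>z. z \<in> sphere 0 1 \<Longrightarrow> \<bar>f (e' z) - g z\<bar> < \<epsilon>"
    using Stone_Weierstrass_real_polynomial_function[OF compact_sphere _ assms] by metis
  then obtain w where w: "w \<in> trig_polys" "\<forall>x. w x = g (e x)" using real_polynomial_in_trig_polys by blast
  have "norm (f - w) \<le> \<epsilon>"
    using g(2)[of "e _"] w(2) by (intro norm_bound) (auto intro: less_imp_le)
  then show thesis using that w(1) by blast
qed

section \<open>Fourier coefficients and rotations\<close>

definition fourier_coeff :: "('x \<Rightarrow>\<^sub>C real) \<Rightarrow> nat \<Rightarrow> complex" where
  "fourier_coeff f n = integral {0..2*pi} (\<lambda>t. of_real (f (e' (cis t))) * cis (- (real n * t)))"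

lemma fourier_coeff_has_integral:
  fixes f :: "'x \<Rightarrow>\<^sub>C real"
  shows "((\<lambda>t. f (e' (cis t)) * Re (cis (- (real n * t)) * z)) has_integral Re (fourier_coeff f n * z)) {0..2*pi}"
proof -
  have "continuous_on {0..2*pi} (\<lambda>t. complex_of_real (f (e' (cis t))) * cis (- (real n * t)))"
    by (intro continuous_intros) auto
  then have "((\<lambda>t. of_real (f (e' (cis t))) * cis (- (real n * t))) has_integral fourier_coeff f n) {0..2*pi}"
    unfolding fourier_coeff_def by (intro integrable_integral integrable_continuous_real)
  from has_integral_linear[OF this, of "\<lambda>w. Re (w * z)"] show ?thesis
    by (simp add: o_def bounded_linear_compose[OF bounded_linear_Re bounded_linear_mult_left] mult.assoc
        scaleR_conv_of_real[symmetric] del: times_complex.sel)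
qed

text \<open>Vanishing coefficients make \<open>f\<close> orthogonal to every wave, hence to all
  trigonometric polynomials. Since these approximate \<open>f\<close>, the integral of its square is
  0, and continuity gives \<open>f = 0\<close>.\<close>

lemma fourier_coeff_zero:
  fixes f :: "'x \<Rightarrow>\<^sub>C real"
  assumes "\<And>n. fourier_coeff f n = 0"
  shows "f = 0"
proof -
  have cf: "continuous_on A (\<lambda>t. apply_bcontfun f (e' (cis t)))" for A and f :: "'x \<Rightarrow>\<^sub>C real"
    by (intro continuous_intros) auto
  define L where "L u = integral {0..2*pi} (\<lambda>t. f (e' (cis t)) * u (e' (cis t)))" for u :: "'x \<Rightarrow>\<^sub>C real"
  have int: "((\<lambda>t. f (e' (cis t)) * u (e' (cis t))) has_integral L u) {0..2*pi}" for u :: "'x \<Rightarrow>\<^sub>C real"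
    unfolding L_def by (intro integrable_integral integrable_continuous_real continuous_intros cf)
  have L_add: "L (u + v) = L u + L v" for u v
    using has_integral_add[OF int[of u] int[of v]]
    by (intro has_integral_unique[OF int]) (simp add: algebra_simps)
  have L_scale: "L (c *\<^sub>R u) = c * L u" for c u
    using has_integral_mult_right[OF int[of u], of c]
    by (intro has_integral_unique[OF int]) (simp add: algebra_simps)
  have subL: "subspace {u. L u = 0}"
    using L_scale[of 0 0] by (intro subspaceI) (auto simp: L_add L_scale)
  have L_wave: "L (wave a n) = 0" for a n
  proof -
    have eq: "Re (cis (- (real n * t)) * cnj a) = Re (a * cis t ^ n)" for t
      unfolding Complex.DeMoivre by (simp add: algebra_simps)
    have "((\<lambda>t. f (e' (cis t)) * Re (cis (- (real n * t)) * cnj a)) has_integral 0) {0..2*pi}"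
      using fourier_coeff_has_integral[of f n "cnj a"] assms by simp
    then show ?thesis by (intro has_integral_unique[OF int]) (simp only: eq wave e_e' norm_cis)
  qed
  have "{wave a n | a n. True} \<subseteq> {u. L u = 0}" using L_wave by auto
  then have L0: "L u = 0" if "u \<in> trig_polys" for u
    using span_minimal[OF _ subL] that unfolding trig_polys_def by blast
  have small: "\<bar>L f\<bar> \<le> norm f * \<epsilon> * (2 * pi)" if \<epsilon>: "0 < \<epsilon>" for \<epsilon>
  proof -
    obtain u where u: "u \<in> trig_polys" "norm (f - u) \<le> \<epsilon>" using trig_polys_dense[OF \<epsilon>] by blast
    have "L f = L (f - u) + L u" using L_add[of "f - u" u] by simp
    then have "L f = L (f - u)" using L0[OF u(1)] by simp
    moreover have "norm (L (f - u)) \<le> norm f * \<epsilon> * (2 * pi - 0)"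
      unfolding L_def
    proof (rule integral_bound)
      show "continuous_on {0..2 * pi} (\<lambda>t. f (e' (cis t)) * (f - u) (e' (cis t)))"
        by (intro continuous_intros cf)
      show "norm (f (e' (cis t)) * (f - u) (e' (cis t))) \<le> norm f * \<epsilon>" for t
        unfolding norm_mult using norm_bounded[of f "e' (cis t)"] norm_bounded[of "f - u" "e' (cis t)"] u(2)
        by (intro mult_mono) auto
    qed simp
    ultimately show ?thesis by simp
  qed
  have "L f = 0"
  proof (rule ccontr)
    assume *: "L f \<noteq> 0"
    then have pos: "0 < norm f" using L_scale[of 0 0] by (auto simp: L_def)
    \<comment> \<open>Chosen so that the bound in \<open>small\<close> becomes half of
      \<open>\<bar>L f\<bar>\<close>.\<close>
    let ?\<epsilon> = "\<bar>L f\<bar> / (norm f * (2 * pi) * 2)"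
    have "0 < ?\<epsilon>" using * pos by simp
    from small[OF this] show False using * pos by (simp add: field_simps)
  qed
  then have "\<forall>t\<in>{0..2*pi}. f (e' (cis t)) * f (e' (cis t)) = 0"
    unfolding L_def by (subst (asm) integral_eq_0_iff) (auto intro!: continuous_intros cf)
  then have "f x = 0" for x using obtain_angle[of x] by (metis atLeastAtMost_iff mult_eq_0_iff)
  then show ?thesis by (intro bcontfun_eqI) simp
qed

definition rotated :: "real \<Rightarrow> ('x \<Rightarrow>\<^sub>C real) \<Rightarrow> 'x \<Rightarrow>\<^sub>C real" where
  "rotated \<alpha> f = Bcontfun (\<lambda>x. f (e' (cis \<alpha> * e x)))"

lemma rotated [simp]: "apply_bcontfun (rotated \<alpha> f) x = f (e' (cis \<alpha> * e x))"
  unfolding rotated_def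
  by (subst apply_Bcontfun)
    (auto intro!: continuous_intros simp: norm_mult)

lemma rotated_wave: "rotated \<alpha> (wave a n) = wave (a * cis (real n * \<alpha>)) n"
  by (rule bcontfun_eqI) (simp add: norm_mult power_mult_distrib Complex.DeMoivre mult.assoc del: times_complex.sel)

lemma continuous_rotated: "continuous_on UNIV (\<lambda>\<alpha>. rotated \<alpha> f)"
proof -
  have "continuous_on UNIV (\<lambda>z. (\<lambda>(\<alpha>, x). f (e' (cis \<alpha> * e x))) z)"
    unfolding case_prod_unfold by (intro continuous_intros) (auto simp: norm_mult)
  then have "continuous_map (prod_topology euclidean euclidean) euclideanreal (\<lambda>(\<alpha>, x). f (e' (cis \<alpha> * e x)))"
    by (simp add: euclidean_product_topology)
  from continuous_map_into_bcontfun[OF compact_UNIV this] show ?thesis by (simp add: rotated_def)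
qed

text \<open>Averaging the rotations of \<open>f\<close> against \<open>cos (n\<alpha>)\<close> leaves its \<open>n\<close>-th Fourier component.
  The integral is taken in \<open>C(\<real>)\<close>, because \<open>C(X)\<close> is not known to be complete.\<close>

lemma fourier_component_in_invariant_subspace:
  assumes V: "closed V" "subspace V" and rot: "\<And>f \<alpha>. f \<in> V \<Longrightarrow> rotated \<alpha> f \<in> V" and f: "f \<in> V"
  shows "wave (fourier_coeff f n) n \<in> V"
proof -
  \<comment> \<open>\<open>J\<close> unrolls the circle onto the real line. It is isometric because
    every point of the circle has an angle.\<close>
  define J :: "('x \<Rightarrow>\<^sub>C real) \<Rightarrow> real \<Rightarrow>\<^sub>C real" where "J v = Bcontfun (\<lambda>t. v (e' (cis t)))" for v
  have J: "J v t = v (e' (cis t))" for v t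
    unfolding J_def
  proof (subst Bcontfun_inverse)
    show "(\<lambda>t. v (e' (cis t))) \<in> bcontfun"
      by (rule bcontfun_normI[of _ "norm v"])
        (auto intro!: continuous_intros intro: norm_bounded simp del: real_norm_def)
  qed simp
  have J_lin: "linear J" by (rule linearI; rule bcontfun_eqI; simp add: J)
  have J_norm: "norm (J v) = norm v" for v
  proof (rule antisym)
    show "norm (J v) \<le> norm v" by (rule norm_bound) (simp only: J norm_bounded)
    show "norm v \<le> norm (J v)"
    proof (rule norm_bound)
      fix x
      obtain t where "x = e' (cis t)" using obtain_angle by blast
      then show "norm (v x) \<le> norm (J v)" using norm_bounded[of "J v" t] by (simp only: J)
    qed
  qed
  \<comment> \<open>After the substitution \<open>r = t + s\<close>, the integral at angle
    \<open>s\<close> is that of \<open>f\<close> at angle \<open>r\<close> against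
    \<open>cos (n * (r - s))\<close>. This is the real part of the coefficient times
    \<open>cis s ^ n\<close>, with no normalising factor.\<close>
  define F where "F t = cos (real n * t) *\<^sub>R rotated t f" for t
  have JF: "continuous_on {0..2*pi} (\<lambda>t. J (F t))"
  proof -
    have "bounded_linear J" by (rule bounded_linear_intro[of _ 1]) (simp_all add: linear_add[OF J_lin] linear_cmul[OF J_lin] J_norm)
    then show ?thesis
      unfolding F_def
      by (intro bounded_linear.continuous_on[of J] continuous_intros continuous_on_subset[OF continuous_rotated]) auto
  qed
  then have int: "((\<lambda>t. J (F t)) has_integral integral {0..2*pi} (\<lambda>t. J (F t))) {0..2*pi}"
    by (intro integrable_integral integrable_continuous_real)
  have "integral {0..2*pi} (\<lambda>t. J (F t)) = J (wave (fourier_coeff f n) n)"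
  proof (rule bcontfun_eqI)
    fix s
    \<comment> \<open>The substitution over one period takes a shift in \<open>{0..2*pi}\<close>, so
      \<open>s\<close> is replaced by such an angle of the same point.\<close>
    obtain t where t: "0 \<le> t" "t \<le> 2 * pi" "e' (cis s) = e' (cis t)" using obtain_angle by blast
    then have st: "cis s = cis t" by (metis e_e' norm_cis)
    define G where "G r = f (e' (cis r)) * Re (cis (- (real n * r)) * cis t ^ n)" for r
    have "(G has_integral Re (fourier_coeff f n * cis t ^ n)) {0..2*pi}"
      unfolding G_def by (rule fourier_coeff_has_integral)
    moreover have "((\<lambda>r. G (r + t)) has_integral integral {0..2*pi} G) {0..2*pi}"
    proof (rule integral_periodic_shift[OF _ _ t(1,2)])
      show "continuous_on UNIV G"
        unfolding G_def
        by (intro continuous_intros) auto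
      show "G (r + 2 * pi) = G r" for r
      proof -
        have "cis (r + 2 * pi) = cis r" by (simp add: cis_mult[symmetric])
        moreover have "cis (- (real n * (r + 2 * pi))) = cis (- (real n * r))"
        proof -
          have "cis (- (real n * (r + 2 * pi))) = cis (- (real n * r)) * inverse (cis (2 * pi) ^ n)"
            unfolding Complex.DeMoivre cis_inverse cis_mult
            by (rule arg_cong[of _ _ cis]) (simp add: algebra_simps)
          then show ?thesis by simp
        qed
        ultimately show ?thesis by (simp only: G_def)
      qed
    qed
    ultimately have G: "((\<lambda>r. G (r + t)) has_integral Re (fourier_coeff f n * cis t ^ n)) {0..2*pi}"
      by (simp add: integral_unique)
    have "bounded_linear (\<lambda>v :: real \<Rightarrow>\<^sub>C real. v s)"
      by (rule bounded_linear_intro[of _ 1]) (auto intro: order_trans[OF norm_bounded] simp del: real_norm_def)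
    from has_integral_linear[OF int this]
    have "((\<lambda>r. cos (real n * r) * f (e' (cis r * cis s))) has_integral
        (integral {0..2*pi} (\<lambda>t. J (F t))) s) {0..2*pi}"
      by (simp add: o_def J F_def)
    moreover have "cos (real n * r) * f (e' (cis r * cis s)) = G (r + t)" for r
      unfolding G_def st Complex.DeMoivre cis_mult by (simp add: algebra_simps)
    ultimately show "(integral {0..2*pi} (\<lambda>t. J (F t))) s = J (wave (fourier_coeff f n) n) s"
      using has_integral_unique[OF _ G] by (simp add: J st del: times_complex.sel)
  qed
  then have "(F has_integral wave (fourier_coeff f n) n) {0..2*pi}"
    using has_integral_linear_isometry[OF J_lin J_norm, of F] int by simp
  then show ?thesis
    by (rule has_integral_in_closed_subspace[OF V]) (simp add: F_def subspace_scale[OF V(2)] rot f)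
qed

text \<open>For \<open>\<bar>s\<bar> < 1\<close> this is the hyperbolic translation of the disk with
  fixed points 1 and -1, restricted to the circle; writing \<open>s = tanh u\<close> turns
  composition into addition of \<open>u\<close>.\<close>

definition boost :: "real \<Rightarrow> 'x \<Rightarrow> 'x" where
  "boost s x = e' ((e x + of_real s) / (1 + of_real s * e x))"

definition boosted :: "real \<Rightarrow> ('x \<Rightarrow>\<^sub>C real) \<Rightarrow> 'x \<Rightarrow>\<^sub>C real" where
  "boosted s f = Bcontfun (\<lambda>x. f (boost s x))"

lemma boost_denominator:
  assumes "\<bar>s\<bar> < 1"
  shows "1 + of_real s * e x \<noteq> 0"
proof
  assume "1 + of_real s * e x = 0"
  then have "norm (of_real s * e x) = 1" by (metis add_eq_0_iff norm_minus_cancel norm_one)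
  then show False using assms by (simp add: norm_mult)
qed

lemma norm_boost:
  assumes "\<bar>s\<bar> < 1"
  shows "norm ((e x + of_real s) / (1 + of_real s * e x)) = 1"
proof -
  have "e x * cnj (e x) = 1" by (simp add: complex_norm_square[symmetric])
  then have "e x + of_real s = e x * cnj (1 + of_real s * e x)" by (simp add: algebra_simps)
  then have "norm (e x + of_real s) = norm (1 + of_real s * e x)"
    by (metis complex_mod_cnj mult_1 norm_e norm_mult)
  then show ?thesis
    using boost_denominator[OF assms, of x] by (simp add: norm_divide)
qed

lemma e_boost: "\<bar>s\<bar> < 1 \<Longrightarrow> e (boost s x) = (e x + of_real s) / (1 + of_real s * e x)"
  by (simp add: boost_def norm_boost)

text \<open>The derivative at \<open>s = 0\<close> of \<open>a z\<^sup>n\<close> along \<open>z \<mapsto> (z + s) / (1 + s z)\<close>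
  is \<open>n a (z\<^bsup>n-1\<^esup> - z\<^bsup>n+1\<^esup>)\<close>; the difference quotients converge uniformly.\<close>

lemma boost_derivative_in_invariant_subspace:
  assumes V: "closed V" "subspace V"
    and bst: "\<And>v s. v \<in> V \<Longrightarrow> 0 < s \<Longrightarrow> s \<le> 1/2 \<Longrightarrow> boosted s v \<in> V"
    and w: "\<And>a. wave a n \<in> V" and n: "1 \<le> n"
  shows "wave a (n - 1) - wave a (n + 1) \<in> V"
proof -
  define h where "h s x = (e x + of_real s) / (1 + of_real s * e x)" for s x
  \<comment> \<open>A closed form of the difference quotient: factoring
    \<open>h s x ^ n - e x ^ n\<close> cancels the factor \<open>s\<close>. Unlike the quotient,
    \<open>D\<close> makes sense at \<open>s = 0\<close>, and joint continuity on the closed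
    interval gives uniform convergence there.\<close>
  define D where "D s x = Re (a * ((1 - e x ^ 2) / (1 + of_real s * e x)) * (\<Sum>k<n. e x ^ (n - Suc k) * h s x ^ k))"
    for s x
  have den: "1 + of_real s * e x \<noteq> 0" if "s \<in> {0..1/2}" for s x
    using that by (intro boost_denominator) auto
  have cont: "continuous_on ({0..1/2} \<times> UNIV) (\<lambda>(s, x). D s x)"
    unfolding D_def h_def case_prod_unfold by (intro continuous_intros) (use den in auto)
  have "prod_topology (top_of_set {0..1/2}) euclidean = top_of_set ({0..1/2::real} \<times> (UNIV :: 'x set))"
    using subtopology_Times[of euclidean euclidean "{0..1/2::real}" "UNIV :: 'x set"]
    by (simp add: euclidean_product_topology)
  then have "continuous_map (prod_topology (top_of_set {0..1/2}) euclidean) euclideanreal (\<lambda>(s, x). D s x)"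
    using cont by (simp only: continuous_map_iff_continuous)
  from continuous_map_into_bcontfun[OF compact_UNIV this]
  have contD: "continuous_on {0..1/2} (\<lambda>s. Bcontfun (D s))" by simp
  have D: "apply_bcontfun (Bcontfun (D s)) = D s" if "s \<in> {0..1/2}" for s
    unfolding D_def h_def by (intro apply_Bcontfun continuous_intros) (use den that in auto)
  have DV: "Bcontfun (D s) \<in> V" if s: "0 < s" "s \<le> 1/2" for s
  proof -
    have cb: "continuous_on UNIV (boost s)"
      unfolding boost_def
      by (intro continuous_intros) (use den[of s] s in \<open>auto intro!: norm_boost\<close>)
    have "Bcontfun (D s) = inverse s *\<^sub>R (boosted s (wave a n) - wave a n)"
    proof (rule bcontfun_eqI)
      fix x
      have hq: "h s x - e x = of_real s * ((1 - e x ^ 2) / (1 + of_real s * e x))"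
        using den[of s x] s by (simp add: h_def field_simps power2_eq_square)
      have "a * h s x ^ n - a * e x ^ n = a * (h s x ^ n - e x ^ n)" by (simp only: right_diff_distrib)
      also have "h s x ^ n - e x ^ n = (h s x - e x) * (\<Sum>k<n. e x ^ (n - Suc k) * h s x ^ k)"
        by (rule power_diff_sumr2)
      finally have "a * h s x ^ n - a * e x ^ n =
          of_real s * (a * ((1 - e x ^ 2) / (1 + of_real s * e x)) * (\<Sum>k<n. e x ^ (n - Suc k) * h s x ^ k))"
        by (simp only: hq mult_ac)
      from arg_cong[OF this, of Re] have "Re (a * h s x ^ n) - Re (a * e x ^ n) = s * D s x"
        by (simp only: D_def Re_of_real_mult minus_complex.sel)
      moreover have "e (boost s x) = h s x" using s by (simp add: e_boost h_def)
      moreover have "apply_bcontfun (boosted s (wave a n)) = (\<lambda>x. wave a n (boost s x))"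
        unfolding boosted_def by (intro apply_Bcontfun continuous_intros cb)
      ultimately show "Bcontfun (D s) x = (inverse s *\<^sub>R (boosted s (wave a n) - wave a n)) x"
        using s by (simp add: D field_simps del: times_complex.sel)
    qed
    then show ?thesis
      using subspace_scale[OF V(2)] subspace_diff[OF V(2)] bst[OF w s] w by simp
  qed
  have "((\<lambda>s. Bcontfun (D s)) \<longlongrightarrow> Bcontfun (D 0)) (at 0 within {0..1/2})"
    using contD by (simp add: continuous_on_def)
  moreover have "\<forall>\<^sub>F s in at 0 within {0..1/2}. Bcontfun (D s) \<in> V"
    unfolding eventually_at_filter by (rule always_eventually) (auto intro!: DV)
  moreover have "at (0::real) within {0..1/2} \<noteq> bot" by (simp add: at_within_Icc_at_right)
  ultimately have "Bcontfun (D 0) \<in> V" by (rule Lim_in_closed_set[OF V(1), rotated -1])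
  moreover have "Bcontfun (D 0) = real n *\<^sub>R (wave a (n - 1) - wave a (n + 1))"
  proof (rule bcontfun_eqI)
    fix x
    have "(\<Sum>k<n. e x ^ (n - Suc k) * e x ^ k) = (\<Sum>k<n. e x ^ (n - 1))"
      by (intro sum.cong refl) (simp add: power_add[symmetric])
    then have "(\<Sum>k<n. e x ^ (n - Suc k) * h 0 x ^ k) = of_nat n * e x ^ (n - 1)" by (simp add: h_def)
    moreover have "e x ^ (n + 1) = e x ^ 2 * e x ^ (n - 1)"
      using n by (simp add: power_add[symmetric])
    ultimately have "D 0 x = Re (of_real (real n) * (a * e x ^ (n - 1) - a * e x ^ (n + 1)))"
      unfolding D_def by (simp add: algebra_simps)
    then show "Bcontfun (D 0) x = (real n *\<^sub>R (wave a (n - 1) - wave a (n + 1))) x"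
      by (simp only: D Re_of_real_mult) (simp add: D algebra_simps)
  qed
  ultimately show ?thesis
    using subspace_scale[OF V(2), of _ "inverse (real n)"] n by fastforce
qed

section \<open>From one nonzero Fourier component to all of \<open>C(X)\<close>, and the (LSW)
  criterion\<close>

lemma invariant_subspace_trivial:
  assumes V: "closed V" "subspace V"
    and one: "const_bcontfun 1 \<in> V"
    and rot: "\<And>v \<alpha>. v \<in> V \<Longrightarrow> rotated \<alpha> v \<in> V"
    and bst: "\<And>v s. v \<in> V \<Longrightarrow> 0 < s \<Longrightarrow> s \<le> 1/2 \<Longrightarrow> boosted s v \<in> V"
    and f: "f \<in> V" "\<nexists>c. \<forall>x. apply_bcontfun f x = c"
  shows "V = UNIV"
proof -
  \<comment> \<open>\<open>c\<close> is the mean of \<open>f\<close>. Removing it kills the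
    component of order 0, so a nonzero component has order at least 1, where rotations and
    derivatives act nontrivially.\<close>
  define c where "c = Re (fourier_coeff f 0) / (2 * pi)"
  define g where "g = f - c *\<^sub>R const_bcontfun 1"
  have gV: "g \<in> V" unfolding g_def by (intro subspace_diff[OF V(2)] subspace_scale[OF V(2)] f one)
  have "g \<noteq> 0"
  proof
    assume "g = 0"
    then have "f x = c" for x using arg_cong[of g 0 "\<lambda>u. apply_bcontfun u x"] by (simp add: g_def)
    then show False using f(2) by blast
  qed
  then obtain n where n: "fourier_coeff g n \<noteq> 0" using fourier_coeff_zero by blast
  have "fourier_coeff g 0 = 0"
  proof -
    have "((\<lambda>t. f (e' (cis t)) - c) has_integral Re (fourier_coeff f 0) - (2 * pi - 0) *\<^sub>R c) {0..2*pi}"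
      using fourier_coeff_has_integral[of f 0 1] has_integral_const_real[of c 0 "2 * pi"]
      by (intro has_integral_diff) simp_all
    then have "((\<lambda>t. g (e' (cis t))) has_integral 0) {0..2*pi}" by (simp add: g_def c_def)
    then have "((\<lambda>t. complex_of_real (g (e' (cis t)))) has_integral of_real 0) {0..2*pi}"
      by (rule has_integral_of_real)
    then show ?thesis unfolding fourier_coeff_def by (simp add: integral_unique)
  qed
  then have n1: "1 \<le> n" using n by (cases n) auto
  have wave_n: "wave a n \<in> V" for a
  proof -
    \<comment> \<open>Rotation by an angle multiplies the coefficient of order \<open>n\<close> by
      \<open>cis\<close> of \<open>n\<close> times that angle. Dividing the argument of
      \<open>?q\<close> by \<open>n\<close> and scaling by its modulus therefore turns the one known
      coefficient into any \<open>a\<close>.\<close>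
    let ?q = "a / fourier_coeff g n"
    have "wave a n = norm ?q *\<^sub>R rotated (Arg ?q / real n) (wave (fourier_coeff g n) n)"
    proof (rule bcontfun_eqI)
      fix x
      have "of_real (norm ?q) * cis (real n * (Arg ?q / real n)) = ?q"
        using n1 rcis_cmod_Arg[of ?q] by (simp add: rcis_def)
      then have "a * e x ^ n = of_real (norm ?q) * (fourier_coeff g n * cis (real n * (Arg ?q / real n)) * e x ^ n)"
        using n by (simp add: field_simps)
      then show "wave a n x = (norm ?q *\<^sub>R rotated (Arg ?q / real n) (wave (fourier_coeff g n) n)) x"
        by (simp only: rotated_wave scaleR_bcontfun.rep_eq wave Re_of_real_mult real_scaleR_def)
    qed
    then show ?thesis
      using subspace_scale[OF V(2)] rot fourier_component_in_invariant_subspace[OF V rot gV] by metis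
  qed
  have step: "wave a (m - 1) \<in> V \<and> wave a (m + 1) \<in> V" if m: "1 \<le> m" and w: "\<And>a. wave a m \<in> V" for m a
  proof -
    let ?u = "\<lambda>a. wave a (m - 1) - wave a (m + 1)"
    have u: "?u a \<in> V" for a by (rule boost_derivative_in_invariant_subspace[OF V bst w m])
    \<comment> \<open>Rotation by \<open>pi / 2\<close> gives the orders \<open>m - 1\<close> and
      \<open>m + 1\<close> opposite factors, since they differ by 2; \<open>b\<close> compensates
      the first factor. So the sum of the two waves lies in \<open>V\<close> along with their
      difference, and each wave follows.\<close>
    define b where "b = a / cis (real (m - 1) * (pi / 2))"
    have "cis (real (m + 1) * (pi / 2)) = - cis (real (m - 1) * (pi / 2))"
    proof -
      have "real (m + 1) * (pi / 2) = real (m - 1) * (pi / 2) + pi" using m by (simp add: of_nat_diff field_simps)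
      then show ?thesis by (simp only: cis_mult[symmetric] cis_pi) simp
    qed
    then have b: "b * cis (real (m - 1) * (pi / 2)) = a" "b * cis (real (m + 1) * (pi / 2)) = - a"
      by (simp_all add: b_def)
    have "rotated (pi / 2) (?u b) = rotated (pi / 2) (wave b (m - 1)) - rotated (pi / 2) (wave b (m + 1))"
      by (rule bcontfun_eqI) (simp only: rotated minus_bcontfun.rep_eq)
    also have "\<dots> = wave a (m - 1) - wave (- a) (m + 1)" by (simp only: rotated_wave b)
    also have "\<dots> = wave a (m - 1) + wave a (m + 1)" by (rule bcontfun_eqI) simp
    finally have "rotated (pi / 2) (?u b) = wave a (m - 1) + wave a (m + 1)" .
    then have "wave a (m - 1) + wave a (m + 1) \<in> V" using rot[OF u] by metis
    then have "(1/2) *\<^sub>R ((wave a (m - 1) + wave a (m + 1)) + ?u a) \<in> V"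
      "(1/2) *\<^sub>R ((wave a (m - 1) + wave a (m + 1)) - ?u a) \<in> V"
      using u subspace_add[OF V(2)] subspace_diff[OF V(2)] subspace_scale[OF V(2)] by blast+
    then show ?thesis by (simp add: scaleR_2[symmetric])
  qed
  \<comment> \<open>Orders above \<open>n\<close> are reached upwards and those below it downwards;
    a step down from \<open>n - k\<close> is taken only while \<open>n - k \<ge> 1\<close>.\<close>
  have "wave a (n + k) \<in> V" for a k
    by (induction k arbitrary: a) (use wave_n step n1 in auto)
  moreover have "k \<le> n \<Longrightarrow> wave a (n - k) \<in> V" for a k
  proof (induction k arbitrary: a)
    case (Suc k)
    then show ?case using step[of "n - k" a] by simp
  qed (simp add: wave_n)
  ultimately have "wave a k \<in> V" for a k
    by (metis diff_diff_cancel diff_le_self le_add_diff_inverse linear)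
  then have sub: "trig_polys \<subseteq> V"
    unfolding trig_polys_def by (intro span_minimal[OF _ V(2)]) auto
  have "v \<in> closure V" for v
  proof (rule closure_approachable[THEN iffD2, rule_format])
    fix \<epsilon> :: real assume "\<epsilon> > 0"
    then obtain w where "w \<in> trig_polys" "norm (v - w) \<le> \<epsilon> / 2" using trig_polys_dense[of "\<epsilon>/2" v] by auto
    then show "\<exists>w\<in>V. dist w v < \<epsilon>"
      using sub \<open>\<epsilon> > 0\<close> by (intro bexI[of _ w]) (auto simp: dist_norm norm_minus_commute)
  qed
  then show ?thesis using V(1) by auto
qed

text \<open>Composition with \<open>\<phi> g\<close> is a linear operator of norm at most 1 that
  sends translates of \<open>f\<close> to translates of \<open>f\<close> and fixes constants, so the
  closed span is invariant, in particular under rotations and boosts.\<close>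

lemma linear_stone_weierstrass_circle:
  assumes cont: "\<And>g. g \<in> S \<Longrightarrow> continuous_on UNIV (\<phi> g)"
    and comp: "\<And>g h. g \<in> S \<Longrightarrow> h \<in> S \<Longrightarrow> \<exists>k\<in>S. \<phi> k = \<phi> g \<circ> \<phi> h"
    and rot: "\<And>\<alpha>. \<exists>g\<in>S. \<forall>x. \<phi> g x = e' (cis \<alpha> * e x)"
    and bst: "\<And>s. 0 < s \<Longrightarrow> s \<le> 1/2 \<Longrightarrow> \<exists>g\<in>S. \<phi> g = boost s"
  shows "linear_stone_weierstrass S \<phi>"
  unfolding linear_stone_weierstrass_def
proof (intro allI impI)
  fix f :: "'x \<Rightarrow>\<^sub>C real" assume f: "\<nexists>c. \<forall>x. f x = c"
  let ?B = "{h. \<exists>g\<in>S. \<forall>x. apply_bcontfun h x = f (\<phi> g x)} \<union> {const_bcontfun 1}"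
  define T where "T g v = Bcontfun (\<lambda>x. apply_bcontfun v (\<phi> g x))" for g and v :: "'x \<Rightarrow>\<^sub>C real"
  have T: "T g v x = v (\<phi> g x)" if "g \<in> S" for g v x
    unfolding T_def by (subst apply_Bcontfun) (use that in \<open>auto intro!: continuous_intros cont\<close>)
  have inv: "T g v \<in> closure (span ?B)" if g: "g \<in> S" and v: "v \<in> closure (span ?B)" for g v
  proof -
    have lin: "linear (T g)" by (rule linearI; rule bcontfun_eqI; simp add: T g)
    have "norm (T g v) \<le> norm v" for v by (rule norm_bound) (simp only: T[OF g] norm_bounded)
    then have "bounded_linear (T g)"
      by (intro bounded_linear_intro[of _ 1]) (simp_all add: linear_add[OF lin] linear_cmul[OF lin])
    then have c: "continuous_on (closure (span ?B)) (T g)" by (rule linear_continuous_on)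
    have "T g ` span ?B \<subseteq> span ?B"
    proof -
      have "T g b \<in> ?B" if "b \<in> ?B" for b
      proof (cases "b = const_bcontfun 1")
        case True
        then have "T g b = const_bcontfun 1" by (intro bcontfun_eqI) (simp add: T g)
        then show ?thesis by simp
      next
        case False
        then have "b \<in> {h. \<exists>g\<in>S. \<forall>x. apply_bcontfun h x = f (\<phi> g x)}" using that by blast
        then obtain h where h: "h \<in> S" "\<forall>x. b x = f (\<phi> h x)" by blast
        then obtain k where "k \<in> S" "\<phi> k = \<phi> h \<circ> \<phi> g" using comp g by blast
        then show ?thesis using h by (auto simp: T g intro!: bexI[of _ k])
      qed
      then have "T g ` ?B \<subseteq> ?B" by blast
      from span_mono[OF this] show ?thesis unfolding linear_span_image[OF lin] .
    qed
    then have "T g ` closure (span ?B) \<subseteq> closure (span ?B)"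
      by (intro image_closure_subset[OF c] closed_closure order_trans[OF _ closure_subset])
    then show ?thesis using v by blast
  qed
  show "closure (span ?B) = UNIV"
  proof (rule invariant_subspace_trivial)
    show "const_bcontfun 1 \<in> closure (span ?B)"
      by (intro closure_subset[THEN subsetD] span_base) simp
    show "rotated \<alpha> v \<in> closure (span ?B)" if "v \<in> closure (span ?B)" for \<alpha> v
    proof -
      obtain g where g: "g \<in> S" "\<forall>x. \<phi> g x = e' (cis \<alpha> * e x)" using rot by blast
      then have "rotated \<alpha> v = T g v" by (simp add: rotated_def T_def)
      then show ?thesis using inv[OF g(1) that] by simp
    qed
    show "boosted s v \<in> closure (span ?B)"
      if vs: "v \<in> closure (span ?B)" "0 < s" "s \<le> 1/2" for v s
    proof -
      obtain g where g: "g \<in> S" "\<phi> g = boost s" using bst[OF vs(2,3)] by blast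
      then have "boosted s v = T g v" by (simp add: boosted_def T_def)
      then show ?thesis using inv[OF g(1) vs(1)] by simp
    qed
    show "f \<in> closure (span ?B)"
    proof -
      \<comment> \<open>The rotation by angle 0 acts as the identity, so \<open>f\<close> is one of
        its own translates.\<close>
      obtain g where g: "g \<in> S" "\<forall>x. \<phi> g x = e' (cis 0 * e x)" using rot by blast
      then have "f \<in> ?B" by (auto intro!: bexI[of _ g])
      then show ?thesis by (intro closure_subset[THEN subsetD] span_base)
    qed
  qed (rule f closed_closure subspace_closure subspace_span)+
qed

end

section \<open>The projective action of PSL(2,R)\<close>

lemma matrix_2_eq_iff: "A = B \<longleftrightarrow> (\<forall>i j. A $ i $ j = B $ i $ j)" for A B :: "real^2^2"
  by (simp add: vec_eq_iff)

lemma matrix_mult_2: "(A ** B) $ i $ j = A $ i $ 1 * B $ 1 $ j + A $ i $ 2 * B $ 2 $ j" for A B :: "real^2^2"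
  by (simp add: matrix_matrix_mult_def sum_2)

lemma matrix_vector_2: "(A *v v) $ i = A $ i $ 1 * v $ 1 + A $ i $ 2 * v $ 2" for A :: "real^2^2"
  by (simp add: matrix_vector_mult_def sum_2)

text \<open>For determinant one this is the inverse matrix; its entries are linear in those of
  \<open>A\<close>, which makes inversion visibly continuous.\<close>

definition adjugate :: "real^2^2 \<Rightarrow> real^2^2" where
  "adjugate A = vector [vector [A $ 2 $ 2, - A $ 1 $ 2], vector [- A $ 2 $ 1, A $ 1 $ 1]]"

lemma adjugate:
  assumes "det A = 1"
  shows "adjugate A ** A = mat 1" "A ** adjugate A = mat 1" "det (adjugate A) = 1"
  using assms
  by (auto simp: matrix_2_eq_iff forall_2 matrix_mult_2 adjugate_def vector_2 det_2 mat_def algebra_simps)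

lemma uminus_mat_mult: "(- mat 1) ** A = - A" "A ** (- mat 1) = - A" "(- A) *v v = - (A *v v)"
  "(- A) ** B = - (A ** B)" "A ** (- B) = - (A ** B)" for A B :: "real^2^2"
  by (simp_all add: vec_eq_iff matrix_mult_2 matrix_vector_2 mat_def forall_2)

lemma det_uminus_2: "det (- A) = det A" for A :: "real^2^2"
  by (simp add: det_2)

lemma group_SL2R: "group SL2R"
proof (rule groupI)
  show "\<exists>y\<in>carrier SL2R. y \<otimes>\<^bsub>SL2R\<^esub> x = \<one>\<^bsub>SL2R\<^esub>" if "x \<in> carrier SL2R" for x
    using that adjugate by (intro bexI[of _ "adjugate x"]) (auto simp: SL2R_def)
qed (auto simp: SL2R_def det_mul matrix_mul_assoc)

abbreviation "pm1 \<equiv> {mat 1, - mat 1} :: (real^2^2) set"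

definition SL2R_class :: "real^2^2 \<Rightarrow> (real^2^2) set" where
  "SL2R_class A = pm1 #>\<^bsub>SL2R\<^esub> A"

lemma SL2R_class_eq: "SL2R_class A = {A, - A}"
  by (auto simp: SL2R_class_def r_coset_def SL2R_def uminus_mat_mult)

lemma subgroup_pm1: "subgroup pm1 SL2R"
proof (rule group.subgroupI[OF group_SL2R])
  have m: "- mat 1 \<in> carrier SL2R" by (simp add: SL2R_def det_uminus_2)
  then show "pm1 \<subseteq> carrier SL2R" by (simp add: SL2R_def)
  show "inv\<^bsub>SL2R\<^esub> a \<in> pm1" if "a \<in> pm1" for a
  proof -
    have "inv\<^bsub>SL2R\<^esub> a = a"
      using that m by (intro group.inv_equality[OF group_SL2R]) (auto simp: SL2R_def uminus_mat_mult)
    then show ?thesis using that by simp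
  qed
qed (auto simp: SL2R_def uminus_mat_mult)

lemma normal_pm1: "pm1 \<lhd> SL2R"
  by (rule group.normalI[OF group_SL2R subgroup_pm1])
    (auto simp: SL2R_class_def r_coset_def l_coset_def SL2R_def uminus_mat_mult)

lemma group_PSL2R: "group PSL2R"
  unfolding PSL2R_def by (rule normal.factorgroup_is_group[OF normal_pm1])

lemma carrier_PSL2R: "carrier PSL2R = SL2R_class ` carrier SL2R"
  by (auto simp: PSL2R_def FactGroup_def RCOSETS_def SL2R_class_def)

lemma mult_SL2R_class:
  assumes "A \<in> carrier SL2R" "B \<in> carrier SL2R"
  shows "SL2R_class A \<otimes>\<^bsub>PSL2R\<^esub> SL2R_class B = SL2R_class (A ** B)"
  using normal.rcos_sum[OF normal_pm1 assms] by (simp add: PSL2R_def FactGroup_def SL2R_class_def SL2R_def)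

lemma one_PSL2R: "\<one>\<^bsub>PSL2R\<^esub> = SL2R_class (mat 1)"
  by (simp add: PSL2R_def FactGroup_def SL2R_class_eq)

lemma inv_SL2R_class:
  assumes "A \<in> carrier SL2R"
  shows "inv\<^bsub>PSL2R\<^esub> (SL2R_class A) = SL2R_class (adjugate A)"
proof (rule group.inv_equality[OF group_PSL2R])
  have "adjugate A \<in> carrier SL2R" using assms adjugate by (simp add: SL2R_def)
  then show "SL2R_class (adjugate A) \<otimes>\<^bsub>PSL2R\<^esub> SL2R_class A = \<one>\<^bsub>PSL2R\<^esub>"
    "SL2R_class A \<in> carrier PSL2R" "SL2R_class (adjugate A) \<in> carrier PSL2R"
    using assms adjugate(1)[of A] by (auto simp: mult_SL2R_class one_PSL2R carrier_PSL2R SL2R_def)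
qed

abbreviation "SL2R_topology \<equiv> top_of_set (carrier SL2R)"

lemma topspace_PSL2R: "topspace PSL2R_topology = carrier PSL2R"
proof -
  have "openin PSL2R_topology (carrier PSL2R)"
  proof -
    have "{A \<in> carrier SL2R. pm1 #>\<^bsub>SL2R\<^esub> A \<in> carrier PSL2R} = carrier SL2R"
      using carrier_PSL2R by (auto simp: SL2R_class_def)
    then show ?thesis by (simp add: openin_PSL2R_topology)
  qed
  moreover have "topspace PSL2R_topology \<subseteq> carrier PSL2R"
    using openin_topspace[of PSL2R_topology] unfolding openin_PSL2R_topology by blast
  ultimately show ?thesis by (meson openin_subset subset_antisym)
qed

lemma continuous_map_SL2R_class: "continuous_map SL2R_topology PSL2R_topology SL2R_class"
  unfolding continuous_map
  using openin_PSL2R_topology by (auto simp: topspace_PSL2R carrier_PSL2R SL2R_class_def)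

text \<open>The preimage of the image of \<open>W\<close> is the union of \<open>W\<close> and
  \<open>-W\<close>, and negation is a continuous map of \<open>SL2R\<close>.\<close>

lemma open_map_SL2R_class: "open_map SL2R_topology PSL2R_topology SL2R_class"
  unfolding open_map_def
proof (intro allI impI)
  fix W assume W: "openin SL2R_topology W"
  then have sub: "W \<subseteq> carrier SL2R" using openin_subset by fastforce
  have neg: "continuous_map SL2R_topology SL2R_topology (\<lambda>A. - A)"
    by (auto simp: SL2R_def det_uminus_2 intro!: continuous_intros)
  have "{A \<in> carrier SL2R. pm1 #>\<^bsub>SL2R\<^esub> A \<in> SL2R_class ` W} = W \<union> {A \<in> carrier SL2R. - A \<in> W}"
  proof (intro equalityI subsetI)
    fix A assume "A \<in> {A \<in> carrier SL2R. pm1 #>\<^bsub>SL2R\<^esub> A \<in> SL2R_class ` W}"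
    then obtain B where "A \<in> carrier SL2R" "B \<in> W" "{A, - A} = {B, - B}"
      by (auto simp: SL2R_class_def[symmetric] SL2R_class_eq)
    then show "A \<in> W \<union> {A \<in> carrier SL2R. - A \<in> W}" by (auto simp: doubleton_eq_iff)
  next
    fix A assume "A \<in> W \<union> {A \<in> carrier SL2R. - A \<in> W}"
    moreover have "SL2R_class A = SL2R_class (- A)" by (auto simp: SL2R_class_eq)
    ultimately show "A \<in> {A \<in> carrier SL2R. pm1 #>\<^bsub>SL2R\<^esub> A \<in> SL2R_class ` W}"
      using sub by (auto simp: SL2R_class_def[symmetric])
  qed
  moreover have "openin SL2R_topology {A \<in> carrier SL2R. - A \<in> W}"
    using openin_continuous_map_preimage[OF neg W] by simp
  ultimately show "openin PSL2R_topology (SL2R_class ` W)"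
    unfolding openin_PSL2R_topology using sub W carrier_PSL2R by (auto intro: openin_Un)
qed

lemma image_SL2R_class: "SL2R_class ` topspace SL2R_topology = topspace PSL2R_topology"
  by (simp add: carrier_PSL2R topspace_PSL2R)

lemma topological_group_PSL2R: "topological_group PSL2R PSL2R_topology"
  unfolding topological_group_def
proof (intro conjI group_PSL2R topspace_PSL2R)
  have "continuous_on (carrier SL2R \<times> carrier SL2R) (\<lambda>z. fst z ** snd z)"
    unfolding matrix_matrix_mult_def by (intro continuous_on_vec_lambda continuous_intros)
  then have "continuous_map (prod_topology SL2R_topology SL2R_topology) SL2R_topology (\<lambda>z. fst z ** snd z)"
    using subtopology_Times[of euclidean euclidean "carrier SL2R" "carrier SL2R"]
    by (auto simp: euclidean_product_topology SL2R_def det_mul)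
  from continuous_map_compose[OF this continuous_map_SL2R_class]
  have "continuous_map (prod_topology SL2R_topology SL2R_topology) PSL2R_topology
      (\<lambda>(A, B). SL2R_class A \<otimes>\<^bsub>PSL2R\<^esub> SL2R_class B)"
    by (rule continuous_map_eq) (auto simp: mult_SL2R_class)
  then show "continuous_map (prod_topology PSL2R_topology PSL2R_topology) PSL2R_topology
      (\<lambda>(x, y). x \<otimes>\<^bsub>PSL2R\<^esub> y)"
    by (intro continuous_map_prod_open_quotient[OF continuous_map_SL2R_class open_map_SL2R_class image_SL2R_class
          continuous_map_SL2R_class open_map_SL2R_class image_SL2R_class])
  \<comment> \<open>An entrywise form, swapping the two diagonal entries and negating the others, in
    which continuity is checked coordinate by coordinate.\<close>
  have eq: "adjugate = (\<lambda>A. \<chi> i j. if i = j then A $ (if i = 1 then 2 else 1) $ (if i = 1 then 2 else 1) else - A $ i $ j)"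
    by (rule ext) (auto simp: adjugate_def vec_eq_iff forall_2 vector_2)
  have "continuous_on (carrier SL2R) adjugate"
    unfolding eq
  proof (intro continuous_on_vec_lambda)
    fix i j :: 2
    show "continuous_on (carrier SL2R) (\<lambda>A. if i = j then A $ (if i = 1 then 2 else 1) $ (if i = 1 then 2 else 1) else - A $ i $ j)"
      by (cases "i = j") (simp_all only: if_True if_False refl, (intro continuous_intros)+)
  qed
  then have "continuous_map SL2R_topology SL2R_topology adjugate"
    using adjugate by (auto simp: SL2R_def)
  from continuous_map_compose[OF this continuous_map_SL2R_class]
  have "continuous_map SL2R_topology PSL2R_topology ((\<lambda>x. inv\<^bsub>PSL2R\<^esub> x) \<circ> SL2R_class)"
    by (rule continuous_map_eq) (auto simp: inv_SL2R_class)
  then show "continuous_map PSL2R_topology PSL2R_topology (\<lambda>x. inv\<^bsub>PSL2R\<^esub> x)"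
    using continuous_open_imp_quotient_map[OF continuous_map_SL2R_class open_map_SL2R_class image_SL2R_class]
    by (metis continuous_compose_quotient_map)
qed

section \<open>The projective line as a quotient of the punctured plane and as a circle\<close>

definition line :: "real^2 \<Rightarrow> proj_line" where
  "line v = Abs_proj_line (span {v})"

lemma Rep_line: "v \<noteq> 0 \<Longrightarrow> Rep_proj_line (line v) = span {v}"
  unfolding line_def by (rule Abs_proj_line_inverse) (simp add: dim_span dim_singleton)

lemma line_scaleR: "c \<noteq> 0 \<Longrightarrow> line (c *\<^sub>R v) = line v"
  using span_image_scale[of "{v}" "\<lambda>_. c"] by (simp add: line_def)

lemma obtain_line:
  obtains v where "v \<noteq> 0" "L = line v"
proof -
  have L: "subspace (Rep_proj_line L)" "dim (Rep_proj_line L) = 1" using Rep_proj_line[of L] by auto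
  then obtain v where v: "v \<in> Rep_proj_line L" "v \<noteq> 0"
    by (metis dim_eq_0 singletonI subsetI zero_neq_one)
  then have "span {v} = Rep_proj_line L"
    using L by (intro subspace_dim_equal) (auto simp: span_minimal dim_span dim_singleton)
  then have "L = line v" by (simp add: line_def Rep_proj_line_inverse)
  then show thesis using that v(2) by blast
qed

lemma line_eq_iff:
  assumes "u \<noteq> 0" "v \<noteq> 0"
  shows "line u = line v \<longleftrightarrow> (\<exists>c. c \<noteq> 0 \<and> u = c *\<^sub>R v)"
proof
  assume "line u = line v"
  then have "u \<in> span {v}" using Rep_line[OF assms(1)] Rep_line[OF assms(2)] span_base[of u "{u}"] by auto
  then show "\<exists>c. c \<noteq> 0 \<and> u = c *\<^sub>R v" using assms(1) by (auto simp: span_singleton)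
qed (auto simp: line_scaleR)

lemma openin_punctured_plane: "openin (top_of_set (- {0 :: real^2})) U \<longleftrightarrow> open U \<and> U \<subseteq> - {0}"
  by (rule openin_open_eq) (rule open_Compl, rule closed_singleton)

abbreviation "punctured_plane \<equiv> top_of_set (- {0 :: real^2})"

lemma open_proj_line_iff: "open U \<longleftrightarrow> open {v. v \<noteq> 0 \<and> line v \<in> U}"
  by (simp add: open_proj_line_def line_def)

lemma continuous_map_line: "continuous_map punctured_plane euclidean line"
proof -
  have "openin punctured_plane {v \<in> - {0}. line v \<in> U}" if "open U" for U
  proof -
    have "{v \<in> - {0}. line v \<in> U} = {v. v \<noteq> 0 \<and> line v \<in> U}" by auto
    then show ?thesis using that open_proj_line_iff[of U] by (auto simp: openin_punctured_plane)
  qed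
  then show ?thesis by (auto simp: continuous_map)
qed

text \<open>The preimage of the image of \<open>W\<close> is the union of all nonzero multiples of
  \<open>W\<close>, each of them open.\<close>

lemma open_map_line: "open_map punctured_plane euclidean line"
  unfolding open_map_def
proof (intro allI impI)
  fix W assume "openin punctured_plane W"
  then have W: "open W" "W \<subseteq> - {0}" by (simp_all add: openin_punctured_plane)
  have "{v. v \<noteq> 0 \<and> line v \<in> line ` W} = (\<Union>c\<in>-{0}. (\<lambda>v. c *\<^sub>R v) ` W)"
  proof safe
    fix v w assume *: "v \<noteq> 0" "line v = line w" "w \<in> W"
    then obtain c where "c \<noteq> 0" "v = c *\<^sub>R w" using line_eq_iff[of v w] W by auto
    then show "v \<in> (\<Union>c\<in>-{0}. (\<lambda>v. c *\<^sub>R v) ` W)" using * by auto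
  next
    fix c w assume "c \<noteq> (0::real)" "w \<in> W"
    then show "line (c *\<^sub>R w) \<in> line ` W" by (simp add: line_scaleR)
  qed (use W in auto)
  moreover have "open (\<Union>c\<in>-{0}. (\<lambda>v. c *\<^sub>R v) ` W)"
    using open_scaling W(1) by (intro open_UN) auto
  ultimately show "openin euclidean (line ` W)" by (simp add: open_proj_line_iff)
qed

lemma image_line: "line ` topspace punctured_plane = topspace euclidean"
proof -
  have "L \<in> line ` (- {0})" for L by (rule obtain_line[of L]) auto
  then show ?thesis by auto
qed

lemma mult_SL2R_nonzero:
  assumes "A \<in> carrier SL2R" "v \<noteq> 0"
  shows "A *v v \<noteq> 0"
proof
  assume "A *v v = 0"
  then have "(adjugate A ** A) *v v = 0" by (simp add: matrix_vector_mul_assoc[symmetric])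
  then show False using adjugate(1)[of A] assms by (simp add: SL2R_def)
qed

lemma PSL2R_action_line:
  assumes "A \<in> carrier SL2R" "v \<noteq> 0"
  shows "PSL2R_action (SL2R_class A) (line v) = line (A *v v)"
proof -
  have "(\<Union>B\<in>{A, - A}. (\<lambda>v. B *v v) ` span {v}) = span {A *v v}"
  proof -
    have 1: "(\<lambda>v. A *v v) ` span {v} = span {A *v v}"
      using linear_span_image[OF matrix_vector_mul_linear[of A], of "{v}"] by simp
    moreover have "(\<lambda>v. (- A) *v v) ` span {v} = span {A *v v}"
    proof -
      have "(\<lambda>v. (- A) *v v) ` span {v} = uminus ` span {A *v v}"
        unfolding 1[symmetric] image_image by (simp add: uminus_mat_mult)
      also have "\<dots> = span {A *v v}"
      proof safe
        show "- x \<in> span {A *v v}" if "x \<in> span {A *v v}" for x using that by (rule span_neg)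
        show "x \<in> uminus ` span {A *v v}" if "x \<in> span {A *v v}" for x
          using that span_neg by (intro image_eqI[of _ _ "- x"]) auto
      qed
      finally show ?thesis .
    qed
    ultimately show ?thesis by simp
  qed
  then show ?thesis unfolding PSL2R_action_def SL2R_class_eq Rep_line[OF assms(2)] line_def[of "A *v v"] by simp
qed

lemma continuous_map_PSL2R_action:
  "continuous_map (prod_topology PSL2R_topology euclidean) euclidean (\<lambda>(g, x). PSL2R_action g x)"
proof (rule continuous_map_prod_open_quotient[OF continuous_map_SL2R_class open_map_SL2R_class image_SL2R_class
      continuous_map_line open_map_line image_line])
  have "continuous_on (carrier SL2R \<times> - {0}) (\<lambda>z. fst z *v snd z)"
    unfolding matrix_vector_mult_def by (intro continuous_on_vec_lambda continuous_intros)
  moreover have "(\<lambda>z. fst z *v snd z) \<in> carrier SL2R \<times> - {0} \<rightarrow> - {0}"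
  proof
    fix z assume "z \<in> carrier SL2R \<times> - {0 :: real^2}"
    then show "fst z *v snd z \<in> - {0}" using mult_SL2R_nonzero[of "fst z" "snd z"] by auto
  qed
  ultimately have "continuous_map (prod_topology SL2R_topology punctured_plane) punctured_plane (\<lambda>z. fst z *v snd z)"
    using subtopology_Times[of euclidean euclidean "carrier SL2R" "- {0 :: real^2}"]
    by (simp add: euclidean_product_topology)
  from continuous_map_compose[OF this continuous_map_line]
  show "continuous_map (prod_topology SL2R_topology punctured_plane) euclidean
      (\<lambda>(A, v). PSL2R_action (SL2R_class A) (line v))"
    by (rule continuous_map_eq) (simp add: case_prod_unfold PSL2R_action_line mem_Times_iff)
qed

lemma group_actionI:
  assumes G: "group G" and ext: "\<And>g. g \<in> carrier G \<Longrightarrow> \<phi> g \<in> extensional E"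
    and closed: "\<And>g x. g \<in> carrier G \<Longrightarrow> x \<in> E \<Longrightarrow> \<phi> g x \<in> E"
    and one: "\<And>x. x \<in> E \<Longrightarrow> \<phi> \<one>\<^bsub>G\<^esub> x = x"
    and mult: "\<And>g h x. g \<in> carrier G \<Longrightarrow> h \<in> carrier G \<Longrightarrow> x \<in> E \<Longrightarrow> \<phi> (g \<otimes>\<^bsub>G\<^esub> h) x = \<phi> g (\<phi> h x)"
  shows "group_action G E \<phi>"
proof -
  interpret group G by fact
  have bij: "\<phi> g \<in> Bij E" if g: "g \<in> carrier G" for g
  proof -
    have "bij_betw (\<phi> g) E E"
    proof (rule bij_betw_byWitness[of _ "\<phi> (inv\<^bsub>G\<^esub> g)"])
      show "\<forall>x\<in>E. \<phi> (inv\<^bsub>G\<^esub> g) (\<phi> g x) = x"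
        using mult[of "inv\<^bsub>G\<^esub> g" g, symmetric] g one by simp
      show "\<forall>x\<in>E. \<phi> g (\<phi> (inv\<^bsub>G\<^esub> g) x) = x"
        using mult[of g "inv\<^bsub>G\<^esub> g", symmetric] g one by simp
    qed (use closed g in auto)
    then show ?thesis using ext[OF g] by (simp add: Bij_def)
  qed
  have "\<phi> (g \<otimes>\<^bsub>G\<^esub> h) = compose E (\<phi> g) (\<phi> h)" if "g \<in> carrier G" "h \<in> carrier G" for g h
    by (rule extensionalityI[of _ E]) (use that ext mult in \<open>auto simp: compose_def\<close>)
  then have "\<phi> \<in> hom G (BijGroup E)"
    using bij by (auto simp: hom_def BijGroup_def)
  then show ?thesis
    by (simp add: group_action_def group_hom_def group_hom_axioms_def group_BijGroup G)
qed

lemma group_action_PSL2R: "group_action PSL2R UNIV PSL2R_action"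
proof (rule group_actionI[OF group_PSL2R])
  show "PSL2R_action \<one>\<^bsub>PSL2R\<^esub> x = x" for x
  proof (rule obtain_line[of x])
    fix v assume "v \<noteq> 0" "x = line v"
    then show ?thesis by (simp add: one_PSL2R PSL2R_action_line SL2R_def)
  qed
  show "PSL2R_action (g \<otimes>\<^bsub>PSL2R\<^esub> h) x = PSL2R_action g (PSL2R_action h x)"
    if gh: "g \<in> carrier PSL2R" "h \<in> carrier PSL2R" for g h x
  proof (rule obtain_line[of x])
    fix v assume v: "v \<noteq> 0" "x = line v"
    obtain A B where AB: "A \<in> carrier SL2R" "g = SL2R_class A" "B \<in> carrier SL2R" "h = SL2R_class B"
      using gh unfolding carrier_PSL2R by blast
    then have "A ** B \<in> carrier SL2R" by (simp add: SL2R_def det_mul)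
    then show ?thesis
      using AB v mult_SL2R_nonzero by (simp add: mult_SL2R_class PSL2R_action_line matrix_vector_mul_assoc)
  qed
qed auto

definition plane_complex :: "real^2 \<Rightarrow> complex" where
  "plane_complex v = Complex (v $ 1) (v $ 2)"

lemma plane_complex_eq_0_iff [simp]: "plane_complex v = 0 \<longleftrightarrow> v = 0"
  by (simp add: plane_complex_def complex_eq_iff vec_eq_iff forall_2)

lemma plane_complex_scaleR: "plane_complex (c *\<^sub>R v) = of_real c * plane_complex v"
  by (simp add: plane_complex_def complex_eq_iff)

text \<open>For a vector at angle t the value is \<open>cis\<close> of 2t: real scaling cancels, so
  all vectors of a line agree, and doubling the angle identifies opposite vectors and nothing
  more.\<close>

definition line_direction :: "proj_line \<Rightarrow> complex" where
  "line_direction L = (let v = SOME v. v \<noteq> 0 \<and> L = line v in plane_complex v / cnj (plane_complex v))"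

lemma line_direction_line:
  assumes "v \<noteq> 0"
  shows "line_direction (line v) = plane_complex v / cnj (plane_complex v)"
proof -
  define u where "u = (SOME u. u \<noteq> 0 \<and> line v = line u)"
  have u: "u \<noteq> 0 \<and> line v = line u" unfolding u_def by (rule someI[of _ v]) (use assms in simp)
  then obtain c where "c \<noteq> 0" "v = c *\<^sub>R u" using line_eq_iff[of v u] assms by blast
  then have "plane_complex v / cnj (plane_complex v) = plane_complex u / cnj (plane_complex u)"
    by (simp add: plane_complex_scaleR)
  then show ?thesis by (simp add: line_direction_def u_def[symmetric] Let_def)
qed

text \<open>A continuous bijection from a compact space onto a Hausdorff space. Compactness holds
  because unit vectors represent all lines, continuity is checked on the punctured plane, and a
  complex square root of \<open>z\<close> gives a vector with direction \<open>z\<close>.\<close>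

lemma homeomorphism_proj_line: "\<exists>e'. homeomorphism UNIV (sphere 0 1) line_direction e'"
proof (rule homeomorphism_compact)
  have "L \<in> line ` sphere 0 1" for L
  proof (rule obtain_line[of L])
    fix v assume v: "v \<noteq> 0" "L = line v"
    then have "L = line ((1 / norm v) *\<^sub>R v)" by (simp add: line_scaleR)
    then show ?thesis using v(1) by (intro image_eqI[of _ _ "(1 / norm v) *\<^sub>R v"]) auto
  qed
  then have "line ` sphere 0 1 = UNIV" by auto
  moreover have "continuous_on (sphere 0 1) line"
    using continuous_map_line by (simp add: continuous_on_subset[of "- {0}"])
  ultimately show "compact (UNIV :: proj_line set)"
    by (metis compact_continuous_image compact_sphere)
  have "continuous_map euclidean euclidean line_direction"
  proof (rule continuous_compose_quotient_map[OF continuous_open_imp_quotient_map[OF continuous_map_line open_map_line image_line]])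
    have "continuous_on (- {0}) (\<lambda>v. plane_complex v / cnj (plane_complex v))"
      unfolding plane_complex_def Complex_eq
      by (intro continuous_intros) (auto simp: Complex_eq[symmetric] plane_complex_def[symmetric])
    then show "continuous_map punctured_plane euclidean (line_direction \<circ> line)"
      by (auto simp: line_direction_line cong: continuous_on_cong_simp)
  qed
  then show "continuous_on UNIV line_direction" by simp
  show "inj_on line_direction UNIV"
  proof (rule injI)
    fix L M assume eq: "line_direction L = line_direction M"
    obtain u v where uv: "u \<noteq> 0" "L = line u" "v \<noteq> 0" "M = line v" using obtain_line by metis
    then have "plane_complex u * cnj (plane_complex v) = plane_complex v * cnj (plane_complex u)"
      using eq by (simp add: line_direction_line field_simps)
    \<comment> \<open>Equal directions make the ratio of the two vectors equal to its conjugate,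
      hence real.\<close>
    then have "plane_complex u / plane_complex v = cnj (plane_complex u / plane_complex v)"
      using uv by (simp add: field_simps)
    then obtain c where "plane_complex u / plane_complex v = of_real c"
      by (metis Reals_cases Reals_cnj_iff)
    then have c: "plane_complex u = of_real c * plane_complex v" using uv by (simp add: field_simps)
    then have "u = c *\<^sub>R v" by (simp add: plane_complex_def complex_eq_iff vec_eq_iff forall_2)
    moreover have "c \<noteq> 0" using c uv by auto
    ultimately show "L = M" using uv line_scaleR by simp
  qed
  show "line_direction ` UNIV = sphere 0 1"
  proof safe
    show "line_direction L \<in> sphere 0 1" for L
      by (rule obtain_line[of L]) (simp add: line_direction_line norm_divide)
    fix z :: complex assume z: "z \<in> sphere 0 1"
    define w where "w = csqrt z"
    have w: "norm w = 1" "w ^ 2 = z" using z by (simp_all add: w_def)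
    define v :: "real^2" where "v = vector [Re w, Im w]"
    have vw: "plane_complex v = w" by (simp add: plane_complex_def v_def vector_2)
    have "w / cnj w = w ^ 2"
    proof -
      have "w * cnj w = 1" using w(1) by (simp add: complex_norm_square[symmetric])
      moreover have "cnj w \<noteq> 0" using w(1) by auto
      ultimately show ?thesis by (simp add: divide_eq_eq power2_eq_square mult.assoc)
    qed
    have "line_direction (line v) = z"
    proof -
      have "v \<noteq> 0"
      proof
        assume "v = 0"
        then have "w = 0" using vw plane_complex_eq_0_iff[of v] by simp
        then show False using w(1) by simp
      qed
      then show ?thesis using \<open>w / cnj w = w ^ 2\<close> w(2) by (simp add: line_direction_line vw)
    qed
    then show "z \<in> range line_direction" by blast
  qed
qed

text \<open>Up to a positive factor, \<open>diag(\<lambda>, 1/\<lambda>)\<close> acts on the plane as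
  \<open>w \<mapsto> w + s cnj w\<close> with \<open>s = (\<lambda>\<^sup>2 - 1) / (\<lambda>\<^sup>2 + 1)\<close>.\<close>

lemma linear_stone_weierstrass_PSL2R: "linear_stone_weierstrass (carrier PSL2R) PSL2R_action"
proof -
  obtain e' where "homeomorphism UNIV (sphere 0 1) line_direction e'" using homeomorphism_proj_line by blast
  then interpret circle_homeomorphism line_direction e' by unfold_locales
  show ?thesis
  proof (rule linear_stone_weierstrass_circle)
    show "continuous_on UNIV (PSL2R_action g)" if "g \<in> carrier PSL2R" for g
      using continuous_map_prod_slice[OF continuous_map_PSL2R_action, of g] that topspace_PSL2R by simp
    show "\<exists>k\<in>carrier PSL2R. PSL2R_action k = PSL2R_action g \<circ> PSL2R_action h"
      if "g \<in> carrier PSL2R" "h \<in> carrier PSL2R" for g h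
    proof (intro bexI ext)
      show "PSL2R_action (g \<otimes>\<^bsub>PSL2R\<^esub> h) x = (PSL2R_action g \<circ> PSL2R_action h) x" for x
        using group_action.composition_rule[OF group_action_PSL2R, of x g h] that by simp
      show "g \<otimes>\<^bsub>PSL2R\<^esub> h \<in> carrier PSL2R"
        using that group_PSL2R by (simp add: group.is_monoid monoid.m_closed)
    qed
    have act: "line_direction (PSL2R_action (SL2R_class A) (line v)) =
        plane_complex (A *v v) / cnj (plane_complex (A *v v))"
      if "A \<in> carrier SL2R" "v \<noteq> 0" for A v
      using that mult_SL2R_nonzero by (simp add: PSL2R_action_line line_direction_line)
    show "\<exists>g\<in>carrier PSL2R. \<forall>x. PSL2R_action g x = e' (cis \<alpha> * line_direction x)" for \<alpha>
    proof (intro bexI allI)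
      \<comment> \<open>The half angle compensates the doubling in
        \<open>line_direction\<close>.\<close>
      let ?A = "vector [vector [cos (\<alpha>/2), - sin (\<alpha>/2)], vector [sin (\<alpha>/2), cos (\<alpha>/2)]] :: real^2^2"
      have A: "?A \<in> carrier SL2R" by (simp add: SL2R_def det_2 vector_2 power2_eq_square[symmetric])
      then show "SL2R_class ?A \<in> carrier PSL2R" by (simp add: carrier_PSL2R)
      show "PSL2R_action (SL2R_class ?A) x = e' (cis \<alpha> * line_direction x)" for x
      proof (rule obtain_line[of x])
        fix v assume v: "v \<noteq> 0" "x = line v"
        have "plane_complex (?A *v v) = cis (\<alpha>/2) * plane_complex v"
          by (simp add: plane_complex_def matrix_vector_2 vector_2 complex_eq_iff)
        from this act[OF A v(1)] have "line_direction (PSL2R_action (SL2R_class ?A) x) =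
            (cis (\<alpha>/2) / cnj (cis (\<alpha>/2))) * line_direction x"
          by (simp only: v(2) line_direction_line[OF v(1)] complex_cnj_mult times_divide_times_eq)
        also have "cis (\<alpha>/2) / cnj (cis (\<alpha>/2)) = cis \<alpha>"
          by (simp add: cis_cnj cis_divide)
        finally have "line_direction (PSL2R_action (SL2R_class ?A) x) = cis \<alpha> * line_direction x" .
        from arg_cong[OF this, of e'] show ?thesis by (simp only: e'_e)
      qed
    qed
    show "\<exists>g\<in>carrier PSL2R. PSL2R_action g = boost s" if s: "0 < s" "s \<le> 1/2" for s
    proof (intro bexI ext)
      \<comment> \<open>Solves \<open>(l ^ 2 - 1) / (l ^ 2 + 1) = s\<close> for the diagonal
        entry.\<close>
      define l where "l = sqrt ((1 + s) / (1 - s))"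
      have l: "0 < l" "l ^ 2 * (1 - s) = 1 + s" using s by (auto simp: l_def field_simps)
      let ?A = "vector [vector [l, 0], vector [0, 1 / l]] :: real^2^2"
      have A: "?A \<in> carrier SL2R" using l by (simp add: SL2R_def det_2 vector_2)
      then show "SL2R_class ?A \<in> carrier PSL2R" by (simp add: carrier_PSL2R)
      show "PSL2R_action (SL2R_class ?A) x = boost s x" for x
      proof (rule obtain_line[of x])
        fix v assume v: "v \<noteq> 0" "x = line v"
        define w where "w = plane_complex v"
        have w0: "w \<noteq> 0" using v by (simp add: w_def)
        \<comment> \<open>The factor with \<open>c * l = 1 + s\<close> and
          \<open>c / l = 1 - s\<close>, so that the scaled image of \<open>w\<close> is
          \<open>w + s * cnj w\<close>.\<close>
        define c where "c = l * (1 - s)"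
        have c: "c \<noteq> 0" using l s by (simp add: c_def)
        have "of_real c * plane_complex (?A *v v) = w + of_real s * cnj w"
        proof -
          have "l * l * (1 - s) * v $ 1 = (1 + s) * v $ 1" using l(2) by (simp only: power2_eq_square)
          then show ?thesis
            using l(1) by (simp add: plane_complex_def matrix_vector_2 vector_2 complex_eq_iff w_def c_def
                algebra_simps)
        qed
        then have "plane_complex (?A *v v) = (w + of_real s * cnj w) / of_real c"
          using c by (simp add: field_simps)
        then have "line_direction (PSL2R_action (SL2R_class ?A) x) =
            (w + of_real s * cnj w) / cnj (w + of_real s * cnj w)"
          using v c by (simp add: act[OF A])
        also have "\<dots> = (w / cnj w + of_real s) / (1 + of_real s * (w / cnj w))"
        proof -
          have "w / cnj w + of_real s = (w + of_real s * cnj w) / cnj w"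
            "1 + of_real s * (w / cnj w) = cnj (w + of_real s * cnj w) / cnj w"
            using w0 by (simp_all add: add_divide_distrib)
          then show ?thesis using w0 by (simp only: divide_divide_eq_right divide_divide_eq_left) simp
        qed
        also have "w / cnj w = line_direction x" by (simp add: v line_direction_line w_def)
        finally have "e' (line_direction (PSL2R_action (SL2R_class ?A) x)) = boost s x" by (simp only: boost_def)
        then show ?thesis by (simp only: e'_e)
      qed
    qed
  qed
qed

section \<open>The Moebius group of the disk\<close>

lemma homeomorphism_circle: "homeomorphism UNIV (sphere 0 1) Rep_circle Abs_circle"
proof (rule homeomorphismI)
  show "continuous_on UNIV Rep_circle"
    unfolding continuous_on_open_vimage[OF open_UNIV] by (auto simp: open_circle_def)
  show "continuous_on (sphere 0 1) Abs_circle"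
  proof (clarsimp simp: continuous_on_open_invariant)
    fix U :: "circle set" assume "open U"
    then obtain V where V: "open V" "U = Rep_circle -` V" by (auto simp: open_circle_def)
    then have "V \<inter> sphere 0 1 = Abs_circle -` U \<inter> sphere 0 1" by (auto simp: Abs_circle_inverse)
    then show "\<exists>A. open A \<and> A \<inter> sphere 0 1 = Abs_circle -` U \<inter> sphere 0 1" using V(1) by blast
  qed
qed (use Rep_circle in \<open>auto simp: Rep_circle_inverse Abs_circle_inverse\<close>)

lemma moebius_denominator:
  assumes "a * cnj a - c * cnj c = 1" "norm z = 1"
  shows "c * z + cnj a \<noteq> 0"
proof
  assume "c * z + cnj a = 0"
  then have "norm (c * z) = norm (cnj a)" by (metis add_eq_0_iff norm_minus_cancel)
  then have "norm c = norm a" using assms(2) by (simp add: norm_mult)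
  then have "a * cnj a = c * cnj c" by (simp add: complex_norm_square[symmetric])
  then show False using assms(1) by simp
qed

lemma norm_moebius:
  assumes "a * cnj a - c * cnj c = 1" "norm z = 1"
  shows "norm ((a * z + cnj c) / (c * z + cnj a)) = 1"
proof -
  have "z * cnj z = 1" using assms(2) by (simp add: complex_norm_square[symmetric])
  then have "a * z + cnj c = z * cnj (c * z + cnj a)" by (simp add: algebra_simps)
  then have "norm (a * z + cnj c) = norm (c * z + cnj a)"
    by (metis assms(2) complex_mod_cnj mult_1 norm_mult)
  then show ?thesis using moebius_denominator[OF assms] by (simp add: norm_divide)
qed

lemma linear_stone_weierstrass_circle_action: "linear_stone_weierstrass disk_moebius_group circle_action"
proof -
  interpret circle_homeomorphism Rep_circle Abs_circle by unfold_locales (rule homeomorphism_circle)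
  define m where "m a c z = (a * z + cnj c) / (c * z + cnj a)" for a c z :: complex
  have grp: "disk_moebius_group = {m a c | a c. a * cnj a - c * cnj c = 1}"
    by (auto simp: disk_moebius_group_def m_def[abs_def])
  show ?thesis
  proof (rule linear_stone_weierstrass_circle)
    show "continuous_on UNIV (circle_action g)" if g: "g \<in> disk_moebius_group" for g
    proof -
      obtain a c where ac: "g = m a c" "a * cnj a - c * cnj c = 1" using g unfolding grp by auto
      show ?thesis
        unfolding circle_action_def ac m_def
        by (intro continuous_intros) (use norm_moebius moebius_denominator ac(2) in auto)
    qed
    show "\<exists>k\<in>disk_moebius_group. circle_action k = circle_action g \<circ> circle_action h"
      if gh: "g \<in> disk_moebius_group" "h \<in> disk_moebius_group" for g h
    proof -
      obtain a c where ac: "g = m a c" "a * cnj a - c * cnj c = 1" using gh unfolding grp by auto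
      obtain a' c' where ac': "h = m a' c'" "a' * cnj a' - c' * cnj c' = 1" using gh unfolding grp by auto
      \<comment> \<open>The first column of the product of the matrices with rows
        \<open>(a, cnj c)\<close>, \<open>(c, cnj a)\<close> and \<open>(a', cnj c')\<close>,
        \<open>(c', cnj a')\<close>; the identity below is multiplicativity of the
        determinant.\<close>
      let ?a = "a * a' + cnj c * c'" and ?c = "c * a' + cnj a * c'"
      have "?a * cnj ?a - ?c * cnj ?c = (a * cnj a - c * cnj c) * (a' * cnj a' - c' * cnj c')"
        by (simp add: algebra_simps)
      then have "?a * cnj ?a - ?c * cnj ?c = 1" by (simp only: ac(2) ac'(2) mult_1)
      then have k: "m ?a ?c \<in> disk_moebius_group" unfolding grp by blast
      have "circle_action (m ?a ?c) x = circle_action g (circle_action h x)" for x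
      proof -
        let ?z = "Rep_circle x"
        have d: "c' * ?z + cnj a' \<noteq> 0" by (rule moebius_denominator[OF ac'(2)]) simp
        have "Rep_circle (circle_action h x) = m a' c' ?z"
          using norm_moebius[OF ac'(2), of ?z] by (simp add: circle_action_def ac' m_def)
        moreover have "m a c (m a' c' ?z) = m ?a ?c ?z"
        proof -
          have "m a c (m a' c' ?z) =
              (a * (a' * ?z + cnj c') + cnj c * (c' * ?z + cnj a')) / (c * (a' * ?z + cnj c') + cnj a * (c' * ?z + cnj a'))"
            using d unfolding m_def by (simp add: divide_simps)
          also have "\<dots> = m ?a ?c ?z" unfolding m_def by (simp add: algebra_simps)
          finally show ?thesis .
        qed
        moreover have "circle_action g (circle_action h x) = Abs_circle (m a c (Rep_circle (circle_action h x)))"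
          unfolding ac(1) by (rule circle_action_def)
        ultimately show ?thesis by (simp only: circle_action_def[of "m ?a ?c" x])
      qed
      then show ?thesis using k by (intro bexI[of _ "m ?a ?c"]) auto
    qed
    show "\<exists>g\<in>disk_moebius_group. \<forall>x. circle_action g x = Abs_circle (cis \<alpha> * Rep_circle x)" for \<alpha>
    proof (intro bexI allI)
      \<comment> \<open>With \<open>c = 0\<close> the map is multiplication by
        \<open>a / cnj a\<close>, whose argument is twice that of \<open>a\<close>.\<close>
      show "m (cis (\<alpha>/2)) 0 \<in> disk_moebius_group"
        unfolding grp by (intro CollectI exI[of _ "cis (\<alpha>/2)"] exI[of _ 0]) (simp add: cis_cnj cis_mult)
      show "circle_action (m (cis (\<alpha>/2)) 0) x = Abs_circle (cis \<alpha> * Rep_circle x)" for x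
      proof -
        have "cis (\<alpha>/2) / cnj (cis (\<alpha>/2)) = cis \<alpha>" by (simp add: cis_cnj cis_divide)
        moreover have "m (cis (\<alpha>/2)) 0 z = (cis (\<alpha>/2) / cnj (cis (\<alpha>/2))) * z" for z by (simp add: m_def)
        ultimately show ?thesis by (simp only: circle_action_def)
      qed
    qed
    show "\<exists>g\<in>disk_moebius_group. circle_action g = boost s" if s: "0 < s" "s \<le> 1/2" for s
    proof (intro bexI ext)
      \<comment> \<open>Makes the coefficients \<open>r\<close> and \<open>r * s\<close> satisfy the
        determinant condition; the common factor \<open>r\<close> cancels in the map.\<close>
      define r where "r = 1 / sqrt (1 - s ^ 2)"
      have s1: "s ^ 2 < 1" using s by (simp add: abs_square_less_1)
      then have r: "r \<noteq> 0" "r * r * (1 - s ^ 2) = 1" by (auto simp: r_def)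
      have "complex_of_real r * of_real r - of_real (r * s) * of_real (r * s) = of_real (r * r * (1 - s ^ 2))"
        by (simp add: algebra_simps power2_eq_square)
      then show "m (of_real r) (of_real (r * s)) \<in> disk_moebius_group"
        unfolding grp r(2) by (intro CollectI exI[of _ "of_real r"] exI[of _ "of_real (r * s)"]) simp
      show "circle_action (m (of_real r) (of_real (r * s))) x = boost s x" for x
      proof -
        have "m (of_real r) (of_real (r * s)) (Rep_circle x) =
            (of_real r * (Rep_circle x + of_real s)) / (of_real r * (1 + of_real s * Rep_circle x))"
          unfolding m_def by (simp add: algebra_simps)
        then show ?thesis using r(1) by (simp add: circle_action_def boost_def)
      qed
    qed
  qed
qed

section \<open>Probability measures as functionals\<close>

lemma integrable_bcontfun:
  fixes f :: "'x::topological_space \<Rightarrow>\<^sub>C real"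
  assumes "\<mu> \<in> borel_prob_measures"
  shows "integrable \<mu> (apply_bcontfun f)"
proof -
  interpret prob_space \<mu> using assms by (simp add: borel_prob_measures_def)
  have "apply_bcontfun f \<in> borel_measurable \<mu>"
    using assms borel_measurable_continuous_onI[OF continuous_on_apply_bcontfun[of UNIV f]]
    by (simp add: borel_prob_measures_def cong: measurable_cong_sets)
  then show ?thesis using norm_bounded[of f] by (intro integrable_const_bound[of _ "norm f"]) auto
qed

lemma integral_functional_apply:
  fixes f :: "'x::topological_space \<Rightarrow>\<^sub>C real"
  assumes \<mu>: "\<mu> \<in> borel_prob_measures"
  shows "blinfun_apply (integral_functional \<mu>) f = (\<integral>x. apply_bcontfun f x \<partial>\<mu>)"
proof -
  interpret prob_space \<mu> using assms by (simp add: borel_prob_measures_def)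
  have "bounded_linear (\<lambda>f :: 'x \<Rightarrow>\<^sub>C real. \<integral>x. apply_bcontfun f x \<partial>\<mu>)"
  proof (rule bounded_linear_intro[of _ 1])
    fix f g :: "'x \<Rightarrow>\<^sub>C real" and c :: real
    show "(\<integral>x. apply_bcontfun (f + g) x \<partial>\<mu>) = (\<integral>x. f x \<partial>\<mu>) + (\<integral>x. g x \<partial>\<mu>)"
      by (simp add: Bochner_Integration.integral_add integrable_bcontfun[OF \<mu>])
    show "(\<integral>x. apply_bcontfun (c *\<^sub>R f) x \<partial>\<mu>) = c *\<^sub>R (\<integral>x. f x \<partial>\<mu>)" by simp
    have "norm (\<integral>x. f x \<partial>\<mu>) \<le> (\<integral>x. norm (f x) \<partial>\<mu>)" by (rule integral_norm_bound)
    also have "\<dots> \<le> (\<integral>x. norm f \<partial>\<mu>)"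
      by (intro integral_mono integrable_norm integrable_bcontfun[OF \<mu>]) (auto simp: norm_bounded simp del: real_norm_def)
    finally show "norm (\<integral>x. f x \<partial>\<mu>) \<le> norm f * 1" by (simp add: prob_space)
  qed
  then show ?thesis by (simp add: integral_functional_def bounded_linear_Blinfun_apply)
qed

lemma prob_functionals_cases:
  assumes "\<Lambda> \<in> prob_functionals"
  obtains \<mu> where "\<mu> \<in> borel_prob_measures" "\<Lambda> = integral_functional \<mu>"
  using assms by (auto simp: prob_functionals_def)

lemma prob_functional_bound:
  assumes "\<Lambda> \<in> prob_functionals"
  shows "\<bar>blinfun_apply \<Lambda> f\<bar> \<le> norm f"
proof -
  obtain \<mu> where \<mu>: "\<mu> \<in> borel_prob_measures" "\<Lambda> = integral_functional \<mu>" using assms by (rule prob_functionals_cases)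
  interpret prob_space \<mu> using \<mu> by (simp add: borel_prob_measures_def)
  have "norm (\<integral>x. f x \<partial>\<mu>) \<le> (\<integral>x. norm (f x) \<partial>\<mu>)" by (rule integral_norm_bound)
  also have "\<dots> \<le> (\<integral>x. norm f \<partial>\<mu>)"
    by (intro integral_mono integrable_norm integrable_bcontfun[OF \<mu>(1)]) (auto simp: norm_bounded simp del: real_norm_def)
  finally show ?thesis using \<mu> by (simp add: integral_functional_apply prob_space)
qed

lemma prob_functional_one:
  assumes "\<Lambda> \<in> prob_functionals"
  shows "blinfun_apply \<Lambda> (const_bcontfun 1) = 1"
proof -
  obtain \<mu> where \<mu>: "\<mu> \<in> borel_prob_measures" "\<Lambda> = integral_functional \<mu>" using assms by (rule prob_functionals_cases)
  interpret prob_space \<mu> using \<mu> by (simp add: borel_prob_measures_def)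
  show ?thesis using \<mu> by (simp add: integral_functional_apply prob_space)
qed

lemma distr_in_borel_prob_measures:
  assumes \<mu>: "prob_space \<mu>" and T: "T \<in> measurable \<mu> borel"
  shows "distr \<mu> borel T \<in> borel_prob_measures"
  using prob_space.prob_space_distr[OF \<mu> T] by (simp add: borel_prob_measures_def)

lemma integral_functional_distr:
  fixes f :: "'x::topological_space \<Rightarrow>\<^sub>C real"
  assumes \<mu>: "prob_space \<mu>" and T: "T \<in> measurable \<mu> borel"
  shows "blinfun_apply (integral_functional (distr \<mu> borel T)) f = (\<integral>x. f (T x) \<partial>\<mu>)"
  unfolding integral_functional_apply[OF distr_in_borel_prob_measures[OF assms]]
  by (rule integral_distr[OF T]) (auto intro: borel_measurable_continuous_onI)

definition compose_bcontfun :: "('x::topological_space \<Rightarrow>\<^sub>C real) \<Rightarrow> ('x \<Rightarrow> 'x) \<Rightarrow> 'x \<Rightarrow>\<^sub>C real" where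
  "compose_bcontfun f T = Bcontfun (\<lambda>x. f (T x))"

lemma compose_bcontfun:
  fixes f :: "'x::topological_space \<Rightarrow>\<^sub>C real"
  assumes "continuous_on UNIV T"
  shows "apply_bcontfun (compose_bcontfun f T) x = f (T x)"
  unfolding compose_bcontfun_def
  by (subst Bcontfun_inverse)
    (use assms in \<open>auto intro!: bcontfun_normI[of _ "norm f"] continuous_intros norm_bounded simp del: real_norm_def\<close>)

text \<open>The action is dual to composition with \<open>\<phi> g\<close>. This formula frees later
  arguments from the representing measure picked by \<open>inv_into\<close>.\<close>

lemma push_forward_action:
  fixes \<phi> :: "'g \<Rightarrow> 'x::topological_space \<Rightarrow> 'x"
  assumes cont: "continuous_on UNIV (\<phi> g)" and \<Lambda>: "\<Lambda> \<in> prob_functionals"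
  shows "push_forward_action \<phi> g \<Lambda> \<in> prob_functionals"
    "blinfun_apply (push_forward_action \<phi> g \<Lambda>) f = blinfun_apply \<Lambda> (compose_bcontfun f (\<phi> g))"
proof -
  define \<mu> where "\<mu> = inv_into borel_prob_measures integral_functional \<Lambda>"
  have \<mu>: "\<mu> \<in> borel_prob_measures" "integral_functional \<mu> = \<Lambda>"
    using \<Lambda> unfolding prob_functionals_def \<mu>_def by (auto intro: inv_into_into f_inv_into_f)
  have ps: "prob_space \<mu>" and m: "\<phi> g \<in> measurable \<mu> borel"
    using \<mu>(1) borel_measurable_continuous_onI[OF cont]
    by (auto simp: borel_prob_measures_def cong: measurable_cong_sets)
  have p: "push_forward_action \<phi> g \<Lambda> = integral_functional (distr \<mu> borel (\<phi> g))"
    using \<Lambda> by (simp add: push_forward_action_def \<mu>_def)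
  then show "push_forward_action \<phi> g \<Lambda> \<in> prob_functionals"
    using distr_in_borel_prob_measures[OF ps m] by (auto simp: prob_functionals_def)
  have "blinfun_apply (push_forward_action \<phi> g \<Lambda>) f = (\<integral>x. f (\<phi> g x) \<partial>\<mu>)"
    unfolding p by (rule integral_functional_distr[OF ps m])
  also have "\<dots> = blinfun_apply \<Lambda> (compose_bcontfun f (\<phi> g))"
    using integral_functional_apply[OF \<mu>(1), of "compose_bcontfun f (\<phi> g)"] by (simp add: \<mu>(2) compose_bcontfun[OF cont])
  finally show "blinfun_apply (push_forward_action \<phi> g \<Lambda>) f = blinfun_apply \<Lambda> (compose_bcontfun f (\<phi> g))" .
qed

text \<open>The convex combination is represented by a two-stage experiment: a Bernoulli variable of
  parameter \<open>t\<close> selects \<open>\<nu>\<close> or \<open>\<mu>\<close>, from which the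
  point is then drawn.\<close>

lemma convex_prob_functionals: "convex (prob_functionals :: (('x::topological_space \<Rightarrow>\<^sub>C real) \<Rightarrow>\<^sub>L real) set)"
  unfolding convex_alt
proof (intro ballI allI impI)
  fix \<Lambda> M :: "('x \<Rightarrow>\<^sub>C real) \<Rightarrow>\<^sub>L real" and t :: real
  assume "\<Lambda> \<in> prob_functionals" "M \<in> prob_functionals" and t: "0 \<le> t \<and> t \<le> 1"
  then obtain \<mu> \<nu> where \<mu>: "\<mu> \<in> borel_prob_measures" "\<Lambda> = integral_functional \<mu>"
    and \<nu>: "\<nu> \<in> borel_prob_measures" "M = integral_functional \<nu>"
    by (metis prob_functionals_cases)
  define N where "N b = (if b then \<nu> else \<mu>)" for b
  define \<rho> where "\<rho> = measure_pmf (bernoulli_pmf t) \<bind> N"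
  have N: "prob_space (N b)" "sets (N b) = sets borel" for b
    using \<mu>(1) \<nu>(1) by (auto simp: N_def borel_prob_measures_def)
  have Nm: "N \<in> measurable (measure_pmf (bernoulli_pmf t)) (subprob_algebra borel)"
    using N by (auto simp: measurable_def space_subprob_algebra prob_space_imp_subprob_space)
  have \<rho>: "\<rho> \<in> borel_prob_measures"
    unfolding borel_prob_measures_def \<rho>_def
    using measure_pmf.prob_space_bind[OF _ Nm] N sets_bind[OF N(2), of "measure_pmf (bernoulli_pmf t)"] by auto
  have "integral_functional \<rho> = (1 - t) *\<^sub>R \<Lambda> + t *\<^sub>R M"
  proof (rule blinfun_eqI)
    fix f :: "'x \<Rightarrow>\<^sub>C real"
    have "(\<integral>x. f x \<partial>\<rho>) = (\<integral>b. \<integral>x. f x \<partial>N b \<partial>bernoulli_pmf t)"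
      unfolding \<rho>_def
    proof (rule integral_bind[where B = "norm f" and B' = 1, OF _ _ Nm])
      show "apply_bcontfun f \<in> borel_measurable borel" by (auto intro: borel_measurable_continuous_onI)
      show "\<bar>f x\<bar> \<le> norm f" for x using norm_bounded[of f x] by simp
    qed (use N in \<open>auto simp: measure_pmf.finite_measure_axioms prob_space.emeasure_space_1\<close>)
    also have "\<dots> = t * (\<integral>x. f x \<partial>\<nu>) + (1 - t) * (\<integral>x. f x \<partial>\<mu>)"
      using t by (simp add: N_def)
    finally show "integral_functional \<rho> f = ((1 - t) *\<^sub>R \<Lambda> + t *\<^sub>R M) f"
      using \<mu> \<nu> \<rho> by (simp add: integral_functional_apply blinfun.add_left blinfun.scaleR_left)
  qed
  then show "(1 - t) *\<^sub>R \<Lambda> + t *\<^sub>R M \<in> prob_functionals"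
    using \<rho> by (metis image_eqI prob_functionals_def)
qed

text \<open>The topology is pulled back from a product of real lines, so a neighbourhood of 0
  contains one that restricts finitely many evaluations to balls around 0; such sets are
  convex.\<close>

lemma locally_convex_weak_star:
  "locally_convex_tvs (weak_star_topology :: (('x::topological_space \<Rightarrow>\<^sub>C real) \<Rightarrow>\<^sub>L real) topology)"
  (is "locally_convex_tvs ?T")
  unfolding locally_convex_tvs_def
proof (intro conjI allI impI)
  show "topspace ?T = UNIV" by (rule strong_operator_topology_topspace)
  have ev: "continuous_map ?T euclideanreal (\<lambda>\<Lambda>. blinfun_apply \<Lambda> f)" for f
    by (rule strong_operator_topology_continuous_evaluation)
  have ev1: "continuous_map (prod_topology ?T ?T) euclideanreal (\<lambda>z. blinfun_apply (fst z) f)"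
    and ev2: "continuous_map (prod_topology S ?T) euclideanreal (\<lambda>z. blinfun_apply (snd z) f)" for f and S :: "'s topology"
    using continuous_map_compose[OF continuous_map_fst ev] continuous_map_compose[OF continuous_map_snd ev]
    by (simp_all add: o_def)
  show "continuous_map (prod_topology ?T ?T) ?T (\<lambda>(x, y). x + y)"
    unfolding continuous_on_strong_operator_topo_iff_coordinatewise case_prod_unfold blinfun.add_left
    by (intro allI continuous_map_add ev1 ev2)
  have sc: "continuous_map (prod_topology euclideanreal ?T) euclideanreal (\<lambda>z. fst z * blinfun_apply (snd z) f)" for f
    by (intro continuous_map_real_mult continuous_map_fst ev2)
  show "continuous_map (prod_topology euclideanreal ?T) ?T (\<lambda>(r, x). r *\<^sub>R x)"
    unfolding continuous_on_strong_operator_topo_iff_coordinatewise case_prod_unfold blinfun.scaleR_left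
    using sc by simp
  fix U assume U: "openin ?T U \<and> 0 \<in> U"
  obtain W :: "(('x \<Rightarrow>\<^sub>C real) \<Rightarrow> real) set" where W: "open W" "U = blinfun_apply -` W"
    using U unfolding strong_operator_topology_def openin_pullback_topology by auto
  have "openin (product_topology (\<lambda>i. euclidean) UNIV) W" "(\<lambda>f. 0) \<in> W"
    using W U by (auto simp: euclidean_product_topology zero_blinfun.rep_eq)
  from product_topology_open_contains_basis[OF this] obtain X where X:
    "(\<lambda>f. 0) \<in> (\<Pi>\<^sub>E i\<in>UNIV. X i)" "\<forall>i. open (X i)" "finite {i. X i \<noteq> UNIV}" "(\<Pi>\<^sub>E i\<in>UNIV. X i) \<subseteq> W"
    by auto
  have "\<forall>i. \<exists>r>0. ball 0 r \<subseteq> X i"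
    using X(1,2) by (auto simp: PiE_iff intro: openE)
  then obtain r where r: "\<And>i. 0 < r i" "\<And>i. ball 0 (r i) \<subseteq> X i" by metis
  define V where "V = {\<Lambda> :: ('x \<Rightarrow>\<^sub>C real) \<Rightarrow>\<^sub>L real. \<forall>i\<in>{i. X i \<noteq> UNIV}. \<Lambda> i \<in> ball 0 (r i)}"
  show "\<exists>V. openin ?T V \<and> convex V \<and> 0 \<in> V \<and> V \<subseteq> U"
  proof (intro exI conjI)
    show "openin ?T V" unfolding V_def by (rule strong_operator_topology_basis[OF X(3)]) auto
    show "convex V"
    proof (rule convexI)
      fix \<Lambda> M :: "('x \<Rightarrow>\<^sub>C real) \<Rightarrow>\<^sub>L real" and u v :: real
      assume *: "\<Lambda> \<in> V" "M \<in> V" "0 \<le> u" "0 \<le> v" "u + v = 1"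
      then show "u *\<^sub>R \<Lambda> + v *\<^sub>R M \<in> V"
        using convexD[OF convex_ball, of _ 0 _ _ u v] by (simp only: V_def mem_Collect_eq blinfun.add_left blinfun.scaleR_left) blast
    qed
    show "0 \<in> V" using r by (simp add: V_def)
    show "V \<subseteq> U"
    proof
      fix \<Lambda> assume "\<Lambda> \<in> V"
      then have "blinfun_apply \<Lambda> i \<in> X i" for i
      proof (cases "X i = UNIV")
        case False
        then have "blinfun_apply \<Lambda> i \<in> ball 0 (r i)" using \<open>\<Lambda> \<in> V\<close> by (simp add: V_def)
        then show ?thesis using r(2) by blast
      qed simp
      then have "blinfun_apply \<Lambda> \<in> (\<Pi>\<^sub>E i\<in>UNIV. X i)" by (simp add: PiE_iff)
      then show "\<Lambda> \<in> U" using X(4) W by auto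
    qed
  qed
qed

abbreviation prob_topology :: "(('x::topological_space \<Rightarrow>\<^sub>C real) \<Rightarrow>\<^sub>L real) topology" where
  "prob_topology \<equiv> subtopology weak_star_topology prob_functionals"

lemma topspace_prob_topology: "topspace prob_topology = prob_functionals"
  by (simp add: strong_operator_topology_topspace)

lemma continuous_map_prob_eval:
  "continuous_map prob_topology euclideanreal (\<lambda>\<Lambda>. blinfun_apply \<Lambda> f)"
  by (intro continuous_map_from_subtopology strong_operator_topology_continuous_evaluation)

definition dirac :: "'x::topological_space \<Rightarrow> ('x \<Rightarrow>\<^sub>C real) \<Rightarrow>\<^sub>L real" where
  "dirac x = integral_functional (return borel x)"

lemma dirac_in_prob_functionals: "dirac x \<in> prob_functionals"
  by (auto simp: dirac_def prob_functionals_def borel_prob_measures_def prob_space_return)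

lemma dirac_apply: "blinfun_apply (dirac x) f = f x"
proof -
  have "return borel x \<in> borel_prob_measures" by (simp add: borel_prob_measures_def prob_space_return)
  then show ?thesis
    by (simp add: dirac_def integral_functional_apply integral_return borel_measurable_continuous_onI)
qed

text \<open>Split \<open>M (F h) - \<Lambda> (F g)\<close> into \<open>M (F h - F g)\<close> and
  \<open>(M - \<Lambda>) (F g)\<close>. The first is at most the norm of \<open>F h - F g\<close>,
  which is small because compactness makes \<open>F\<close> norm continuous; the second is small for
  \<open>M\<close> weak* close to \<open>\<Lambda>\<close>.\<close>

lemma continuous_map_push_forward:
  fixes \<phi> :: "'g \<Rightarrow> 'x::topological_space \<Rightarrow> 'x"
  assumes cpt: "compact (UNIV :: 'x set)"
    and cont: "continuous_map (prod_topology TG euclidean) euclidean (\<lambda>(g, x). \<phi> g x)"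
  shows "continuous_map (prod_topology TG prob_topology) prob_topology (\<lambda>(g, \<Lambda>). push_forward_action \<phi> g \<Lambda>)"
proof -
  have c: "continuous_on UNIV (\<phi> g)" if "g \<in> topspace TG" for g
    using continuous_map_prod_slice[OF cont that] by simp
  have "continuous_map (prod_topology TG prob_topology) euclideanreal (\<lambda>z. blinfun_apply (push_forward_action \<phi> (fst z) (snd z)) f)"
    for f :: "'x \<Rightarrow>\<^sub>C real"
  proof -
    define F where "F g = compose_bcontfun f (\<phi> g)" for g
    have "continuous_map (prod_topology TG euclidean) euclideanreal (apply_bcontfun f \<circ> (\<lambda>(g, x). \<phi> g x))"
      by (rule continuous_map_compose[OF cont]) simp
    then have "continuous_map (prod_topology TG euclidean) euclideanreal (\<lambda>(g, x). f (\<phi> g x))"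
      by (simp add: o_def case_prod_unfold)
    from continuous_map_into_bcontfun[OF cpt this] have F: "continuous_map TG euclidean F"
      by (simp add: F_def[abs_def] compose_bcontfun_def)
    have "continuous_map (prod_topology TG prob_topology) euclideanreal (\<lambda>z. blinfun_apply (snd z) (F (fst z)))"
    proof (clarsimp simp: continuous_map topspace_prob_topology strong_operator_topology_topspace)
      fix W :: "real set" assume "open W"
      let ?S = "{z \<in> topspace TG \<times> prob_functionals. blinfun_apply (snd z) (F (fst z)) \<in> W}"
      show "openin (prod_topology TG prob_topology) ?S"
      proof (subst openin_prod_topology_alt, intro allI impI)
        fix g \<Lambda> assume "(g, \<Lambda>) \<in> ?S"
        then have g: "g \<in> topspace TG" and \<Lambda>: "\<Lambda> \<in> prob_functionals" and "\<Lambda> (F g) \<in> W" by auto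
        then obtain \<epsilon> where \<epsilon>: "\<epsilon> > 0" "ball (\<Lambda> (F g)) \<epsilon> \<subseteq> W" using \<open>open W\<close> by (meson open_contains_ball)
        define A where "A = {h \<in> topspace TG. F h \<in> ball (F g) (\<epsilon>/2)}"
        define B where "B = {M \<in> topspace prob_topology. blinfun_apply M (F g) \<in> ball (\<Lambda> (F g)) (\<epsilon>/2)}"
        have "openin TG A" unfolding A_def by (rule openin_continuous_map_preimage[OF F]) simp
        moreover have "openin prob_topology B"
          unfolding B_def by (rule openin_continuous_map_preimage[OF continuous_map_prob_eval]) simp
        moreover have "A \<times> B \<subseteq> ?S"
        proof
          fix z assume "z \<in> A \<times> B"
          then obtain h M where z: "z = (h, M)" and h: "h \<in> A" and M: "M \<in> B" by blast
          have hM: "h \<in> topspace TG" "M \<in> prob_functionals"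
            using h M by (auto simp: A_def B_def topspace_prob_topology)
          have "\<bar>M (F h - F g)\<bar> \<le> norm (F h - F g)" by (rule prob_functional_bound[OF hM(2)])
          then have "\<bar>M (F h) - M (F g)\<bar> < \<epsilon>/2"
            using h by (simp add: A_def blinfun.diff_right dist_norm norm_minus_commute)
          moreover have "\<bar>\<Lambda> (F g) - M (F g)\<bar> < \<epsilon>/2" using M by (simp add: B_def dist_real_def)
          ultimately have "\<bar>\<Lambda> (F g) - M (F h)\<bar> < \<epsilon>" by linarith
          then have "M (F h) \<in> W" using \<epsilon>(2) by (auto simp: dist_real_def)
          then show "z \<in> ?S" using z hM by simp
        qed
        moreover have "g \<in> A" "\<Lambda> \<in> B" using g \<Lambda> \<epsilon>(1) by (auto simp: A_def B_def topspace_prob_topology strong_operator_topology_topspace)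
        ultimately show "\<exists>U V. openin TG U \<and> openin prob_topology V \<and> g \<in> U \<and> \<Lambda> \<in> V \<and> U \<times> V \<subseteq> ?S"
          by blast
      qed
    qed
    then show ?thesis
      by (rule continuous_map_eq) (use c in \<open>auto simp: F_def push_forward_action(2) topspace_prob_topology\<close>)
  qed
  moreover have "push_forward_action \<phi> g \<Lambda> \<in> prob_functionals" if "g \<in> topspace TG" "\<Lambda> \<in> prob_functionals" for g \<Lambda>
    using push_forward_action(1)[of \<phi> g, OF c[OF that(1)] that(2)] .
  ultimately show ?thesis
    by (auto simp: continuous_map_in_subtopology continuous_on_strong_operator_topo_iff_coordinatewise
        case_prod_unfold topspace_prob_topology)
qed

lemma group_action_push_forward:
  fixes \<phi> :: "'g \<Rightarrow> 'x::topological_space \<Rightarrow> 'x"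
  assumes act: "group_action G UNIV \<phi>" and c: "\<And>g. g \<in> carrier G \<Longrightarrow> continuous_on UNIV (\<phi> g)"
  shows "group_action G prob_functionals (push_forward_action \<phi>)"
proof (rule group_actionI)
  interpret group_action G UNIV \<phi> by fact
  show G: "group G" using group_hom by (simp add: group_hom_def)
  show "push_forward_action \<phi> g \<in> extensional prob_functionals" for g
    by (simp add: push_forward_action_def)
  show "push_forward_action \<phi> g \<Lambda> \<in> prob_functionals" if "g \<in> carrier G" "\<Lambda> \<in> prob_functionals" for g \<Lambda>
    using push_forward_action(1)[of \<phi> g \<Lambda>, OF c[OF that(1)] that(2)] .
  show "push_forward_action \<phi> \<one>\<^bsub>G\<^esub> \<Lambda> = \<Lambda>" if "\<Lambda> \<in> prob_functionals" for \<Lambda>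
  proof (rule blinfun_eqI)
    fix f :: "'x \<Rightarrow>\<^sub>C real"
    have one: "\<one>\<^bsub>G\<^esub> \<in> carrier G" using G by (simp add: group.is_monoid monoid.one_closed)
    have "\<phi> \<one>\<^bsub>G\<^esub> x = x" for x using fun_cong[OF id_eq_one, of x] by simp
    then have "compose_bcontfun f (\<phi> \<one>\<^bsub>G\<^esub>) = f"
      by (intro bcontfun_eqI) (simp add: compose_bcontfun[OF c[OF one]])
    then show "push_forward_action \<phi> \<one>\<^bsub>G\<^esub> \<Lambda> f = \<Lambda> f"
      by (simp add: push_forward_action(2)[of \<phi>, OF c[OF one] that])
  qed
  show "push_forward_action \<phi> (g \<otimes>\<^bsub>G\<^esub> h) \<Lambda> = push_forward_action \<phi> g (push_forward_action \<phi> h \<Lambda>)"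
    if gh: "g \<in> carrier G" "h \<in> carrier G" and \<Lambda>: "\<Lambda> \<in> prob_functionals" for g h \<Lambda>
  proof (rule blinfun_eqI)
    fix f :: "'x \<Rightarrow>\<^sub>C real"
    have gh': "g \<otimes>\<^bsub>G\<^esub> h \<in> carrier G" using G gh by (simp add: group.is_monoid monoid.m_closed)
    have "compose_bcontfun f (\<phi> (g \<otimes>\<^bsub>G\<^esub> h)) = compose_bcontfun (compose_bcontfun f (\<phi> g)) (\<phi> h)"
      by (rule bcontfun_eqI)
        (simp add: compose_bcontfun[OF c[OF gh']] compose_bcontfun[OF c[OF gh(1)]] compose_bcontfun[OF c[OF gh(2)]]
          composition_rule gh)
    then show "push_forward_action \<phi> (g \<otimes>\<^bsub>G\<^esub> h) \<Lambda> f = push_forward_action \<phi> g (push_forward_action \<phi> h \<Lambda>) f"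
      using c[OF gh(1)] c[OF gh(2)] c[OF gh'] \<Lambda> push_forward_action(1)[of \<phi> h, OF c[OF gh(2)] \<Lambda>]
      by (simp add: push_forward_action(2))
  qed
qed

section \<open>Trigonometric moments: metrizability and compactness of \<open>M(X)\<close>\<close>

context circle_homeomorphism
begin

text \<open>For a measure this is the conjugate of the integral of \<open>e x ^ n\<close>, its
  Fourier-Stieltjes coefficient. As a point of \<open>nat \<Rightarrow> complex\<close> it lives in
  a countable product of planes, which is metrizable.\<close>

definition moments :: "(('x \<Rightarrow>\<^sub>C real) \<Rightarrow>\<^sub>L real) \<Rightarrow> nat \<Rightarrow> complex" where
  "moments \<Lambda> n = Complex (\<Lambda> (wave 1 n)) (\<Lambda> (wave \<i> n))"

lemma prob_functional_wave:
  "blinfun_apply \<Lambda> (wave a n) = Re a * Re (moments \<Lambda> n) + Im a * Im (moments \<Lambda> n)"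
proof -
  have "wave a n = Re a *\<^sub>R wave 1 n + Im a *\<^sub>R wave \<i> n"
    by (rule bcontfun_eqI) simp
  then show ?thesis by (simp add: moments_def blinfun.add_right blinfun.scaleR_right)
qed

text \<open>Convergence on waves extends to trigonometric polynomials by linearity, and to every
  \<open>f\<close> by density, since all the functionals have the common bound
  \<open>norm\<close>.\<close>

lemma moments_tendsto:
  assumes \<Lambda>: "\<And>k. \<Lambda> k \<in> prob_functionals" "M \<in> prob_functionals"
    and lim: "\<And>n. (\<lambda>k. moments (\<Lambda> k) n) \<longlonglongrightarrow> moments M n"
  shows "(\<lambda>k. blinfun_apply (\<Lambda> k) f) \<longlonglongrightarrow> blinfun_apply M f"
proof -
  have "subspace {u. (\<lambda>k. blinfun_apply (\<Lambda> k) u) \<longlonglongrightarrow> blinfun_apply M u}"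
    by (rule subspaceI) (auto simp: blinfun.add_right blinfun.scaleR_right intro!: tendsto_intros)
  moreover have "(\<lambda>k. blinfun_apply (\<Lambda> k) (wave a n)) \<longlonglongrightarrow> blinfun_apply M (wave a n)" for a n
    unfolding prob_functional_wave by (intro tendsto_intros lim)
  ultimately have trig: "(\<lambda>k. blinfun_apply (\<Lambda> k) u) \<longlonglongrightarrow> blinfun_apply M u" if "u \<in> trig_polys" for u
    using span_minimal[of "{wave a n | a n. True}" "{u. (\<lambda>k. blinfun_apply (\<Lambda> k) u) \<longlonglongrightarrow> blinfun_apply M u}"] that
    unfolding trig_polys_def by blast
  show ?thesis
  proof (rule LIMSEQ_I)
    fix \<epsilon> :: real assume \<epsilon>: "0 < \<epsilon>"
    obtain u where u: "u \<in> trig_polys" "norm (f - u) \<le> \<epsilon>/4" using trig_polys_dense[of "\<epsilon>/4" f] \<epsilon> by auto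
    obtain K where K: "\<And>k. k \<ge> K \<Longrightarrow> norm (\<Lambda> k u - M u) < \<epsilon>/2"
      using LIMSEQ_D[OF trig[OF u(1)], of "\<epsilon>/2"] \<epsilon> by auto
    have b: "\<bar>N f - N u\<bar> \<le> \<epsilon>/4" if "N \<in> prob_functionals" for N
      using prob_functional_bound[OF that, of "f - u"] u(2) by (simp add: blinfun.diff_right)
    have "norm (\<Lambda> k f - M f) < \<epsilon>" if "k \<ge> K" for k
      using b[OF \<Lambda>(1)[of k]] b[OF \<Lambda>(2)] K[OF that] unfolding real_norm_def by linarith
    then show "\<exists>K. \<forall>k\<ge>K. norm (\<Lambda> k f - M f) < \<epsilon>" by blast
  qed
qed

lemma inj_on_moments: "inj_on moments prob_functionals"
proof (rule inj_onI)
  fix \<Lambda> M :: "('x \<Rightarrow>\<^sub>C real) \<Rightarrow>\<^sub>L real"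
  assume *: "\<Lambda> \<in> prob_functionals" "M \<in> prob_functionals" "moments \<Lambda> = moments M"
  \<comment> \<open>Injectivity is the case of a constant sequence, by uniqueness of limits.\<close>
  have "(\<lambda>k::nat. \<Lambda> f) \<longlonglongrightarrow> M f" for f
    by (rule moments_tendsto) (simp_all add: *)
  then show "\<Lambda> = M" by (intro blinfun_eqI) (simp add: LIMSEQ_const_iff)
qed

text \<open>Moments are weak* continuous, being made of evaluations. Continuity of the inverse may
  be tested on sequences, because the target is metrizable, and there it is
  \<open>moments_tendsto\<close>.\<close>

lemma homeomorphic_maps_moments:
  "homeomorphic_maps prob_topology (top_of_set (moments ` prob_functionals)) moments (inv_into prob_functionals moments)"
  unfolding homeomorphic_maps_def
proof (intro conjI)
  let ?inv = "inv_into prob_functionals moments"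
  have inv: "?inv (moments \<Lambda>) = \<Lambda>" if "\<Lambda> \<in> prob_functionals" for \<Lambda>
    by (rule inv_into_f_f[OF inj_on_moments that])
  have "continuous_map prob_topology euclidean (\<lambda>\<Lambda>. moments \<Lambda> n)" for n
  proof -
    have "continuous_map prob_topology euclidean (\<lambda>\<Lambda>. of_real (\<Lambda> (wave 1 n)) + \<i> * of_real (\<Lambda> (wave \<i> n)))"
    proof -
      have "continuous_map prob_topology euclidean (\<lambda>\<Lambda>. (\<Lambda> (wave 1 n), \<Lambda> (wave \<i> n)))"
        using continuous_map_pairedI[OF continuous_map_prob_eval continuous_map_prob_eval] by simp
      moreover have "continuous_map (euclidean :: (real \<times> real) topology) euclidean (\<lambda>z. of_real (fst z) + \<i> * of_real (snd z))"
        by (simp, intro continuous_intros)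
      from continuous_map_compose[OF calculation this] show ?thesis by (simp add: o_def)
    qed
    then show ?thesis by (simp add: moments_def Complex_eq)
  qed
  then have "continuous_map prob_topology (product_topology (\<lambda>i. euclidean) UNIV) moments"
    by (simp add: continuous_map_componentwise_UNIV)
  then show "continuous_map prob_topology (top_of_set (moments ` prob_functionals)) moments"
    by (auto simp: continuous_map_in_subtopology euclidean_product_topology topspace_prob_topology)
  have "continuous_on (moments ` prob_functionals) (\<lambda>m. blinfun_apply (?inv m) f)" for f
    unfolding continuous_on_sequentially
  proof (intro allI ballI impI)
    fix m a assume a: "a \<in> moments ` prob_functionals" and m: "(\<forall>k::nat. m k \<in> moments ` prob_functionals) \<and> m \<longlonglongrightarrow> a"
    have "(\<lambda>k. m k n) \<longlonglongrightarrow> a n" for n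
      using continuous_on_tendsto_compose[OF continuous_on_product_coordinates[of n] conjunct2[OF m]] by simp
    moreover have "moments (?inv b) = b" "?inv b \<in> prob_functionals" if "b \<in> moments ` prob_functionals" for b
      using that by (auto simp: inv)
    ultimately show "((\<lambda>m. blinfun_apply (?inv m) f) \<circ> m) \<longlonglongrightarrow> blinfun_apply (?inv a) f"
      unfolding o_def using a m by (intro moments_tendsto) auto
  qed
  then have "continuous_map (top_of_set (moments ` prob_functionals)) weak_star_topology ?inv"
    by (simp add: continuous_on_strong_operator_topo_iff_coordinatewise)
  then show "continuous_map (top_of_set (moments ` prob_functionals)) prob_topology ?inv"
    by (auto simp: continuous_map_in_subtopology inv)
qed (auto simp: topspace_prob_topology inv_into_f_f[OF inj_on_moments])

lemma metrizable_prob_topology: "metrizable_space (prob_topology :: (('x \<Rightarrow>\<^sub>C real) \<Rightarrow>\<^sub>L real) topology)"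
  using homeomorphic_metrizable_space[OF homeomorphic_maps_imp_homeomorphic_space[OF homeomorphic_maps_moments]]
    metrizable_space_subtopology[OF metrizable_space_euclidean] by blast

lemma prob_topology_tendsto:
  fixes H :: "(('x \<Rightarrow>\<^sub>C real) \<Rightarrow>\<^sub>L real) \<Rightarrow> real"
  assumes H: "continuous_map prob_topology euclideanreal H"
    and \<Lambda>: "\<And>k. \<Lambda> k \<in> prob_functionals" "M \<in> prob_functionals"
    and lim: "\<And>f. (\<lambda>k. blinfun_apply (\<Lambda> k) f) \<longlonglongrightarrow> blinfun_apply M f"
  shows "(\<lambda>k. H (\<Lambda> k)) \<longlonglongrightarrow> H M"
proof -
  let ?inv = "inv_into prob_functionals moments"
  have inv: "?inv (moments N) = N" if "N \<in> prob_functionals" for N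
    by (rule inv_into_f_f[OF inj_on_moments that])
  have "continuous_map (top_of_set (moments ` prob_functionals)) euclideanreal (H \<circ> ?inv)"
    using homeomorphic_maps_moments H by (intro continuous_map_compose) (auto simp: homeomorphic_maps_def)
  then have cont: "continuous_on (moments ` prob_functionals) (H \<circ> ?inv)" by simp
  have "(\<lambda>k. moments (\<Lambda> k) n) \<longlonglongrightarrow> moments M n" for n
    unfolding moments_def Complex_eq by (intro tendsto_intros lim)
  then have "limitin (product_topology (\<lambda>i. euclidean) UNIV) (\<lambda>k. moments (\<Lambda> k)) (moments M) sequentially"
    by (simp add: limitin_componentwise)
  then have "(\<lambda>k. moments (\<Lambda> k)) \<longlonglongrightarrow> moments M" by (simp add: euclidean_product_topology)
  from continuous_on_tendsto_compose[OF cont this] show ?thesis using \<Lambda> by (simp add: inv)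
qed

text \<open>A Borel section of \<open>t \<mapsto> e' (cis t)\<close>, discontinuous only where
  \<open>e x = -1\<close>. The form with \<open>arccos\<close> makes it piecewise continuous on two
  Borel sets.\<close>

definition arg :: "'x \<Rightarrow> real" where
  "arg x = (if 0 \<le> Im (e x) then arccos (Re (e x)) else - arccos (Re (e x)))"

lemma abs_Re_e: "\<bar>Re (e x)\<bar> \<le> 1"
  using abs_Re_le_cmod[of "e x"] by simp

lemma arg_bounds: "- pi \<le> arg x" "arg x \<le> pi"
  using arccos_lbound[of "Re (e x)"] arccos_ubound[of "Re (e x)"] abs_Re_e[of x] by (auto simp: arg_def abs_le_iff)

lemma e'_cis_arg: "e' (cis (arg x)) = x"
proof -
  have "(Re (e x))\<^sup>2 + (Im (e x))\<^sup>2 = 1" using norm_e[of x] by (simp add: cmod_def)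
  then have "sqrt (1 - (Re (e x))\<^sup>2) = \<bar>Im (e x)\<bar>" by (metis add_diff_cancel_left' real_sqrt_abs)
  then have "cis (arg x) = e x"
    using abs_Re_e[of x] by (auto simp: arg_def complex_eq_iff abs_le_iff sin_arccos)
  then show ?thesis by simp
qed

lemma measurable_arg: "arg \<in> borel_measurable borel"
proof -
  have 1: "(\<lambda>x. arccos (Re (e x))) \<in> borel_measurable borel" "(\<lambda>x. Im (e x)) \<in> borel_measurable borel"
    using abs_Re_e by (intro borel_measurable_continuous_onI continuous_intros; auto simp: abs_le_iff; smt)+
  then have "(\<lambda>x. if 0 \<le> Im (e x) then arccos (Re (e x)) else - arccos (Re (e x))) \<in> borel_measurable borel"
    by (intro measurable_If) auto
  then show ?thesis by (simp add: arg_def[abs_def])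
qed

lemma measurable_e'_cis: "(\<lambda>t. e' (cis t)) \<in> borel_measurable borel"
  by (intro borel_measurable_continuous_onI continuous_intros) auto

text \<open>Lifting measures to \<open>[-\<pi>, \<pi>]\<close> gives a tight family, to which Helly's theorem applies.\<close>

lemma compact_prob_topology: "compact_space (prob_topology :: (('x \<Rightarrow>\<^sub>C real) \<Rightarrow>\<^sub>L real) topology)"
proof -
  \<comment> \<open>The moment image lies in a metrizable product, so sequential compactness is
    enough.\<close>
  have "seq_compact (moments ` prob_functionals)"
    unfolding seq_compact_def
  proof (intro allI impI)
    fix m :: "nat \<Rightarrow> nat \<Rightarrow> complex" assume "\<forall>n. m n \<in> moments ` prob_functionals"
    then have "\<forall>n. \<exists>\<mu>\<in>borel_prob_measures. m n = moments (integral_functional \<mu>)"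
      by (force simp: prob_functionals_def)
    then obtain \<mu> where \<mu>: "\<And>n. \<mu> n \<in> borel_prob_measures" "\<And>n. m n = moments (integral_functional (\<mu> n))"
      by metis
    define \<nu> where "\<nu> n = distr (\<mu> n) borel arg" for n
    have ps: "prob_space (\<mu> n)" and ms: "arg \<in> borel_measurable (\<mu> n)" for n
      using \<mu>(1)[of n] measurable_arg by (auto simp: borel_prob_measures_def cong: measurable_cong_sets)
    have rd: "real_distribution (\<nu> n)" for n
      unfolding \<nu>_def by (rule prob_space.real_distribution_distr[OF ps ms])
    have "tight \<nu>"
      unfolding tight_def
    proof (intro conjI allI impI rd)
      fix \<epsilon> :: real assume "0 < \<epsilon>"
      \<comment> \<open>All values of \<open>arg\<close> lie in \<open>{-pi..pi}\<close>, and
        \<open>pi < 4\<close>.\<close>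
      have "measure (\<nu> n) {-4<..4} = 1" for n
      proof -
        have "arg x \<in> {-4<..4}" for x
          using arg_bounds[of x] pi_less_4 unfolding greaterThanAtMost_iff by linarith
        then have "arg -` {-4<..4} \<inter> space (\<mu> n) = space (\<mu> n)" by blast
        then show ?thesis
          unfolding \<nu>_def by (subst measure_distr[OF ms]) (simp_all add: prob_space.prob_space[OF ps])
      qed
      then show "\<exists>a b. a < b \<and> (\<forall>n. 1 - \<epsilon> < measure (\<nu> n) {a<..b})"
        using \<open>0 < \<epsilon>\<close> by (intro exI[of _ "-4"] exI[of _ 4]) auto
    qed
    from tight_imp_convergent_subsubsequence[OF this strict_mono_id] obtain r M where
      r: "strict_mono (r :: nat \<Rightarrow> nat)" and M: "real_distribution M" and w: "weak_conv_m (\<nu> \<circ> id \<circ> r) M" by auto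
    \<comment> \<open>The limit returns to the circle along \<open>t \<mapsto> e' (cis t)\<close>.
      Unlike \<open>arg\<close> this map is continuous, so weak convergence on the line passes to
      integrals of \<open>f\<close>.\<close>
    define \<Lambda> where "\<Lambda> = integral_functional (distr M borel (\<lambda>t. e' (cis t)))"
    have Mp: "prob_space M" and Mm: "(\<lambda>t. e' (cis t)) \<in> measurable M borel"
      using M measurable_e'_cis by (auto simp: real_distribution_def real_distribution_axioms_def cong: measurable_cong_sets)
    have \<Lambda>: "\<Lambda> \<in> prob_functionals"
      using distr_in_borel_prob_measures[OF Mp Mm] by (auto simp: \<Lambda>_def prob_functionals_def)
    have lim: "(\<lambda>k. blinfun_apply (integral_functional (\<mu> (r k))) f) \<longlonglongrightarrow> blinfun_apply \<Lambda> f" for f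
    proof -
      have cont: "continuous_on UNIV (\<lambda>t. f (e' (cis t)))" by (intro continuous_intros) auto
      have "(\<lambda>k. integral\<^sup>L ((\<nu> \<circ> id \<circ> r) k) (\<lambda>t. f (e' (cis t)))) \<longlonglongrightarrow> integral\<^sup>L M (\<lambda>t. f (e' (cis t)))"
        by (rule weak_conv_imp_integral_bdd_continuous_conv[OF _ M w, where B = "norm f"])
          (use rd cont norm_bounded[of f] in \<open>auto simp: continuous_on_eq_continuous_at\<close>)
      moreover have "integral\<^sup>L ((\<nu> \<circ> id \<circ> r) k) (\<lambda>t. f (e' (cis t))) = blinfun_apply (integral_functional (\<mu> (r k))) f" for k
        using integral_distr[OF ms borel_measurable_continuous_onI[OF cont], of "r k"]
        by (simp add: \<nu>_def e'_cis_arg integral_functional_apply[OF \<mu>(1)])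
      ultimately show ?thesis
        unfolding \<Lambda>_def integral_functional_distr[OF Mp Mm] by simp
    qed
    have "(\<lambda>k. m (r k)) \<longlonglongrightarrow> moments \<Lambda>"
    proof -
      have "(\<lambda>k. m (r k) n) \<longlonglongrightarrow> moments \<Lambda> n" for n
        unfolding \<mu>(2) moments_def Complex_eq by (intro tendsto_intros lim)
      then have "limitin (product_topology (\<lambda>i. euclidean) UNIV) (\<lambda>k. m (r k)) (moments \<Lambda>) sequentially"
        by (simp add: limitin_componentwise)
      then show ?thesis by (simp add: euclidean_product_topology)
    qed
    then show "\<exists>l\<in>moments ` prob_functionals. \<exists>r. strict_mono r \<and> (m \<circ> r) \<longlonglongrightarrow> l"
      using \<Lambda> r by (auto simp: o_def)
  qed
  then have "compact_space (top_of_set (moments ` prob_functionals))"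
    by (simp add: compact_space_subtopology compact_eq_seq_compact_metric)
  then show ?thesis
    using homeomorphic_compact_space[OF homeomorphic_maps_imp_homeomorphic_space[OF homeomorphic_maps_moments]] by blast
qed

section \<open>The affine system \<open>M(X)\<close>, its affine functionals and affine
  primeness\<close>

lemma affine_system_prob_functionals:
  assumes G: "topological_group G TG" and act: "group_action G UNIV \<phi>"
    and cont: "continuous_map (prod_topology TG euclidean) euclidean (\<lambda>(g, x :: 'x). \<phi> g x)"
  shows "affine_dynamical_system weak_star_topology (prob_functionals :: (('x \<Rightarrow>\<^sub>C real) \<Rightarrow>\<^sub>L real) set)
      G TG (push_forward_action \<phi>)"
  unfolding affine_dynamical_system_def dynamical_system_def
proof (intro conjI ballI locally_convex_weak_star convex_prob_functionals G compact_prob_topology metrizable_prob_topology)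
  have top: "topspace TG = carrier G" using G by (simp add: topological_group_def)
  have c: "continuous_on UNIV (\<phi> g)" if "g \<in> carrier G" for g
    using continuous_map_prod_slice[OF cont, of g] that top by simp
  show "topspace (prob_topology :: (('x \<Rightarrow>\<^sub>C real) \<Rightarrow>\<^sub>L real) topology) \<noteq> {}"
    using dirac_in_prob_functionals unfolding topspace_prob_topology by blast
  have ga: "group_action G prob_functionals (push_forward_action \<phi>)"
    using group_action_push_forward[OF act c] .
  then show "group_action G (topspace prob_topology) (push_forward_action \<phi>)"
    by (simp only: topspace_prob_topology)
  show "continuous_map TG (Homeo_topology prob_topology) (push_forward_action \<phi>)"
    by (rule continuous_map_Homeo_topology[OF _ top continuous_map_push_forward[OF compact_UNIV cont]])
      (simp only: topspace_prob_topology ga)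
  show "affine_map_on prob_functionals (push_forward_action \<phi> g)" if "g \<in> carrier G" for g
    unfolding affine_map_on_def
  proof (intro ballI)
    fix \<Lambda> M :: "('x \<Rightarrow>\<^sub>C real) \<Rightarrow>\<^sub>L real" and t :: real
    assume *: "\<Lambda> \<in> prob_functionals" "M \<in> prob_functionals" "t \<in> {0..1}"
    then have "(1 - t) *\<^sub>R \<Lambda> + t *\<^sub>R M \<in> prob_functionals"
      by (intro convexD_alt[OF convex_prob_functionals]) auto
    then show "push_forward_action \<phi> g ((1 - t) *\<^sub>R \<Lambda> + t *\<^sub>R M) =
        (1 - t) *\<^sub>R push_forward_action \<phi> g \<Lambda> + t *\<^sub>R push_forward_action \<phi> g M"
      using * by (intro blinfun_eqI) (simp add: push_forward_action(2)[of \<phi>, OF c[OF that]] blinfun.add_left blinfun.scaleR_left)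
  qed
qed

text \<open>Every measure is the limit of its images under step maps, which are finite convex combinations
  of Dirac measures.\<close>

lemma affine_functional_representation:
  assumes aff: "affine_map_on prob_functionals H"
    and H: "continuous_map prob_topology euclideanreal H"
  obtains f :: "'x \<Rightarrow>\<^sub>C real" where "\<And>\<Lambda>. \<Lambda> \<in> prob_functionals \<Longrightarrow> H \<Lambda> = blinfun_apply \<Lambda> f" "\<And>x. f x = H (dirac x)"
proof -
  have "continuous_map euclidean prob_topology dirac"
    by (auto simp: continuous_map_in_subtopology continuous_on_strong_operator_topo_iff_coordinatewise
        dirac_apply dirac_in_prob_functionals)
  from continuous_map_compose[OF this H] have cf: "continuous_on UNIV (\<lambda>x :: 'x. H (dirac x))"
    by (simp add: o_def)
  define f where "f = Bcontfun (\<lambda>x :: 'x. H (dirac x))"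
  have f: "f x = H (dirac x)" for x unfolding f_def by (subst apply_Bcontfun[OF cf]) simp
  have finite_affine: "H (\<Sum>j\<in>J. a j *\<^sub>R \<Lambda> j) = (\<Sum>j\<in>J. a j * H (\<Lambda> j))"
    if J: "finite J" "\<And>j. j \<in> J \<Longrightarrow> 0 \<le> a j" "(\<Sum>j\<in>J. a j) = 1" "\<And>j. j \<in> J \<Longrightarrow> \<Lambda> j \<in> prob_functionals"
    for J :: "int set" and a \<Lambda>
  proof -
    \<comment> \<open>What follows applies Jensen's inequality to \<open>H\<close> and to
      \<open>- H\<close>, both convex, to get the two inequalities.\<close>
    have ne: "J \<noteq> {}" using J(3) by auto
    have 1: "convex_on prob_functionals H" "convex_on prob_functionals (\<lambda>\<Lambda>. - H \<Lambda>)"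
      using aff convex_prob_functionals by (auto simp: affine_map_on_def convex_on_alt algebra_simps)
    show ?thesis
      using convex_on_sum[OF J(1) ne 1(1) J(3), of \<Lambda>] convex_on_sum[OF J(1) ne 1(2) J(3), of \<Lambda>] J(2,4)
      by (simp add: sum_negf)
  qed
  have "H \<Lambda> = blinfun_apply \<Lambda> f" if \<Lambda>: "\<Lambda> \<in> prob_functionals" for \<Lambda>
  proof -
    obtain \<mu> where \<mu>: "\<mu> \<in> borel_prob_measures" "\<Lambda> = integral_functional \<mu>" using \<Lambda> by (rule prob_functionals_cases)
    interpret prob_space \<mu> using \<mu> by (simp add: borel_prob_measures_def)
    have sets: "sets \<mu> = sets borel" and space: "space \<mu> = UNIV"
      using \<mu>(1) sets_eq_imp_space_eq[of \<mu> borel] by (auto simp: borel_prob_measures_def)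
    have arg: "arg \<in> borel_measurable \<mu>" using measurable_arg sets by (simp cong: measurable_cong_sets)
    \<comment> \<open>\<open>s n\<close> rounds the angle down to a multiple of
      \<open>1 / Suc n\<close>, with index \<open>j n x\<close>, and \<open>A n i\<close> collects
      the points of index \<open>i\<close>. Since \<open>pi < 4\<close>, all indices lie in the
      finite set \<open>J n\<close>.\<close>
    define p where "p n j = e' (cis (real_of_int j / real (Suc n)))" for n j
    define j where "j n x = \<lfloor>real (Suc n) * arg x\<rfloor>" for n x
    define s where "s n x = p n (j n x)" for n x
    define J where "J n = {- 4 * int (Suc n)..4 * int (Suc n)}" for n
    define A where "A n i = {x. j n x = i}" for n i
    have jJ: "j n x \<in> J n" for n x
    proof -
      have "\<bar>arg x\<bar> \<le> 4" using arg_bounds[of x] pi_less_4 by (simp add: abs_le_iff)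
      then have "\<bar>real (Suc n) * arg x\<bar> \<le> 4 * real (Suc n)"
        unfolding abs_mult mult.commute[of 4] abs_of_nat by (intro mult_left_mono) auto
      then show ?thesis by (simp add: J_def j_def abs_le_iff floor_le_iff le_floor_iff)
    qed
    have jm: "j n \<in> measurable \<mu> (count_space UNIV)" for n
      unfolding j_def[abs_def] using arg by measurable
    have A: "A n i \<in> sets \<mu>" for n i
      using measurable_sets[OF jm[of n], of "{i}"] by (simp add: A_def space vimage_def)
    have sm: "s n \<in> measurable \<mu> borel" for n
      unfolding s_def[abs_def] by (rule measurable_compose[OF jm]) simp
    define \<Lambda>' where "\<Lambda>' n = integral_functional (distr \<mu> borel (s n))" for n
    have \<Lambda>'P: "\<Lambda>' n \<in> prob_functionals" for n
      using distr_in_borel_prob_measures[OF prob_space_axioms sm] by (auto simp: \<Lambda>'_def prob_functionals_def)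
    have \<Lambda>': "blinfun_apply (\<Lambda>' n) g = (\<integral>x. g (s n x) \<partial>\<mu>)" for n g
      unfolding \<Lambda>'_def by (rule integral_functional_distr[OF prob_space_axioms sm])
    have sum: "(\<integral>x. g (s n x) \<partial>\<mu>) = (\<Sum>i\<in>J n. measure \<mu> (A n i) * g (p n i))" for n and g :: "'x \<Rightarrow> real"
    proof -
      have "g (s n x) = (\<Sum>i\<in>J n. g (p n i) * indicator (A n i) x)" for x
      proof -
        have "(\<Sum>i\<in>J n. g (p n i) * indicator (A n i) x) = (\<Sum>i\<in>J n. if j n x = i then g (p n i) else 0)"
          by (intro sum.cong) (auto simp: A_def)
        also have "\<dots> = g (s n x)" using jJ[of n x] by (simp add: s_def J_def)
        finally show ?thesis by simp
      qed
      moreover have "integrable \<mu> (indicat_real (A n i))" for i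
        using A by (intro integrable_real_indicator) (auto simp: emeasure_eq_measure)
      ultimately show ?thesis
        using A by (simp add: Bochner_Integration.integral_sum mult.commute)
    qed
    have "H (\<Lambda>' n) = \<Lambda>' n f" for n
    proof -
      have eq: "\<Lambda>' n = (\<Sum>i\<in>J n. measure \<mu> (A n i) *\<^sub>R dirac (p n i))"
        by (rule blinfun_eqI) (simp add: \<Lambda>' sum blinfun.sum_left blinfun.scaleR_left dirac_apply)
      have "(\<Sum>i\<in>J n. measure \<mu> (A n i)) = 1" using sum[of "\<lambda>_. 1" n] by (simp add: prob_space)
      then have "H (\<Sum>i\<in>J n. measure \<mu> (A n i) *\<^sub>R dirac (p n i)) = (\<Sum>i\<in>J n. measure \<mu> (A n i) * H (dirac (p n i)))"
        by (intro finite_affine) (auto simp: J_def dirac_in_prob_functionals)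
      moreover have "\<Lambda>' n f = (\<Sum>i\<in>J n. measure \<mu> (A n i) * f (p n i))" by (simp only: \<Lambda>' sum)
      ultimately show ?thesis by (simp only: eq[symmetric] f)
    qed
    moreover have lim: "(\<lambda>n. \<Lambda>' n g) \<longlonglongrightarrow> \<Lambda> g" for g
    proof -
      have "(\<lambda>n. g (s n x)) \<longlonglongrightarrow> g x" for x
      proof -
        have "(\<lambda>n. real_of_int \<lfloor>real (Suc n) * arg x\<rfloor> / real (Suc n)) \<longlonglongrightarrow> arg x"
        proof (rule real_tendsto_sandwich)
          show "(\<lambda>n. arg x - inverse (real (Suc n))) \<longlonglongrightarrow> arg x"
            using tendsto_diff[OF tendsto_const LIMSEQ_inverse_real_of_nat, of "arg x"] by simp
          show "\<forall>\<^sub>F n in sequentially. arg x - inverse (real (Suc n)) \<le> real_of_int \<lfloor>real (Suc n) * arg x\<rfloor> / real (Suc n)"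
          proof (intro always_eventually allI)
            fix n
            have "real (Suc n) * arg x - 1 \<le> real_of_int \<lfloor>real (Suc n) * arg x\<rfloor>" by linarith
            then have "(real (Suc n) * arg x - 1) / real (Suc n) \<le> real_of_int \<lfloor>real (Suc n) * arg x\<rfloor> / real (Suc n)"
              by (intro divide_right_mono) auto
            then show "arg x - inverse (real (Suc n)) \<le> real_of_int \<lfloor>real (Suc n) * arg x\<rfloor> / real (Suc n)"
              by (simp add: diff_divide_distrib inverse_eq_divide del: of_nat_Suc)
          qed
          show "\<forall>\<^sub>F n in sequentially. real_of_int \<lfloor>real (Suc n) * arg x\<rfloor> / real (Suc n) \<le> arg x"
            by (intro always_eventually allI) (simp add: divide_le_eq mult.commute del: of_nat_Suc)
        qed simp
        moreover have "continuous_on UNIV (\<lambda>t. g (e' (cis t)))" by (intro continuous_intros) auto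
        ultimately have "(\<lambda>n. g (e' (cis (real_of_int \<lfloor>real (Suc n) * arg x\<rfloor> / real (Suc n))))) \<longlonglongrightarrow> g (e' (cis (arg x)))"
          using continuous_on_tendsto_compose[of UNIV "\<lambda>t. g (e' (cis t))"] by simp
        then show ?thesis by (simp add: s_def p_def j_def e'_cis_arg)
      qed
      then have "(\<lambda>n. \<integral>x. g (s n x) \<partial>\<mu>) \<longlonglongrightarrow> (\<integral>x. g x \<partial>\<mu>)"
      proof (intro integral_dominated_convergence[where w = "\<lambda>_. norm g"] AE_I2)
        show "apply_bcontfun g \<in> borel_measurable \<mu>" using integrable_bcontfun[OF \<mu>(1)] by blast
        show "(\<lambda>x. g (s n x)) \<in> borel_measurable \<mu>" for n
          by (rule measurable_compose[OF sm]) (auto intro: borel_measurable_continuous_onI)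
        show "norm (g (s n x)) \<le> norm g" for n x by (rule norm_bounded)
      qed auto
      then show ?thesis by (simp add: \<Lambda>' \<mu> integral_functional_apply)
    qed
    ultimately have "(\<lambda>n. H (\<Lambda>' n)) \<longlonglongrightarrow> \<Lambda> f" by simp
    moreover have "(\<lambda>n. H (\<Lambda>' n)) \<longlonglongrightarrow> H \<Lambda>"
      by (rule prob_topology_tendsto[OF H \<Lambda>'P \<Lambda> lim])
    ultimately show ?thesis by (rule LIMSEQ_unique[symmetric])
  qed
  then show thesis using that f by blast
qed

lemma affinely_prime_prob_functionals:
  assumes G: "topological_group G TG" and act: "group_action G UNIV \<phi>"
    and cont: "continuous_map (prod_topology TG euclidean) euclidean (\<lambda>(g, x :: 'x). \<phi> g x)"
    and LSW: "linear_stone_weierstrass (carrier G) \<phi>"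
  shows "affinely_prime TYPE('w::real_vector) weak_star_topology
      (prob_functionals :: (('x \<Rightarrow>\<^sub>C real) \<Rightarrow>\<^sub>L real) set) G TG (push_forward_action \<phi>)"
  unfolding affinely_prime_def
proof (intro conjI allI impI affine_system_prob_functionals[OF G act cont])
  fix T' :: "'w topology" and Q' \<phi>' and p :: "(('x \<Rightarrow>\<^sub>C real) \<Rightarrow>\<^sub>L real) \<Rightarrow> 'w"
  assume asm: "affine_dynamical_system T' Q' G TG \<phi>' \<and> (\<exists>x\<in>Q'. \<exists>y\<in>Q'. x \<noteq> y) \<and>
    affine_homomorphism weak_star_topology prob_functionals (push_forward_action \<phi>) T' Q' \<phi>' G p \<and>
    p ` prob_functionals = Q'"
  then obtain x y where xy: "x \<in> Q'" "y \<in> Q'" "x \<noteq> y" by blast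
  have lc: "locally_convex_tvs T'" and met: "metrizable_space (subtopology T' Q')"
    using asm by (auto simp: affine_dynamical_system_def dynamical_system_def)
  have pc: "continuous_map prob_topology (subtopology T' Q') p" and pa: "affine_map_on prob_functionals p"
    and pe: "\<And>g \<Lambda>. g \<in> carrier G \<Longrightarrow> \<Lambda> \<in> prob_functionals \<Longrightarrow> p (push_forward_action \<phi> g \<Lambda>) = \<phi>' g (p \<Lambda>)"
    and pQ: "p ` prob_functionals = Q'"
    using asm by (auto simp: affine_homomorphism_def)
  have c: "continuous_on UNIV (\<phi> g)" if "g \<in> carrier G" for g
    using continuous_map_prod_slice[OF cont, of g] that G by (simp add: topological_group_def)
  \<comment> \<open>Hausdorffness is available on \<open>Q'\<close>, which is metrizable, but not on
    \<open>T'\<close>; an open set of \<open>T'\<close> that contains \<open>x\<close> and misses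
    \<open>y\<close> suffices for the separation.\<close>
  obtain U where U: "openin T' U" "x \<in> U" "y \<notin> U"
  proof -
    have "Hausdorff_space (subtopology T' Q')" by (rule metrizable_imp_Hausdorff_space[OF met])
    moreover have "x \<in> topspace (subtopology T' Q')" "y \<in> topspace (subtopology T' Q')"
      using xy lc by (auto simp: locally_convex_tvs_def)
    ultimately obtain A B where "openin (subtopology T' Q') A" "x \<in> A" "y \<in> B" "disjnt A B"
      using xy(3) unfolding Hausdorff_space_def by metis
    then obtain U where "openin T' U" "A = U \<inter> Q'" by (auto simp: openin_subtopology)
    then show thesis using that \<open>x \<in> A\<close> \<open>y \<in> B\<close> \<open>disjnt A B\<close> xy(2) by (auto simp: disjnt_def)
  qed
  then obtain l :: "'w \<Rightarrow> real" where l: "linear l" "continuous_map T' euclideanreal l" "l x \<noteq> l y"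
    using locally_convex_separation[OF lc] by blast
  have lpc: "continuous_map prob_topology euclideanreal (\<lambda>\<Lambda>. l (p \<Lambda>))"
    using continuous_map_compose[OF pc continuous_map_from_subtopology[OF l(2)]] by (simp add: o_def)
  have lpa: "affine_map_on prob_functionals (\<lambda>\<Lambda>. l (p \<Lambda>))"
    using pa by (simp add: affine_map_on_def linear_add[OF l(1)] linear_cmul[OF l(1)])
  obtain f :: "'x \<Rightarrow>\<^sub>C real" where f: "\<And>\<Lambda>. \<Lambda> \<in> prob_functionals \<Longrightarrow> l (p \<Lambda>) = blinfun_apply \<Lambda> f"
    using affine_functional_representation[OF lpa lpc] by metis
  \<comment> \<open>Total mass 1 sends a constant function to its value, so a constant
    \<open>f\<close> would make \<open>l\<close> constant on \<open>Q'\<close>.\<close>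
  have nonconst: "\<nexists>c. \<forall>x. f x = c"
  proof
    assume "\<exists>c. \<forall>x. f x = c"
    then obtain c where "\<And>x. f x = c" by blast
    then have "f = c *\<^sub>R const_bcontfun 1" by (intro bcontfun_eqI) simp
    then have "l (p \<Lambda>) = c" if "\<Lambda> \<in> prob_functionals" for \<Lambda>
      using f[OF that] prob_functional_one[OF that] by (simp add: blinfun.scaleR_right)
    then have "l z = c" if "z \<in> Q'" for z using that pQ by auto
    then show False using xy l(3) by simp
  qed
  let ?B = "{h. \<exists>g\<in>carrier G. \<forall>x. apply_bcontfun h x = f (\<phi> g x)} \<union> {const_bcontfun 1}"
  have dense: "closure (span ?B) = UNIV"
    using LSW nonconst unfolding linear_stone_weierstrass_def by blast
  show "inj_on p prob_functionals"
  proof (rule inj_onI)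
    fix \<Lambda> M :: "('x \<Rightarrow>\<^sub>C real) \<Rightarrow>\<^sub>L real"
    assume P: "\<Lambda> \<in> prob_functionals" "M \<in> prob_functionals" and eq: "p \<Lambda> = p M"
    have B: "blinfun_apply \<Lambda> h = blinfun_apply M h" if "h \<in> ?B" for h
    proof (cases "h = const_bcontfun 1")
      case True
      then show ?thesis using P by (simp add: prob_functional_one)
    next
      case False
      then have "h \<in> {h. \<exists>g\<in>carrier G. \<forall>x. apply_bcontfun h x = f (\<phi> g x)}" using that by blast
      then obtain g where g: "g \<in> carrier G" "\<And>x. h x = f (\<phi> g x)" by blast
      have h: "h = compose_bcontfun f (\<phi> g)"
        by (rule bcontfun_eqI) (simp add: g(2) compose_bcontfun[OF c[OF g(1)]])
      \<comment> \<open>By equivariance the value of \<open>N\<close> at a translate of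
        \<open>f\<close> is \<open>l (\<phi>' g (p N))\<close>, which depends on \<open>N\<close>
        only through \<open>p N\<close>.\<close>
      have "blinfun_apply N h = l (\<phi>' g (p N))" if N: "N \<in> prob_functionals" for N
        unfolding h push_forward_action(2)[of \<phi> g, OF c[OF g(1)] N, symmetric]
        using f[OF push_forward_action(1)[of \<phi> g, OF c[OF g(1)] N]] pe[OF g(1) N] by simp
      then show ?thesis using P eq by simp
    qed
    have "subspace {h. blinfun_apply \<Lambda> h = blinfun_apply M h}"
      by (rule subspaceI) (simp_all add: blinfun.add_right blinfun.scaleR_right)
    then have "span ?B \<subseteq> {h. blinfun_apply \<Lambda> h = blinfun_apply M h}"
      using B by (intro span_minimal) blast+
    moreover have "closed {h. blinfun_apply \<Lambda> h = blinfun_apply M h}"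
      by (intro closed_Collect_eq) (auto intro!: continuous_intros)
    ultimately have "closure (span ?B) \<subseteq> {h. blinfun_apply \<Lambda> h = blinfun_apply M h}"
      by (rule closure_minimal)
    then show "\<Lambda> = M" unfolding dense by (intro blinfun_eqI) blast
  qed
qed

end

lemma dynamical_system_proj_line:
  "dynamical_system (euclidean :: proj_line topology) PSL2R PSL2R_topology PSL2R_action"
proof -
  obtain e' where h: "homeomorphism UNIV (sphere 0 1) line_direction e'" using homeomorphism_proj_line by blast
  then interpret circle_homeomorphism line_direction e' by unfold_locales
  have "homeomorphic_maps euclidean (top_of_set (sphere 0 1)) line_direction e'"
    using h by (auto simp: homeomorphic_maps_def homeomorphism_def continuous_map_in_subtopology)
  then have met: "metrizable_space (euclidean :: proj_line topology)"
    using homeomorphic_metrizable_space[OF homeomorphic_maps_imp_homeomorphic_space]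
      metrizable_space_subtopology[OF metrizable_space_euclidean] by blast
  have "compact_space (euclidean :: proj_line topology)" using compact_UNIV by (simp add: compact_space_def)
  then show ?thesis
    unfolding dynamical_system_def
    using met topological_group_PSL2R group_action_PSL2R topspace_PSL2R continuous_map_PSL2R_action
    by (auto intro: continuous_map_Homeo_topology)
qed

theorem theorem2p1:
  shows "affinely_prime_system TYPE('w::real_vector) PSL2R PSL2R_topology PSL2R_action \<and>
         linear_stone_weierstrass disk_moebius_group circle_action"
proof -
  obtain e' where "homeomorphism UNIV (sphere 0 1) line_direction e'" using homeomorphism_proj_line by blast
  then interpret circle_homeomorphism line_direction e' by unfold_locales
  show ?thesis
    unfolding affinely_prime_system_def
    using dynamical_system_proj_line linear_stone_weierstrass_circle_action
      affinely_prime_prob_functionals[OF topological_group_PSL2R group_action_PSL2R continuous_map_PSL2R_action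
        linear_stone_weierstrass_PSL2R]
    by blast
qed

end
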